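(* Let $k\ge2$ be an integer and $\varepsilon,\varphi\in(0,1)$ with $\frac{\varepsilon}{\varphi^2}\le\frac{1}{10^5}$. Let $G=(V,E)$ be a $d$-regular $(k,\varphi,\varepsilon)$-clusterable graph on $n$ vertices. Let $\frac{1}{n^5}<\xi<1$ and $1\le M_{\mathrm{init}},M_{\mathrm{query}}\le O\!\left(\frac{n^{1/2-20\varepsilon/\varphi^2}}{k}\right)$. Then, with probability at least $1-2n^{-100}$, $\textsc{InitOracle}(G,k,\xi,M_{\mathrm{init}})$ computes a matrix $\Psi$ of size $n^{O(\varepsilon/\varphi^2)}\cdot\log^2 n\cdot(k/\xi)^{O(1)}$ such that for every pair of vertices $x,y\in V$, $\textsc{QueryDot}(G,x,y,\xi,\Psi,M_{\mathrm{query}})$ outputs a value $\langle f_x,f_y\rangle_{\mathrm{apx}}$ satisfying, with probability at least $1-6n^{-100}$, $$\left|\langle f_x,f_y\rangle_{\mathrm{apx}}-\langle f_x,f_y\rangle\right|\le\frac{\xi}{n}.$$ Moreover, the space $S_{\mathrm{init}}$ (in bits) and time $T_{\mathrm{init}}$ of $\textsc{InitOracle}$ and the space $S_{\mathrm{query}}$ and time $T_{\mathrm{query}}$ of a single $\textsc{QueryDot}$ call satisfy $S_{\mathrm{init}}=(k/\xi)^{O(1)}n^{O(\varepsilon/\varphi^2)}M_{\mathrm{init}}\log^4 n$, $T_{\mathrm{init}}=(k/\xi)^{O(1)}n^{1+O(\varepsilon/\varphi^2)}\frac{\log^4 n}{M_{\mathrm{init}}}\cdot\frac{1}{\varphi^2}$,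 $S_{\mathrm{query}}=(k/\xi)^{O(1)}n^{O(\varepsilon/\varphi^2)}M_{\mathrm{query}}\log^3 n$, $T_{\mathrm{query}}=(k/\xi)^{O(1)}n^{1+O(\varepsilon/\varphi^2)}\frac{\log^3 n}{M_{\mathrm{query}}}\cdot\frac{1}{\varphi^2}$.
   Context: $G$ is $(k,\varphi,\varepsilon)$-clusterable if $V$ has a partition $C_1,\dots,C_k$ with inner conductance $\phi_{\mathrm{in}}(C_i)\ge\varphi$, outer conductance $\phi_{\mathrm{out}}(C_i,V)\le\varepsilon$, and $|C_i|/|C_j|\in O(1)$; here $\phi_{\mathrm{out}}(C,V)=|E(C,V\setminus C)|/\mathrm{vol}(C)$, $\mathrm{vol}(C)=\sum_{v\in C}d_v$, and $\phi_{\mathrm{in}}(C)=\min_{S\subseteq C,0<\mathrm{vol}(S)\le\mathrm{vol}(C)/2}\phi_{\mathrm{out}}(S,C)$. Let $A$ be the adjacency matrix, $L=I-A/d$ the normalized Laplacian with eigenvalues $0=\lambda_1\le\dots\le\lambda_n$ and orthonormal eigenvectors $u_1,\dots,u_n$; the spectral embedding of $x$ is $f_x=(u_1(x),\dots,u_k(x))^T\in\mathbb{R}^k$. $\mathbf M=\frac12(I+A/d)$ is the lazy random walk transition matrix; $\mathbb 1_x$ is the indicator vector of $x$. Algorithms. $\textsc{EstRWDot}(G,R,t,M,x,y)$: for each of $B=R/M$ batches, run $M$ independent lazy random walks of length $t$ from $x$ and $M$ from $y$, let $\hat p_x(i)$ (resp. $\hat p_y(i)$) be the fraction of walks from $x$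 (resp. $y$) ending at $i$, and set $Z_b=\langle\hat p_x,\hat p_y\rangle$; output $Z=\frac1B\sum_b Z_b$ (only the current batch's endpoints are stored). $\textsc{EstColliProb}(G,R,t,M,I_S)$, for a multiset $I_S=\{s_1,\dots,s_s\}$: for $l=1,\dots,O(\log n)$ set $\mathcal G_l(i,j)=\mathcal G_l(j,i)=\textsc{EstRWDot}(G,R,t,M,s_i,s_j)$ for $i\le j$; output the entrywise median $\mathcal G\in\mathbb R^{s\times s}$. $\textsc{InitOracle}(G,k,\xi,M_{\mathrm{init}})$: $t=\frac{20\log n}{\varphi^2}$, $R_{\mathrm{init}}=\Theta\!\left(\frac{n^{1+920\varepsilon/\varphi^2}}{M_{\mathrm{init}}}\frac{k^{14}}{\xi^2}\right)$, $s=O(n^{480\varepsilon/\varphi^2}\log n\,k^8/\xi^2)$; sample a multiset $I_S$ of $s$ vertices independently and uniformly at random; $\mathcal G=\textsc{EstColliProb}(G,R_{\mathrm{init}},t,M_{\mathrm{init}},I_S)$; take an eigendecomposition $\frac ns\mathcal G=\widehat W\widehat\Sigma\widehat W^T$; if $\widehat\Sigma^{-1}$ exists, output $\Psi=\frac ns\widehat W_{[k]}\widehat\Sigma_{[k]}^{-2}\widehat W_{[k]}^T$, where $_{[k]}$ denotes restriction to the first $k$ eigenvalues/columns. $\textsc{QueryDot}(G,x,y,\xi,\Psi,M_{\mathrm{query}})$: $t$ as before, $R_{\mathrm{query}}=\Theta\!\left(\frac{n^{1+440\varepsilon/\varphi^2}}{M_{\mathrm{query}}}\frac{k^6}{\xi^2}\right)$;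 for $l=1,\dots,O(\log n)$ and $i=1,\dots,s$ set $x_l(i)=\textsc{EstRWDot}(G,R_{\mathrm{query}},t,M_{\mathrm{query}},x,s_i)$, $y_l(i)=\textsc{EstRWDot}(G,R_{\mathrm{query}},t,M_{\mathrm{query}},y,s_i)$; let $\alpha_x,\alpha_y$ be entrywise medians; output $\langle f_x,f_y\rangle_{\mathrm{apx}}=\alpha_x^T\Psi\alpha_y$.
   Formalization: InitOracle's test "if Σ̂⁻¹ exists" is applied to Σ̂_[k], the only block that is inverted; with the full s×s Σ̂ the claim fails, e.g. for two disjoint cliques with constant ξ, where the medians make 𝒢 block-constant of rank 2 with high probability. *)

theory Defs
  imports
    "HOL-Probability.Probability"
    "Jordan_Normal_Form.Gauss_Jordan_Elimination"
begin

hide_const (open) Finite_Cartesian_Product.vec Finite_Cartesian_Product.mat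
hide_type (open) Finite_Cartesian_Product.vec
unbundle no vec_syntax
unbundle no inner_syntax

section \<open>Graphs, conductance, clusterability\<close>

text \<open>A graph on \<open>n\<close> vertices has vertex set \<open>{..<n}\<close> and is given by its adjacency relation.\<close>

type_synonym edges = "nat \<Rightarrow> nat \<Rightarrow> bool"

definition graph :: "nat \<Rightarrow> edges \<Rightarrow> bool" where
  "graph n E \<longleftrightarrow>
     (\<forall>u v. E u v \<longrightarrow> u < n \<and> v < n) \<and> (\<forall>u v. E u v \<longrightarrow> E v u) \<and> (\<forall>v. \<not> E v v)"

definition deg :: "edges \<Rightarrow> nat \<Rightarrow> nat" where
  "deg E v = card {u. E v u}"

definition regular_graph :: "nat \<Rightarrow> nat \<Rightarrow> edges \<Rightarrow> bool" where
  "regular_graph n d E \<longleftrightarrow> graph n E \<and> d \<ge> 1 \<and> (\<forall>v<n. deg E v = d)"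

definition vol :: "edges \<Rightarrow> nat set \<Rightarrow> nat" where
  "vol E C = (\<Sum>v\<in>C. deg E v)"

definition cut_edges :: "edges \<Rightarrow> nat set \<Rightarrow> nat set \<Rightarrow> (nat \<times> nat) set" where
  "cut_edges E S T = {(u, v). u \<in> S \<and> v \<in> T \<and> E u v}"

definition outer_conductance :: "edges \<Rightarrow> nat set \<Rightarrow> nat set \<Rightarrow> real" where
  "outer_conductance E S C = real (card (cut_edges E S (C - S))) / real (vol E S)"

text \<open>The minimum is an infimum over a finite set of reals, taken in \<^typ>\<open>ereal\<close> so that it is
  \<open>\<infinity>\<close> when no set \<open>S\<close> is admissible (e.g. for a singleton cluster).\<close>

definition inner_conductance :: "edges \<Rightarrow> nat set \<Rightarrow> ereal" where
  "inner_conductance E C =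
     (INF S \<in> {S. S \<subseteq> C \<and> 0 < vol E S \<and> real (vol E S) \<le> real (vol E C) / 2}.
        ereal (outer_conductance E S C))"

text \<open>\<open>\<beta>\<close> is the constant behind the requirement \<open>|C\<^sub>i| / |C\<^sub>j| \<in> O(1)\<close>.\<close>

definition clusterable :: "real \<Rightarrow> nat \<Rightarrow> real \<Rightarrow> real \<Rightarrow> nat \<Rightarrow> edges \<Rightarrow> bool" where
  "clusterable \<beta> k \<phi> \<epsilon> n E \<longleftrightarrow>
     (\<exists>C :: nat \<Rightarrow> nat set.
        (\<forall>i<k. C i \<noteq> {}) \<and> disjoint_family_on C {..<k} \<and> (\<Union>i<k. C i) = {..<n} \<and>
        (\<forall>i<k. inner_conductance E (C i) \<ge> ereal \<phi>) \<and>
        (\<forall>i<k. outer_conductance E (C i) {..<n} \<le> \<epsilon>) \<and>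
        (\<forall>i<k. \<forall>j<k. real (card (C i)) / real (card (C j)) \<le> \<beta>))"

section \<open>Spectral embedding\<close>

definition adjacency :: "nat \<Rightarrow> edges \<Rightarrow> real mat" where
  "adjacency n E = mat n n (\<lambda>(i, j). if E i j then 1 else 0)"

definition laplacian :: "nat \<Rightarrow> nat \<Rightarrow> edges \<Rightarrow> real mat" where
  "laplacian n d E = 1\<^sub>m n - (1 / real d) \<cdot>\<^sub>m adjacency n E"

definition ordered_eigenbasis :: "nat \<Rightarrow> real mat \<Rightarrow> (nat \<Rightarrow> real) \<Rightarrow> (nat \<Rightarrow> real vec) \<Rightarrow> bool" where
  "ordered_eigenbasis n A lam u \<longleftrightarrow>
     (\<forall>i<n. u i \<in> carrier_vec n \<and> A *\<^sub>v u i = lam i \<cdot>\<^sub>v u i) \<and>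
     (\<forall>i<n. \<forall>j<n. u i \<bullet> u j = (if i = j then 1 else 0)) \<and>
     (\<forall>i j. i \<le> j \<and> j < n \<longrightarrow> lam i \<le> lam j)"

definition spectral_embedding :: "nat \<Rightarrow> (nat \<Rightarrow> real vec) \<Rightarrow> nat \<Rightarrow> real vec" where
  "spectral_embedding k u x = vec k (\<lambda>i. u i $ x)"

section \<open>Randomized computations with time and space\<close>

text \<open>An outcome consists of a value, the number of elementary operations performed, and the peak
  number of bits of working memory. Memory follows a stack discipline: \<open>with_space b m\<close> keeps \<open>b\<close>
  bits reserved while \<open>m\<close> runs and releases them afterwards, so values that survive a call are paid
  for by the caller. The graph is accessed through neighbour queries and is not charged.\<close>

datatype 'a comp = Comp (run: "('a \<times> nat \<times> nat) pmf")

definition ret :: "'a \<Rightarrow> 'a comp" where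
  "ret a = Comp (return_pmf (a, 0, 0))"

definition bind_comp :: "'a comp \<Rightarrow> ('a \<Rightarrow> 'b comp) \<Rightarrow> 'b comp" where
  "bind_comp m f = Comp (bind_pmf (run m) (\<lambda>(a, T, S).
     map_pmf (\<lambda>(b, T', S'). (b, T + T', max S S')) (run (f a))))"

adhoc_overloading Monad_Syntax.bind \<rightleftharpoons> bind_comp

definition tick :: "nat \<Rightarrow> unit comp" where
  "tick T = Comp (return_pmf ((), T, 0))"

definition draw :: "'a pmf \<Rightarrow> 'a comp" where
  "draw p = Comp (map_pmf (\<lambda>a. (a, 1, 0)) p)"

definition with_space :: "nat \<Rightarrow> 'a comp \<Rightarrow> 'a comp" where
  "with_space b m = Comp (map_pmf (\<lambda>(a, T, S). (a, T, b + S)) (run m))"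

primrec for_each :: "('a \<Rightarrow> 'b comp) \<Rightarrow> 'a list \<Rightarrow> 'b list comp" where
  "for_each f [] = ret []"
| "for_each f (x # xs) = do { y \<leftarrow> f x; ys \<leftarrow> for_each f xs; ret (y # ys) }"

primrec accumulate :: "nat \<Rightarrow> real comp \<Rightarrow> real \<Rightarrow> real comp" where
  "accumulate 0 m acc = ret acc"
| "accumulate (Suc b) m acc = do { z \<leftarrow> m; tick 1; accumulate b m (acc + z) }"

definition result :: "'a comp \<Rightarrow> 'a pmf" where
  "result m = map_pmf fst (run m)"

text \<open>Vertices, counters and numbers each occupy one machine word of \<open>\<Theta>(log n)\<close> bits, with hidden
  constant \<open>cw\<close>.\<close>

definition word :: "nat \<Rightarrow> nat \<Rightarrow> nat" where
  "word cw n = cw * nat \<lceil>log 2 (real n)\<rceil>"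

definition sort_time :: "nat \<Rightarrow> nat" where
  "sort_time m = m * (nat \<lceil>log 2 (real m)\<rceil> + 1)"

section \<open>The algorithms\<close>

text \<open>One step has transition matrix \<open>(I + A/d)/2\<close> and costs one operation.\<close>

definition lazy_step :: "edges \<Rightarrow> nat \<Rightarrow> nat pmf" where
  "lazy_step E v =
     bind_pmf (bernoulli_pmf (1/2)) (\<lambda>stay. if stay then return_pmf v else pmf_of_set {u. E v u})"

primrec lazy_walk :: "edges \<Rightarrow> nat \<Rightarrow> nat \<Rightarrow> nat comp" where
  "lazy_walk E 0 v = ret v"
| "lazy_walk E (Suc t) v = do { u \<leftarrow> draw (lazy_step E v); lazy_walk E t u }"

definition empirical :: "nat list \<Rightarrow> nat \<Rightarrow> real" where
  "empirical xs i = real (count_list xs i) / real (length xs)"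

text \<open>The inner product of the two empirical distributions is charged as sorting both lists of
  endpoints followed by one merging pass.\<close>

definition rw_batch :: "nat \<Rightarrow> edges \<Rightarrow> nat \<Rightarrow> nat \<Rightarrow> nat \<Rightarrow> nat \<Rightarrow> real comp" where
  "rw_batch n E t M x y = do {
     xs \<leftarrow> for_each (\<lambda>_. lazy_walk E t x) [0..<M];
     ys \<leftarrow> for_each (\<lambda>_. lazy_walk E t y) [0..<M];
     tick (2 * sort_time M + 2 * M);
     ret (\<Sum>i<n. empirical xs i * empirical ys i)
   }"

text \<open>The reserved space holds the \<open>2 M\<close> endpoints of the current batch and a constant number of
  registers (loop counters, current vertex, accumulator).\<close>

definition est_rw_dot ::
    "nat \<Rightarrow> nat \<Rightarrow> edges \<Rightarrow> real \<Rightarrow> nat \<Rightarrow> nat \<Rightarrow> nat \<Rightarrow> nat \<Rightarrow> real comp" where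
  "est_rw_dot cw n E R t M x y =
     (let B = nat \<lceil>R / real M\<rceil> in
      with_space (word cw n * (2 * M + 8)) (do {
        z \<leftarrow> accumulate B (rw_batch n E t M x y) 0;
        tick 1;
        ret (z / real B)
      }))"

definition median :: "real list \<Rightarrow> real" where
  "median xs = sort xs ! (length xs div 2)"

text \<open>\<open>reps\<close> is the number of repetitions, \<open>O(log n)\<close>. The triangular array \<open>rows\<close> holds the
  estimates for \<open>i \<le> j\<close>, from which the symmetric matrix \<open>\<G>\<^sub>l\<close> is read off. The reserved space holds
  all matrices \<open>\<G>\<^sub>l\<close> and one array for computing medians.\<close>

definition est_colli_prob ::
    "nat \<Rightarrow> nat \<Rightarrow> edges \<Rightarrow> nat \<Rightarrow> real \<Rightarrow> nat \<Rightarrow> nat \<Rightarrow> nat list \<Rightarrow> real mat comp" where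
  "est_colli_prob cw n E reps R t M IS =
     (let s = length IS in
      with_space (word cw n * (reps * s\<^sup>2 + reps + 8)) (do {
        Gs \<leftarrow> for_each (\<lambda>l. do {
                rows \<leftarrow> for_each (\<lambda>i. for_each (\<lambda>j. est_rw_dot cw n E R t M (IS ! i) (IS ! j)) [i..<s])
                          [0..<s];
                ret (mat s s (\<lambda>(i, j). rows ! min i j ! (max i j - min i j)))
              }) [0..<reps];
        tick (s\<^sup>2 * sort_time reps);
        ret (mat s s (\<lambda>(i, j). median (map (\<lambda>G. G $$ (i, j)) Gs)))
      }))"

text \<open>Some eigendecomposition \<open>A = W \<Sigma> W\<^sup>T\<close> of every real symmetric matrix, with the eigenvalues in
  decreasing order.\<close>

definition eigensolver :: "(real mat \<Rightarrow> real mat \<times> real mat) \<Rightarrow> bool" where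
  "eigensolver eig \<longleftrightarrow>
     (\<forall>m A. A \<in> carrier_mat m m \<and> transpose_mat A = A \<longrightarrow>
        (case eig A of (W, D) \<Rightarrow>
           W \<in> carrier_mat m m \<and> D \<in> carrier_mat m m \<and>
           W * transpose_mat W = 1\<^sub>m m \<and> transpose_mat W * W = 1\<^sub>m m \<and>
           diagonal_mat D \<and> (\<forall>i j. i \<le> j \<and> j < m \<longrightarrow> D $$ (j, j) \<le> D $$ (i, i)) \<and>
           A = W * D * transpose_mat W))"

text \<open>The constants hidden in \<open>s\<close>, \<open>R\<^sub>i\<^sub>n\<^sub>i\<^sub>t\<close>, \<open>R\<^sub>q\<^sub>u\<^sub>e\<^sub>r\<^sub>y\<close> and in the number of repetitions.\<close>

record hidden =
  c_s :: real
  c_init :: real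
  c_query :: real
  c_reps :: real

definition positive_hidden :: "hidden \<Rightarrow> bool" where
  "positive_hidden H \<longleftrightarrow> c_s H > 0 \<and> c_init H > 0 \<and> c_query H > 0 \<and> c_reps H > 0"

definition walk_length :: "nat \<Rightarrow> real \<Rightarrow> nat" where
  "walk_length n \<phi> = nat \<lceil>20 * ln (real n) / \<phi>\<^sup>2\<rceil>"

definition repetitions :: "hidden \<Rightarrow> nat \<Rightarrow> nat" where
  "repetitions H n = nat \<lceil>c_reps H * ln (real n)\<rceil>"

definition sample_size :: "hidden \<Rightarrow> nat \<Rightarrow> nat \<Rightarrow> real \<Rightarrow> real \<Rightarrow> real \<Rightarrow> nat" where
  "sample_size H n k \<phi> \<epsilon> \<xi> =
     nat \<lceil>c_s H * (real n powr (480 * \<epsilon> / \<phi>\<^sup>2) * ln (real n) * real k ^ 8 / \<xi>\<^sup>2)\<rceil>"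

definition R_init :: "hidden \<Rightarrow> nat \<Rightarrow> nat \<Rightarrow> real \<Rightarrow> real \<Rightarrow> real \<Rightarrow> nat \<Rightarrow> real" where
  "R_init H n k \<phi> \<epsilon> \<xi> M =
     c_init H * (real n powr (1 + 920 * \<epsilon> / \<phi>\<^sup>2) / real M * (real k ^ 14 / \<xi>\<^sup>2))"

definition R_query :: "hidden \<Rightarrow> nat \<Rightarrow> nat \<Rightarrow> real \<Rightarrow> real \<Rightarrow> real \<Rightarrow> nat \<Rightarrow> real" where
  "R_query H n k \<phi> \<epsilon> \<xi> M =
     c_query H * (real n powr (1 + 440 * \<epsilon> / \<phi>\<^sup>2) / real M * (real k ^ 6 / \<xi>\<^sup>2))"

text \<open>The oracle consists of the sampled multiset, as a list, and of \<open>\<Psi>\<close>; no \<open>\<Psi>\<close> is output if the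
  diagonal matrix of the \<open>k\<close> largest eigenvalues is singular. The eigendecomposition of an
  \<open>s \<times> s\<close> matrix is charged \<open>ce s\<^sup>3\<close> operations and \<open>ce s\<^sup>2\<close> words. The reserved space holds the
  sample, \<open>\<G>\<close>, \<open>\<Psi>\<close>, the eigendecomposition, and an \<open>s \<times> k\<close> intermediate product.\<close>

definition init_oracle ::
    "hidden \<Rightarrow> nat \<Rightarrow> nat \<Rightarrow> (real mat \<Rightarrow> real mat \<times> real mat) \<Rightarrow> nat \<Rightarrow> edges \<Rightarrow>
     nat \<Rightarrow> real \<Rightarrow> real \<Rightarrow> real \<Rightarrow> nat \<Rightarrow> (nat list \<times> real mat option) comp" where
  "init_oracle H cw ce eig n E k \<phi> \<epsilon> \<xi> M =
     (let t = walk_length n \<phi>;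
          R = R_init H n k \<phi> \<epsilon> \<xi> M;
          s = sample_size H n k \<phi> \<epsilon> \<xi>
      in with_space (word cw n * (s + 2 * s\<^sup>2 + ce * s\<^sup>2 + s * k + 8)) (do {
        IS \<leftarrow> for_each (\<lambda>_. draw (pmf_of_set {..<n})) [0..<s];
        G \<leftarrow> est_colli_prob cw n E (repetitions H n) R t M IS;
        let (W, D) = eig ((real n / real s) \<cdot>\<^sub>m G);
        tick (s\<^sup>2 + ce * s ^ 3);
        let Wk = mat s k (\<lambda>(i, j). W $$ (i, j));
        let Dk = mat k k (\<lambda>(i, j). D $$ (i, j));
        tick (k + s * k + s\<^sup>2 * k + s\<^sup>2);
        ret (IS, case mat_inverse Dk of
                   None \<Rightarrow> None
                 | Some Di \<Rightarrow> Some ((real n / real s) \<cdot>\<^sub>m (Wk * (Di * Di) * transpose_mat Wk)))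
      }))"

text \<open>The reserved space includes the oracle itself (sample and \<open>\<Psi>\<close>), besides the arrays
  \<open>x\<^sub>l, y\<^sub>l\<close>, their medians, and one array for computing medians.\<close>

definition query_dot ::
    "hidden \<Rightarrow> nat \<Rightarrow> nat \<Rightarrow> edges \<Rightarrow> nat \<Rightarrow> real \<Rightarrow> real \<Rightarrow> real \<Rightarrow>
     nat list \<Rightarrow> real mat \<Rightarrow> nat \<Rightarrow> nat \<Rightarrow> nat \<Rightarrow> real comp" where
  "query_dot H cw n E k \<phi> \<epsilon> \<xi> IS \<Psi> M x y =
     (let t = walk_length n \<phi>;
          R = R_query H n k \<phi> \<epsilon> \<xi> M;
          reps = repetitions H n;
          s = length IS
      in with_space (word cw n * (s + s\<^sup>2 + 2 * reps * s + 2 * s + reps + 8)) (do {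
        rows \<leftarrow> for_each (\<lambda>l. for_each (\<lambda>i. do {
                  a \<leftarrow> est_rw_dot cw n E R t M x (IS ! i);
                  b \<leftarrow> est_rw_dot cw n E R t M y (IS ! i);
                  ret (a, b)
                }) [0..<s]) [0..<reps];
        tick (2 * s * sort_time reps);
        let \<alpha>x = vec s (\<lambda>i. median (map (\<lambda>r. fst (r ! i)) rows));
        let \<alpha>y = vec s (\<lambda>i. median (map (\<lambda>r. snd (r ! i)) rows));
        tick (2 * s\<^sup>2 + 2 * s);
        ret (\<alpha>x \<bullet> (\<Psi> *\<^sub>v \<alpha>y))
      }))"

end

theory Submission
  imports Defs "Jordan_Normal_Form.Determinant"
begin

text \<open>
  Write \<open>\<nu> = n powr (\<epsilon> / \<phi>\<^sup>2)\<close>. Testing the Laplacian on the cluster indicators gives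
  \<open>\<lambda>\<^sub>k \<le> 2 \<epsilon>\<close>, and Cheeger's inequality inside each cluster gives \<open>\<lambda>\<^sub>k\<^sub>+\<^sub>1 \<ge> \<phi>\<^sup>2 / 2\<close>. Hence after
  \<open>20 ln n / \<phi>\<^sup>2\<close> lazy steps the top part of the spectrum is damped by at most a power of \<open>\<nu>\<close>, and
  the rest by \<open>n\<^sup>-\<^sup>1\<^sup>0\<close>. Superlevel sets of an eigenvector with eigenvalue at most \<open>2 \<epsilon>\<close> grow by a
  factor \<open>1 + \<phi> / 2\<close> whenever the level drops by a factor \<open>1 - 8 \<epsilon> / \<phi>\<close>, so its entries are at
  most \<open>O(\<nu>\<^sup>3\<^sup>0 sqrt (k / n))\<close>. This sup-norm bound controls the variance of the collision estimates
  and the number of samples.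

  Let \<open>A\<close> be the \<open>s \<times> k\<close> matrix of the rescaled embedded sample points and \<open>D\<close> the diagonal matrix of
  the top \<open>k\<close> eigenvalues of the \<open>2 t\<close>-step walk. By Hoeffding's inequality \<open>A\<^sup>T A\<close> is close to the
  identity. The rescaled estimated Gram matrix is \<open>G = A D A\<^sup>T + N\<close> and the rescaled query vector is
  \<open>b = A D f + e\<close> with \<open>N\<close> and \<open>e\<close> small. If \<open>A\<^sup>T A w = f\<close> and \<open>\<omega> = A w\<close> then
  \<open>b = G \<omega> + (e - N \<omega>)\<close>, so applying the truncated inverse of \<open>G\<close> to \<open>b\<close> recovers \<open>\<omega>\<close> up to a small
  error, and \<open>\<omega>\<^sub>x \<bullet> \<omega>\<^sub>y = w\<^sub>x \<bullet> f\<^sub>y\<close> is close to \<open>f\<^sub>x \<bullet> f\<^sub>y\<close>.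
\<close>

section \<open>Vectors and matrices as functions\<close>

definition dot :: "nat \<Rightarrow> (nat \<Rightarrow> real) \<Rightarrow> (nat \<Rightarrow> real) \<Rightarrow> real" where
  "dot n x y = (\<Sum>i<n. x i * y i)"

abbreviation l2norm :: "nat \<Rightarrow> (nat \<Rightarrow> real) \<Rightarrow> real" where
  "l2norm n x \<equiv> L2_set x {..<n}"

definition mul_vec :: "nat \<Rightarrow> (nat \<Rightarrow> nat \<Rightarrow> real) \<Rightarrow> (nat \<Rightarrow> real) \<Rightarrow> nat \<Rightarrow> real" where
  "mul_vec n A x i = (\<Sum>j<n. A i j * x j)"

abbreviation (input) transposed :: "(nat \<Rightarrow> nat \<Rightarrow> real) \<Rightarrow> nat \<Rightarrow> nat \<Rightarrow> real" where
  "transposed A \<equiv> \<lambda>i j. A j i"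

lemma dot_commute: "dot n x y = dot n y x"
  by (simp add: dot_def mult.commute)

lemma dot_cong: "(\<And>i. i < n \<Longrightarrow> x i = x' i) \<Longrightarrow> (\<And>i. i < n \<Longrightarrow> y i = y' i) \<Longrightarrow> dot n x y = dot n x' y'"
  by (simp add: dot_def)

lemma dot_add_left: "dot n (\<lambda>i. x i + y i) z = dot n x z + dot n y z"
  by (simp add: dot_def distrib_right sum.distrib)

lemma dot_add_right: "dot n z (\<lambda>i. x i + y i) = dot n z x + dot n z y"
  by (simp add: dot_def distrib_left sum.distrib)

lemma dot_self: "dot n x x = (l2norm n x)\<^sup>2"
  by (simp add: dot_def L2_set_def power2_eq_square[symmetric] sum_nonneg)

lemma l2norm_sq: "(l2norm n x)\<^sup>2 = (\<Sum>i<n. (x i)\<^sup>2)"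
  by (simp add: L2_set_def sum_nonneg)

lemma l2norm_pos_iff: "0 < l2norm n x \<longleftrightarrow> (\<exists>i<n. x i \<noteq> 0)"
  using L2_set_nonneg[of x "{..<n}"] L2_set_eq_0_iff[of "{..<n}" x] by (auto simp: order_less_le)

lemma abs_dot_le: "\<bar>dot n x y\<bar> \<le> l2norm n x * l2norm n y"
proof -
  have "\<bar>dot n x y\<bar> \<le> (\<Sum>i<n. \<bar>x i\<bar> * \<bar>y i\<bar>)"
    unfolding dot_def by (rule order_trans[OF sum_abs]) (simp add: abs_mult)
  also have "\<dots> \<le> l2norm n x * l2norm n y" by (rule L2_set_mult_ineq)
  finally show ?thesis .
qed

lemma abs_dot_perturbed_le:
  fixes c r :: real
  assumes x: "l2norm n x \<le> c" and y: "l2norm n y \<le> c"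
    and dx: "l2norm n (\<lambda>i. x' i - x i) \<le> r" and dy: "l2norm n (\<lambda>i. y' i - y i) \<le> r"
  shows "\<bar>dot n x' y' - dot n x y\<bar> \<le> 2 * c * r + r\<^sup>2"
proof -
  let ?dx = "\<lambda>i. x' i - x i" and ?dy = "\<lambda>i. y' i - y i"
  have nonneg: "0 \<le> c" "0 \<le> r" using order_trans[OF L2_set_nonneg x] order_trans[OF L2_set_nonneg dx] by auto
  have "dot n x' y' = dot n (\<lambda>i. x i + ?dx i) (\<lambda>i. y i + ?dy i)" by simp
  also have "\<dots> = dot n x y + (dot n x ?dy + dot n ?dx y + dot n ?dx ?dy)" by (simp only: dot_add_left dot_add_right)
  finally have "\<bar>dot n x' y' - dot n x y\<bar> = \<bar>dot n x ?dy + dot n ?dx y + dot n ?dx ?dy\<bar>" by simp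
  also have "\<dots> \<le> \<bar>dot n x ?dy\<bar> + \<bar>dot n ?dx y\<bar> + \<bar>dot n ?dx ?dy\<bar>" by linarith
  also have "\<dots> \<le> c * r + r * c + r * r"
    by (intro add_mono order_trans[OF abs_dot_le] mult_mono x y dx dy nonneg L2_set_nonneg)
  also have "\<dots> = 2 * c * r + r\<^sup>2" by (simp add: power2_eq_square)
  finally show ?thesis .
qed

lemma dot_mul_vec: "dot m (mul_vec k A y) x = dot k y (mul_vec m (transposed A) x)"
proof -
  have "dot m (mul_vec k A y) x = (\<Sum>i<m. \<Sum>j<k. y j * (A i j * x i))"
    by (simp add: dot_def mul_vec_def sum_distrib_left sum_distrib_right mult_ac)
  also have "\<dots> = dot k y (mul_vec m (transposed A) x)"
    by (subst sum.swap) (simp add: dot_def mul_vec_def sum_distrib_left)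
  finally show ?thesis .
qed

lemma mul_vec_cong: "(\<And>j. j < n \<Longrightarrow> x j = y j) \<Longrightarrow> mul_vec n A x i = mul_vec n A y i"
  by (simp add: mul_vec_def)

lemma mul_vec_add: "mul_vec n A (\<lambda>j. x j + y j) i = mul_vec n A x i + mul_vec n A y i"
  by (simp add: mul_vec_def distrib_left sum.distrib)

lemma mul_vec_divide: "mul_vec n A (\<lambda>j. x j / c) i = mul_vec n A x i / c"
  by (simp add: mul_vec_def sum_divide_distrib)

lemma mul_vec_mul_vec: "mul_vec m A (mul_vec n B x) i = mul_vec n (\<lambda>i j. \<Sum>l<m. A i l * B l j) x i"
proof -
  have "mul_vec m A (mul_vec n B x) i = (\<Sum>l<m. \<Sum>j<n. A i l * B l j * x j)"
    by (simp add: mul_vec_def sum_distrib_left mult.assoc)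
  also have "\<dots> = mul_vec n (\<lambda>i j. \<Sum>l<m. A i l * B l j) x i"
    by (subst sum.swap) (simp add: mul_vec_def sum_distrib_right)
  finally show ?thesis .
qed

lemma l2norm_mono_abs: "(\<And>i. i < n \<Longrightarrow> \<bar>x i\<bar> \<le> \<bar>y i\<bar>) \<Longrightarrow> l2norm n x \<le> l2norm n y"
  unfolding L2_set_def by (intro real_sqrt_le_mono sum_mono) (simp add: abs_le_square_iff)

lemma l2norm_abs: "l2norm n (\<lambda>i. \<bar>x i\<bar>) = l2norm n x"
  by (simp add: L2_set_def)

lemma l2norm_scale: "0 \<le> c \<Longrightarrow> l2norm n (\<lambda>i. c * x i) = c * l2norm n x"
  by (rule L2_set_right_distrib[symmetric])

lemma l2norm_le_const:
  assumes "\<And>i. i < n \<Longrightarrow> \<bar>x i\<bar> \<le> c" "0 \<le> c"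
  shows "l2norm n x \<le> sqrt n * c"
proof -
  have "l2norm n x \<le> l2norm n (\<lambda>_. c)" using assms by (intro l2norm_mono_abs) auto
  also have "\<dots> = sqrt n * c" using assms(2) by (simp add: L2_set_def real_sqrt_mult)
  finally show ?thesis .
qed

lemma l2norm_mul_vec_le:
  assumes entries: "\<And>i j. i < n \<Longrightarrow> j < n \<Longrightarrow> \<bar>A i j\<bar> \<le> c / n" and c: "0 \<le> c"
  shows "l2norm n (mul_vec n A x) \<le> c * l2norm n x"
proof (cases "n = 0")
  case False
  have "\<bar>mul_vec n A x i\<bar> \<le> c / sqrt n * l2norm n x" if "i < n" for i
  proof -
    have "\<bar>mul_vec n A x i\<bar> \<le> l2norm n (A i) * l2norm n x"
      using abs_dot_le[of n "A i" x] by (simp add: dot_def mul_vec_def)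
    also have "l2norm n (A i) \<le> sqrt n * (c / n)"
      using entries[OF that] c by (intro l2norm_le_const) auto
    also have "sqrt n * (c / n) = c / sqrt n" using False by (simp add: field_simps)
    finally show ?thesis by (simp add: mult_right_mono)
  qed
  then have "l2norm n (mul_vec n A x) \<le> sqrt n * (c / sqrt n * l2norm n x)"
    using c by (intro l2norm_le_const) auto
  also have "\<dots> = c * l2norm n x" using False by simp
  finally show ?thesis .
qed simp

lemma underdetermined_system_solvable:
  assumes "m < n"
  shows "\<exists>c. (\<exists>j<n. c j \<noteq> 0) \<and> (\<forall>i<m. mul_vec n A c i = 0)"
proof -
  define B where "B = mat n n (\<lambda>(i, j). if i < m then A i j else 0)"
  have B: "B \<in> carrier_mat n n" by (simp add: B_def)
  have "row B (n - 1) = 0\<^sub>v n" using assms by (intro eq_vecI) (auto simp: B_def)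
  then have "B = mat\<^sub>r n n (\<lambda>i. if i = n - 1 then 0\<^sub>v n else row B i)"
    using B by (intro eq_rowI) (auto simp: mat_of_rows_def)
  then have "det B = 0" using det_row_0[of "n - 1" n "row B"] assms B by auto
  then obtain v where v: "v \<in> carrier_vec n" "v \<noteq> 0\<^sub>v n" "B *\<^sub>v v = 0\<^sub>v n"
    using det_0_iff_vec_prod_zero[OF B] by blast
  have "mul_vec n A (($) v) i = 0" if "i < m" for i
  proof -
    have "mul_vec n A (($) v) i = (B *\<^sub>v v) $ i"
      using that assms v(1) by (simp add: B_def mul_vec_def scalar_prod_def atLeast0LessThan)
    then show ?thesis using v(3) that assms by simp
  qed
  moreover have "\<exists>j<n. v $ j \<noteq> 0" using v(1,2) by (auto intro!: eq_vecI)
  ultimately show ?thesis by blast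
qed

section \<open>Orthonormal eigenbases\<close>

locale orthonormal_basis =
  fixes n :: nat and e :: "nat \<Rightarrow> nat \<Rightarrow> real"
  assumes orthonormal: "a < n \<Longrightarrow> b < n \<Longrightarrow> dot n (e a) (e b) = (if a = b then 1 else 0)"
begin

definition coords :: "(nat \<Rightarrow> real) \<Rightarrow> nat \<Rightarrow> real" where
  "coords = mul_vec n e"

lemma complete:
  assumes "i < n" "j < n"
  shows "(\<Sum>a<n. e a i * e a j) = (if i = j then 1 else 0)"
proof -
  define U where "U = mat n n (\<lambda>(a, i). e a i)"
  have U: "U \<in> carrier_mat n n" "transpose_mat U \<in> carrier_mat n n" by (auto simp: U_def)
  have "U * transpose_mat U = 1\<^sub>m n"
    using orthonormal by (intro eq_matI) (auto simp: U_def scalar_prod_def atLeast0LessThan dot_def)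
  then have "transpose_mat U * U = 1\<^sub>m n" by (rule mat_mult_left_right_inverse[OF U])
  then have "(transpose_mat U * U) $$ (i, j) = 1\<^sub>m n $$ (i, j)" by simp
  then show ?thesis using assms by (simp add: U_def scalar_prod_def atLeast0LessThan)
qed

lemma expansion:
  assumes "i < n"
  shows "x i = mul_vec n (transposed e) (coords x) i"
proof -
  have "mul_vec n (transposed e) (coords x) i = (\<Sum>j<n. (if i = j then 1 else 0) * x j)"
    unfolding coords_def mul_vec_mul_vec unfolding mul_vec_def using complete assms by simp
  also have "\<dots> = x i" using assms by (simp add: if_distribR if_distrib[of "\<lambda>t. t * _"] cong: if_cong)
  finally show ?thesis by simp
qed

lemma parseval: "dot n x y = dot n (coords x) (coords y)"
proof -
  have "dot n (coords x) (coords y) = dot n x (mul_vec n (transposed e) (coords y))"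
    unfolding coords_def by (rule dot_mul_vec)
  also have "\<dots> = dot n x y" by (intro dot_cong) (simp_all add: expansion[symmetric])
  finally show ?thesis by simp
qed

lemma l2norm_coords: "l2norm n (coords x) = l2norm n x"
proof -
  have "(l2norm n (coords x))\<^sup>2 = (l2norm n x)\<^sup>2" using parseval[of x x] by (simp add: dot_self)
  then show ?thesis by (simp add: power2_eq_iff_nonneg)
qed

lemma coords_combination:
  assumes "m \<le> n" "a < n"
  shows "coords (mul_vec m (transposed e) c) a = (if a < m then c a else 0)"
proof -
  have "coords (mul_vec m (transposed e) c) a = (\<Sum>b<m. (if a = b then 1 else 0) * c b)"
    unfolding coords_def mul_vec_mul_vec unfolding mul_vec_def
    using orthonormal[unfolded dot_def] assms by (intro sum.cong) auto
  also have "\<dots> = (if a < m then c a else 0)"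
    by (simp add: if_distribR if_distrib[of "\<lambda>t. t * _"] cong: if_cong)
  finally show ?thesis .
qed

end

locale orthonormal_eigenbasis = orthonormal_basis +
  fixes A :: "nat \<Rightarrow> nat \<Rightarrow> real" and \<mu> :: "nat \<Rightarrow> real"
  assumes eigenvector: "a < n \<Longrightarrow> i < n \<Longrightarrow> mul_vec n A (e a) i = \<mu> a * e a i"
    and eigenvalues_antimono: "a \<le> b \<Longrightarrow> b < n \<Longrightarrow> \<mu> b \<le> \<mu> a"
begin

lemma coords_mul_vec:
  assumes "a < n"
  shows "coords (mul_vec n A x) a = \<mu> a * coords x a"
proof -
  have apply_eigen: "mul_vec n A x i = mul_vec n (transposed e) (\<lambda>a. \<mu> a * coords x a) i" if "i < n" for i
  proof -
    have "mul_vec n A x i = mul_vec n A (mul_vec n (transposed e) (coords x)) i"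
      by (intro mul_vec_cong expansion)
    also have "\<dots> = (\<Sum>a<n. mul_vec n A (e a) i * coords x a)"
      unfolding mul_vec_mul_vec by (simp add: mul_vec_def)
    also have "\<dots> = mul_vec n (transposed e) (\<lambda>a. \<mu> a * coords x a) i"
      using that unfolding mul_vec_def[of _ "transposed e"] by (intro sum.cong) (simp_all add: eigenvector)
    finally show ?thesis .
  qed
  have "coords (mul_vec n A x) a = coords (mul_vec n (transposed e) (\<lambda>a. \<mu> a * coords x a)) a"
    using apply_eigen unfolding coords_def by (intro mul_vec_cong) simp
  then show ?thesis using assms by (simp add: coords_combination)
qed

lemma quadratic_form: "dot n x (mul_vec n A x) = (\<Sum>a<n. \<mu> a * (coords x a)\<^sup>2)"
  unfolding parseval[of x] unfolding dot_def by (simp add: coords_mul_vec power2_eq_square mult_ac)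

text \<open>The test space is the range of an injective \<open>B\<close> in the first half of the Courant--Fischer theorem,
  and the kernel of \<open>B\<close> in the second.\<close>

lemma courant_fischer_ge:
  assumes "a < m" "m \<le> n"
    and inj: "\<And>c. \<exists>j<m. c j \<noteq> 0 \<Longrightarrow> 0 < l2norm n (mul_vec m B c)"
    and form: "\<And>c. r * (l2norm n (mul_vec m B c))\<^sup>2 \<le> dot n (mul_vec m B c) (mul_vec n A (mul_vec m B c))"
  shows "r \<le> \<mu> a"
proof -
  obtain c where nonzero: "\<exists>j<m. c j \<noteq> 0" and orthogonal: "\<forall>b<m - 1. mul_vec m (\<lambda>b j. \<Sum>i<n. e b i * B i j) c b = 0"
    using underdetermined_system_solvable[of "m - 1" m "\<lambda>b j. \<Sum>i<n. e b i * B i j"] assms(1) by auto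
  define x where "x = mul_vec m B c"
  have low: "coords x b = 0" if "b < m - 1" for b
    using orthogonal that unfolding x_def coords_def mul_vec_mul_vec by simp
  have "r * (l2norm n x)\<^sup>2 \<le> (\<Sum>b<n. \<mu> b * (coords x b)\<^sup>2)"
    using form[of c] by (simp add: x_def[symmetric] quadratic_form)
  also have "\<dots> \<le> (\<Sum>b<n. \<mu> (m - 1) * (coords x b)\<^sup>2)"
  proof (rule sum_mono)
    fix b assume b: "b \<in> {..<n}"
    show "\<mu> b * (coords x b)\<^sup>2 \<le> \<mu> (m - 1) * (coords x b)\<^sup>2"
      using low[of b] eigenvalues_antimono[of "m - 1" b] b
      by (cases "b < m - 1") (auto intro: mult_right_mono)
  qed
  also have "\<dots> = \<mu> (m - 1) * (l2norm n x)\<^sup>2"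
    by (simp add: sum_distrib_left[symmetric] l2norm_sq[symmetric] l2norm_coords)
  finally have "r \<le> \<mu> (m - 1)" using inj[OF nonzero] by (simp add: x_def)
  also have "\<dots> \<le> \<mu> a" using assms by (intro eigenvalues_antimono) auto
  finally show ?thesis .
qed

lemma courant_fischer_le:
  assumes "m \<le> a" "a < n"
    and form: "\<And>x. \<forall>i<m. mul_vec n B x i = 0 \<Longrightarrow> dot n x (mul_vec n A x) \<le> r * (l2norm n x)\<^sup>2"
  shows "\<mu> a \<le> r"
proof -
  obtain c where nonzero: "\<exists>j<Suc m. c j \<noteq> 0" and kernel: "\<forall>i<m. mul_vec (Suc m) (\<lambda>i j. \<Sum>l<n. B i l * e j l) c i = 0"
    using underdetermined_system_solvable[of m "Suc m"] by blast
  define x where "x = mul_vec (Suc m) (transposed e) c"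
  have coords: "coords x b = (if b < Suc m then c b else 0)" if "b < n" for b
    using that assms unfolding x_def by (intro coords_combination) auto
  obtain j where "j < Suc m" "c j \<noteq> 0" using nonzero by blast
  then have "\<exists>j<n. coords x j \<noteq> 0" using coords[of j] assms(1,2) by (intro exI[of _ j]) auto
  then have pos: "0 < l2norm n x" unfolding l2norm_coords[of x, symmetric] l2norm_pos_iff .
  have "\<mu> m * (l2norm n x)\<^sup>2 = (\<Sum>b<n. \<mu> m * (coords x b)\<^sup>2)"
    by (simp add: sum_distrib_left[symmetric] l2norm_sq[symmetric] l2norm_coords)
  also have "\<dots> \<le> (\<Sum>b<n. \<mu> b * (coords x b)\<^sup>2)"
  proof (rule sum_mono)
    fix b assume b: "b \<in> {..<n}"
    show "\<mu> m * (coords x b)\<^sup>2 \<le> \<mu> b * (coords x b)\<^sup>2"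
      using coords[of b] eigenvalues_antimono[of b m] assms b
      by (cases "b < Suc m") (auto intro: mult_right_mono)
  qed
  also have "\<dots> \<le> r * (l2norm n x)\<^sup>2"
    unfolding quadratic_form[symmetric]
  proof (intro form allI impI)
    fix i assume "i < m"
    then show "mul_vec n B x i = 0" using kernel unfolding x_def mul_vec_mul_vec by simp
  qed
  finally have "\<mu> m \<le> r" using pos by simp
  moreover have "\<mu> a \<le> \<mu> m" using assms by (intro eigenvalues_antimono) auto
  ultimately show ?thesis by linarith
qed

end

section \<open>Medians\<close>

lemma length_filter_eq_card_sort:
  "length (filter P xs) = card {i. i < length xs \<and> P (sort xs ! i)}"
proof -
  have "length (filter P xs) = length (filter P (sort xs))"
    by (metis mset_filter mset_sort size_mset)
  then show ?thesis by (simp add: length_filter_conv_card)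
qed

lemma length_filter_less_median: "2 * length (filter (\<lambda>x. x < median xs) xs) \<le> length xs"
proof -
  have "{i. i < length xs \<and> sort xs ! i < median xs} \<subseteq> {..<length xs div 2}"
    unfolding median_def by (auto simp: not_le[symmetric] intro: sorted_nth_mono)
  then have "card {i. i < length xs \<and> sort xs ! i < median xs} \<le> card {..<length xs div 2}"
    by (intro card_mono) auto
  then show ?thesis by (simp add: length_filter_eq_card_sort)
qed

lemma length_filter_median_less: "2 * length (filter (\<lambda>x. median xs < x) xs) \<le> length xs"
proof -
  have "{i. i < length xs \<and> median xs < sort xs ! i} \<subseteq> {length xs div 2<..<length xs}"
    unfolding median_def by (auto simp: not_le[symmetric] intro: sorted_nth_mono)
  then have "card {i. i < length xs \<and> median xs < sort xs ! i} \<le> card {length xs div 2<..<length xs}"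
    by (intro card_mono) auto
  then show ?thesis by (simp add: length_filter_eq_card_sort)
qed

lemma ex_median_on:
  fixes z :: "'a \<Rightarrow> real"
  assumes "finite C"
  shows "\<exists>m. 2 * card {x\<in>C. m < z x} \<le> card C \<and> 2 * card {x\<in>C. z x < m} \<le> card C"
proof -
  obtain xs where xs: "set xs = C" "distinct xs" using finite_distinct_list[OF assms] by blast
  have card_filter: "card {x\<in>C. P (z x)} = length (filter P (map z xs))" for P
    using distinct_card[OF distinct_filter[OF xs(2)], of "P \<circ> z"] xs(1) by (simp add: filter_map)
  have "card C = length (map z xs)" using distinct_card[OF xs(2)] xs(1) by simp
  then have "2 * card {x\<in>C. median (map z xs) < z x} \<le> card C \<and> 2 * card {x\<in>C. z x < median (map z xs)} \<le> card C"
    unfolding card_filter[of "\<lambda>r. r < median (map z xs)"] card_filter[of "\<lambda>r. median (map z xs) < r"]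
    using length_filter_less_median length_filter_median_less by metis
  then show ?thesis ..
qed

section \<open>Cheeger's inequality\<close>

definition adj :: "('a \<Rightarrow> 'a \<Rightarrow> bool) \<Rightarrow> 'a \<Rightarrow> 'a \<Rightarrow> real" where
  "adj E x y = of_bool (E x y)"

definition cut_weight :: "('a \<Rightarrow> 'a \<Rightarrow> bool) \<Rightarrow> 'a set \<Rightarrow> 'a set \<Rightarrow> real" where
  "cut_weight E S T = (\<Sum>x\<in>S. \<Sum>y\<in>T. adj E x y)"

definition total_variation :: "('a \<Rightarrow> 'a \<Rightarrow> bool) \<Rightarrow> 'a set \<Rightarrow> ('a \<Rightarrow> real) \<Rightarrow> real" where
  "total_variation E C z = (\<Sum>x\<in>C. \<Sum>y\<in>C. adj E x y * \<bar>z x - z y\<bar>)"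

definition dirichlet :: "('a \<Rightarrow> 'a \<Rightarrow> bool) \<Rightarrow> 'a set \<Rightarrow> ('a \<Rightarrow> real) \<Rightarrow> real" where
  "dirichlet E C z = (\<Sum>x\<in>C. \<Sum>y\<in>C. adj E x y * (z x - z y)\<^sup>2)"

definition expands :: "real \<Rightarrow> ('a \<Rightarrow> 'a \<Rightarrow> bool) \<Rightarrow> 'a set \<Rightarrow> bool" where
  "expands r E C \<longleftrightarrow> (\<forall>S\<subseteq>C. 2 * card S \<le> card C \<longrightarrow> r * card S \<le> cut_weight E S (C - S))"

lemma adj_nonneg [simp]: "0 \<le> adj E x y"
  by (simp add: adj_def)

lemma adj_commute: "symp E \<Longrightarrow> adj E x y = adj E y x"
  by (auto simp: adj_def dest: sympD)

lemma sum_adj_swap: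
  assumes "symp E"
  shows "(\<Sum>x\<in>S. \<Sum>y\<in>T. adj E x y * g x y) = (\<Sum>x\<in>T. \<Sum>y\<in>S. adj E x y * g y x)"
  by (subst sum.swap) (simp add: adj_commute[OF assms, of _ "_ :: 'a"] cong: sum.cong)

lemma cut_weight_Un_right: "finite T \<Longrightarrow> finite T' \<Longrightarrow> T \<inter> T' = {} \<Longrightarrow> cut_weight E S (T \<union> T') = cut_weight E S T + cut_weight E S T'"
  by (simp add: cut_weight_def sum.union_disjoint sum.distrib)

lemma cut_weight_mono: "finite T \<Longrightarrow> finite S \<Longrightarrow> S' \<subseteq> S \<Longrightarrow> T' \<subseteq> T \<Longrightarrow> cut_weight E S' T' \<le> cut_weight E S T"
  unfolding cut_weight_def by (rule order_trans[OF sum_mono[OF sum_mono2] sum_mono2]) (auto intro: sum_nonneg)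

lemma cut_weight_commute: "symp E \<Longrightarrow> cut_weight E S T = cut_weight E T S"
  using sum_adj_swap[of E "\<lambda>_ _. 1"] by (simp add: cut_weight_def)

lemma sum_adj_across:
  assumes "finite C" "S \<subseteq> C"
  shows "(\<Sum>x\<in>C. \<Sum>y\<in>C. adj E x y * of_bool (x \<in> S \<and> y \<notin> S)) = cut_weight E S (C - S)"
proof -
  have "(\<Sum>x\<in>C. \<Sum>y\<in>C. adj E x y * of_bool (x \<in> S \<and> y \<notin> S))
      = (\<Sum>x\<in>S. \<Sum>y\<in>C. adj E x y * of_bool (x \<in> S \<and> y \<notin> S))"
    using assms by (intro sum.mono_neutral_right) auto
  also have "\<dots> = (\<Sum>x\<in>S. \<Sum>y\<in>C - S. adj E x y)"
    using assms by (intro sum.cong refl sum.mono_neutral_cong_right) auto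
  finally show ?thesis by (simp add: cut_weight_def)
qed

lemma total_variation_add_indicator:
  fixes h :: "'a \<Rightarrow> real"
  assumes C: "finite C" "symp E" and S: "S \<subseteq> C" and m: "0 \<le> m"
    and h: "\<And>x. x \<in> C \<Longrightarrow> 0 \<le> h x" "\<And>x. x \<in> C - S \<Longrightarrow> h x = 0"
  shows "total_variation E C (\<lambda>x. h x + m * of_bool (x \<in> S)) = total_variation E C h + 2 * m * cut_weight E S (C - S)"
proof -
  let ?out = "\<lambda>x y. of_bool (x \<in> S \<and> y \<notin> S) :: real"
  have "\<bar>(h x + m * of_bool (x \<in> S)) - (h y + m * of_bool (y \<in> S))\<bar> = \<bar>h x - h y\<bar> + m * (?out x y + ?out y x)"
    if "x \<in> C" "y \<in> C" for x y
    using that h[of x] h[of y] m by auto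
  then have "total_variation E C (\<lambda>x. h x + m * of_bool (x \<in> S))
      = (\<Sum>x\<in>C. \<Sum>y\<in>C. adj E x y * \<bar>h x - h y\<bar> + m * (adj E x y * ?out x y) + m * (adj E x y * ?out y x))"
    unfolding total_variation_def by (intro sum.cong refl) (simp add: algebra_simps)
  also have "\<dots> = total_variation E C h
      + m * (\<Sum>x\<in>C. \<Sum>y\<in>C. adj E x y * ?out x y) + m * (\<Sum>x\<in>C. \<Sum>y\<in>C. adj E x y * ?out y x)"
    by (simp add: total_variation_def sum.distrib sum_distrib_left)
  also have "\<dots> = total_variation E C h + 2 * m * cut_weight E S (C - S)"
    unfolding sum_adj_swap[OF C(2), of "\<lambda>x y. ?out y x"] sum_adj_across[OF C(1) S] by simp
  finally show ?thesis .
qed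

text \<open>The induction peels off the lowest positive level set.\<close>

lemma coarea_inequality:
  fixes h :: "'a \<Rightarrow> real"
  assumes C: "finite C" "symp E" and exp: "expands r E C"
    and h: "\<And>x. x \<in> C \<Longrightarrow> 0 \<le> h x" "2 * card {x\<in>C. h x \<noteq> 0} \<le> card C"
  shows "2 * r * (\<Sum>x\<in>C. h x) \<le> total_variation E C h"
  using h
proof (induction "card {x\<in>C. h x \<noteq> 0}" arbitrary: h rule: less_induct)
  case less
  define S where "S = {x\<in>C. h x \<noteq> 0}"
  have S: "S \<subseteq> C" "finite S" using C(1) by (auto simp: S_def)
  show ?case
  proof (cases "S = {}")
    case True
    then have "(\<Sum>x\<in>C. h x) = 0" by (auto simp: S_def)
    then show ?thesis by (simp add: total_variation_def sum_nonneg)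
  next
    case False
    define m where "m = Min (h ` S)"
    obtain x0 where x0: "x0 \<in> S" "h x0 = m"
      using Min_in[of "h ` S"] False S(2) unfolding m_def by (metis (no_types, lifting) finite_imageI image_iff image_is_empty)
    have m: "0 < m" using x0 less.prems(1)[of x0] by (auto simp: S_def order_less_le)
    have m_le: "m \<le> h x" if "x \<in> S" for x using that S by (simp add: m_def)
    define h' where "h' x = h x - m * of_bool (x \<in> S)" for x
    have h': "0 \<le> h' x" if "x \<in> C" for x using that m_le[of x] less.prems(1)[of x] by (simp add: h'_def)
    have off_S: "h' x = 0" if "x \<in> C - S" for x using that by (simp add: h'_def S_def)
    have "h' x0 = 0" using x0 by (simp add: h'_def)
    then have "{x\<in>C. h' x \<noteq> 0} \<subset> S" using x0(1) off_S by blast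
    then have "card {x\<in>C. h' x \<noteq> 0} < card S" by (rule psubset_card_mono[OF S(2)])
    then have "2 * r * (\<Sum>x\<in>C. h' x) \<le> total_variation E C h'"
      using less.prems(2) h' by (intro less.hyps) (auto simp: S_def)
    moreover have "r * card S \<le> cut_weight E S (C - S)"
      using exp S less.prems(2) by (simp add: expands_def S_def)
    then have "2 * m * (r * card S) \<le> 2 * m * cut_weight E S (C - S)" using m by simp
    moreover have "(\<Sum>x\<in>C. h x) = (\<Sum>x\<in>C. h' x) + m * card S"
      using S C(1) by (simp add: h'_def sum_subtractf sum_distrib_left[symmetric] Int_absorb1)
    moreover have "total_variation E C h = total_variation E C h' + 2 * m * cut_weight E S (C - S)"
      using total_variation_add_indicator[where h = h', OF C S(1) _ h' off_S, of m] m by (simp add: h'_def)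
    ultimately show ?thesis by (simp add: algebra_simps)
  qed
qed

lemma sum_adj_le:
  fixes h :: "'a \<Rightarrow> real"
  assumes "symp E" and deg: "\<And>x. x \<in> C \<Longrightarrow> (\<Sum>y\<in>C. adj E x y) \<le> d"
    and g: "\<And>x y. g x y \<le> 2 * (h x)\<^sup>2 + 2 * (h y)\<^sup>2"
  shows "(\<Sum>x\<in>C. \<Sum>y\<in>C. adj E x y * g x y) \<le> 4 * d * (\<Sum>x\<in>C. (h x)\<^sup>2)"
proof -
  have "(\<Sum>x\<in>C. \<Sum>y\<in>C. adj E x y * g x y) \<le> (\<Sum>x\<in>C. \<Sum>y\<in>C. adj E x y * (2 * (h x)\<^sup>2 + 2 * (h y)\<^sup>2))"
    using g by (intro sum_mono mult_left_mono) auto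
  also have "\<dots> = 2 * (\<Sum>x\<in>C. \<Sum>y\<in>C. adj E x y * (h x)\<^sup>2) + 2 * (\<Sum>x\<in>C. \<Sum>y\<in>C. adj E x y * (h y)\<^sup>2)"
    by (simp add: sum_distrib_left sum.distrib[symmetric] algebra_simps)
  also have "\<dots> = 4 * (\<Sum>x\<in>C. (\<Sum>y\<in>C. adj E x y) * (h x)\<^sup>2)"
    unfolding sum_adj_swap[OF assms(1), of "\<lambda>x y. (h y)\<^sup>2"] by (simp add: sum_distrib_right)
  also have "\<dots> \<le> 4 * (\<Sum>x\<in>C. d * (h x)\<^sup>2)"
    using deg by (intro mult_left_mono sum_mono mult_right_mono) auto
  finally show ?thesis by (simp add: sum_distrib_left mult_ac)
qed

lemma total_variation_square_le:
  fixes h :: "'a \<Rightarrow> real"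
  assumes "symp E" and deg: "\<And>x. x \<in> C \<Longrightarrow> (\<Sum>y\<in>C. adj E x y) \<le> d"
    and h: "\<And>x. x \<in> C \<Longrightarrow> 0 \<le> h x"
  shows "(total_variation E C (\<lambda>x. (h x)\<^sup>2))\<^sup>2 \<le> dirichlet E C h * (4 * d * (\<Sum>x\<in>C. (h x)\<^sup>2))"
proof -
  define drop where "drop = (\<lambda>(x, y). adj E x y * \<bar>h x - h y\<bar>)"
  define total where "total = (\<lambda>(x, y). adj E x y * (h x + h y))"
  have "total_variation E C (\<lambda>x. (h x)\<^sup>2) = (\<Sum>p\<in>C \<times> C. drop p * total p)"
    unfolding total_variation_def sum.cartesian_product drop_def total_def
    by (intro sum.cong) (auto simp: adj_def power2_eq_square square_diff_square_factored abs_mult h)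
  then have "(total_variation E C (\<lambda>x. (h x)\<^sup>2))\<^sup>2 \<le> (\<Sum>p\<in>C \<times> C. (drop p)\<^sup>2) * (\<Sum>p\<in>C \<times> C. (total p)\<^sup>2)"
    by (simp add: Cauchy_Schwarz_ineq_sum)
  also have "(\<Sum>p\<in>C \<times> C. (drop p)\<^sup>2) = dirichlet E C h"
    unfolding dirichlet_def sum.cartesian_product drop_def
    by (intro sum.cong) (auto simp: adj_def)
  also have "(\<Sum>p\<in>C \<times> C. (total p)\<^sup>2) = (\<Sum>x\<in>C. \<Sum>y\<in>C. adj E x y * (h x + h y)\<^sup>2)"
    unfolding sum.cartesian_product total_def by (intro sum.cong) (auto simp: adj_def)
  also have "dirichlet E C h * \<dots> \<le> dirichlet E C h * (4 * d * (\<Sum>x\<in>C. (h x)\<^sup>2))"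
  proof (intro mult_left_mono sum_adj_le assms(1) deg)
    show "(h x + h y)\<^sup>2 \<le> 2 * (h x)\<^sup>2 + 2 * (h y)\<^sup>2" for x y
      using sum_squares_bound[of "h x" "h y"] by (simp add: power2_sum)
  qed (auto simp: dirichlet_def intro!: sum_nonneg)
  finally show ?thesis .
qed

lemma cheeger_small_support:
  fixes h :: "'a \<Rightarrow> real"
  assumes C: "finite C" "symp E" and \<phi>: "0 \<le> \<phi>" and d: "0 < d"
    and deg: "\<And>x. x \<in> C \<Longrightarrow> (\<Sum>y\<in>C. adj E x y) \<le> d" and exp: "expands (\<phi> * d) E C"
    and h: "\<And>x. x \<in> C \<Longrightarrow> 0 \<le> h x" "2 * card {x\<in>C. h x \<noteq> 0} \<le> card C"
  shows "\<phi>\<^sup>2 * d * (\<Sum>x\<in>C. (h x)\<^sup>2) \<le> dirichlet E C h"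
proof -
  define s where "s = (\<Sum>x\<in>C. (h x)\<^sup>2)"
  have s: "0 \<le> s" by (simp add: s_def sum_nonneg)
  have "2 * (\<phi> * d) * s \<le> total_variation E C (\<lambda>x. (h x)\<^sup>2)"
    unfolding s_def using h(2) by (intro coarea_inequality C exp) auto
  then have "(2 * (\<phi> * d) * s)\<^sup>2 \<le> (total_variation E C (\<lambda>x. (h x)\<^sup>2))\<^sup>2"
    using s d \<phi> by (intro power_mono) auto
  also have "\<dots> \<le> dirichlet E C h * (4 * d * s)"
    unfolding s_def by (rule total_variation_square_le[OF C(2) deg h(1)])
  finally have "(\<phi>\<^sup>2 * d * s) * (4 * d * s) \<le> dirichlet E C h * (4 * d * s)"
    by (simp add: power2_eq_square algebra_simps)
  moreover have "0 \<le> dirichlet E C h" by (simp add: dirichlet_def sum_nonneg)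
  ultimately have "\<phi>\<^sup>2 * d * s \<le> dirichlet E C h" using s d by (cases "s = 0") auto
  then show ?thesis by (simp add: s_def)
qed

lemma dirichlet_pos_neg_parts_le:
  fixes z :: "'a \<Rightarrow> real"
  shows "dirichlet E C (\<lambda>x. max (z x - m) 0) + dirichlet E C (\<lambda>x. max (m - z x) 0) \<le> dirichlet E C z"
proof -
  have superadditive: "a\<^sup>2 + b\<^sup>2 \<le> (a + b)\<^sup>2" if "0 \<le> a" "0 \<le> b" for a b :: real
    using that by (simp add: power2_sum)
  have "(max (z x - m) 0 - max (z y - m) 0)\<^sup>2 + (max (m - z x) 0 - max (m - z y) 0)\<^sup>2 \<le> (z x - z y)\<^sup>2" for x y
  proof -
    consider (above) "m \<le> z x" "m \<le> z y" | (below) "z x \<le> m" "z y \<le> m"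
      | (down) "m \<le> z x" "z y \<le> m" | (up) "z x \<le> m" "m \<le> z y" by linarith
    then show ?thesis
    proof cases
      case down
      then show ?thesis using superadditive[of "z x - m" "m - z y"] by (simp add: max_def power2_eq_square)
    next
      case up
      then show ?thesis
        using superadditive[of "z y - m" "m - z x"] by (simp add: max_def power2_eq_square algebra_simps)
    qed (simp_all add: max_def power2_commute)
  qed
  then show ?thesis
    unfolding dirichlet_def sum.distrib[symmetric] distrib_left[symmetric]
    by (intro sum_mono mult_left_mono) auto
qed

theorem cheeger_inequality:
  fixes z :: "'a \<Rightarrow> real"
  assumes C: "finite C" "symp E" and \<phi>: "0 \<le> \<phi>" and d: "0 < d"
    and deg: "\<And>x. x \<in> C \<Longrightarrow> (\<Sum>y\<in>C. adj E x y) \<le> d" and exp: "expands (\<phi> * d) E C"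
    and z: "(\<Sum>x\<in>C. z x) = 0"
  shows "\<phi>\<^sup>2 * d * (\<Sum>x\<in>C. (z x)\<^sup>2) \<le> dirichlet E C z"
proof -
  obtain m where m: "2 * card {x\<in>C. m < z x} \<le> card C" "2 * card {x\<in>C. z x < m} \<le> card C"
    using ex_median_on[OF C(1)] by blast
  define p where "p x = max (z x - m) 0" for x
  define q where "q x = max (m - z x) 0" for x
  have "(\<Sum>x\<in>C. (z x)\<^sup>2) \<le> (\<Sum>x\<in>C. (z x)\<^sup>2) - 2 * m * (\<Sum>x\<in>C. z x) + card C * m\<^sup>2"
    using z by simp
  also have "\<dots> = (\<Sum>x\<in>C. (z x)\<^sup>2 - 2 * m * z x + m\<^sup>2)"
    by (simp add: sum.distrib sum_subtractf sum_distrib_left)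
  also have "\<dots> = (\<Sum>x\<in>C. (p x)\<^sup>2 + (q x)\<^sup>2)"
    by (intro sum.cong refl) (auto simp: p_def q_def max_def power2_eq_square algebra_simps)
  finally have "\<phi>\<^sup>2 * d * (\<Sum>x\<in>C. (z x)\<^sup>2) \<le> \<phi>\<^sup>2 * d * (\<Sum>x\<in>C. (p x)\<^sup>2 + (q x)\<^sup>2)"
    using d by (intro mult_left_mono) auto
  also have "\<dots> = \<phi>\<^sup>2 * d * (\<Sum>x\<in>C. (p x)\<^sup>2) + \<phi>\<^sup>2 * d * (\<Sum>x\<in>C. (q x)\<^sup>2)"
    by (simp add: sum.distrib distrib_left)
  also have "\<dots> \<le> dirichlet E C p + dirichlet E C q"
  proof (intro add_mono cheeger_small_support C \<phi> d deg exp)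
    have "{x\<in>C. p x \<noteq> 0} = {x\<in>C. m < z x}" "{x\<in>C. q x \<noteq> 0} = {x\<in>C. z x < m}"
      by (auto simp: p_def q_def max_def split: if_splits)
    then show "2 * card {x\<in>C. p x \<noteq> 0} \<le> card C" "2 * card {x\<in>C. q x \<noteq> 0} \<le> card C" using m by auto
  qed (auto simp: p_def q_def)
  also have "\<dots> \<le> dirichlet E C z" unfolding p_def q_def by (rule dirichlet_pos_neg_parts_le)
  finally show ?thesis .
qed

section \<open>Spectrum of a clusterable graph\<close>

lemma card_cut_edges:
  assumes "finite S" "finite T"
  shows "real (card (cut_edges E S T)) = cut_weight E S T"
proof -
  have "cut_edges E S T = (SIGMA x:S. {y\<in>T. E x y})" by (auto simp: cut_edges_def)
  then have "card (cut_edges E S T) = (\<Sum>x\<in>S. card {y\<in>T. E x y})" using assms by simp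
  moreover have "real (card {y\<in>T. E x y}) = (\<Sum>y\<in>T. adj E x y)" for x
    using assms by (simp add: adj_def of_bool_def sum.If_cases Int_def)
  ultimately show ?thesis by (simp add: cut_weight_def)
qed

locale regular_graph_spectrum =
  fixes n d :: nat and E :: edges and lam :: "nat \<Rightarrow> real" and u :: "nat \<Rightarrow> real vec"
  assumes regular: "regular_graph n d E"
    and eigenbasis: "ordered_eigenbasis n (laplacian n d E) lam u"
begin

abbreviation v :: "nat \<Rightarrow> nat \<Rightarrow> real" where
  "v a x \<equiv> u a $ x"

definition normalized_adj :: "nat \<Rightarrow> nat \<Rightarrow> real" where
  "normalized_adj x y = adj E x y / d"

lemma d_pos: "0 < real d"
  using regular by (simp add: regular_graph_def)

lemma symp_E: "symp E"
  using regular by (auto simp: regular_graph_def graph_def intro: sympI)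

lemma E_bound: "E x y \<Longrightarrow> x < n \<and> y < n"
  using regular by (simp add: regular_graph_def graph_def)

lemma E_irrefl: "\<not> E x x"
  using regular by (simp add: regular_graph_def graph_def)

lemma card_neighbours: "x < n \<Longrightarrow> card {y. E x y} = d"
  using regular by (simp add: regular_graph_def deg_def)

lemma vol_eq: "S \<subseteq> {..<n} \<Longrightarrow> vol E S = d * card S"
  unfolding vol_def using regular by (simp add: regular_graph_def subset_eq)

lemma sum_adj: "(\<Sum>y<n. adj E x y * g y) = (\<Sum>y | E x y. g y)"
proof -
  have "(\<Sum>y<n. adj E x y * g y) = (\<Sum>y<n. if E x y then g y else 0)"
    by (intro sum.cong) (auto simp: adj_def)
  also have "\<dots> = (\<Sum>y\<in>{y\<in>{..<n}. E x y}. g y)" by (rule sum.inter_filter[symmetric]) simp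
  also have "{y\<in>{..<n}. E x y} = {y. E x y}" using E_bound by auto
  finally show ?thesis .
qed

lemma adj_row_sum: "x < n \<Longrightarrow> (\<Sum>y<n. adj E x y) = real d"
  using sum_adj[of x "\<lambda>_. 1"] card_neighbours[of x] by simp

lemma adj_row_sum_le: "x < n \<Longrightarrow> S \<subseteq> {..<n} \<Longrightarrow> (\<Sum>y\<in>S. adj E x y) \<le> real d"
  using sum_mono2[of "{..<n}" S "adj E x"] by (simp add: adj_row_sum)

sublocale orthonormal_eigenbasis n v normalized_adj "\<lambda>a. 1 - lam a"
proof
  have carrier: "u a \<in> carrier_vec n" and eigen: "laplacian n d E *\<^sub>v u a = lam a \<cdot>\<^sub>v u a" if "a < n" for a
    using eigenbasis that by (auto simp: ordered_eigenbasis_def)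
  show "dot n (v a) (v b) = (if a = b then 1 else 0)" if "a < n" "b < n" for a b
  proof -
    have "dot n (v a) (v b) = u a \<bullet> u b"
      using carrier[OF that(2)] by (simp add: dot_def scalar_prod_def atLeast0LessThan)
    then show ?thesis using eigenbasis that by (simp add: ordered_eigenbasis_def)
  qed
  show "mul_vec n normalized_adj (v a) x = (1 - lam a) * v a x" if "a < n" "x < n" for a x
  proof -
    have "(laplacian n d E *\<^sub>v u a) $ x = (\<Sum>y<n. (of_bool (x = y) - adj E x y / d) * v a y)"
      using that carrier[OF that(1)]
      by (simp add: laplacian_def adjacency_def scalar_prod_def atLeast0LessThan adj_def of_bool_def
          if_distrib[of "\<lambda>t. t / _"] cong: if_cong)
    also have "\<dots> = v a x - mul_vec n normalized_adj (v a) x"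
      using that by (simp add: left_diff_distrib sum_subtractf mul_vec_def normalized_adj_def)
    finally show ?thesis using that carrier[OF that(1)] by (simp add: eigen algebra_simps)
  qed
  show "1 - lam b \<le> 1 - lam a" if "a \<le> b" "b < n" for a b
    using eigenbasis that by (simp add: ordered_eigenbasis_def)
qed

lemma sum_adj_eq_normalized: "(\<Sum>y<n. adj E x y * z y) = d * mul_vec n normalized_adj z x"
  using d_pos by (simp add: mul_vec_def normalized_adj_def sum_distrib_left)

lemma dot_normalized_adj:
  "dot n z (mul_vec n normalized_adj z) = (l2norm n z)\<^sup>2 - dirichlet E {..<n} z / (2 * d)"
proof -
  have squares: "(\<Sum>x<n. \<Sum>y<n. adj E x y * (z x)\<^sup>2) = d * (l2norm n z)\<^sup>2"
    by (simp add: sum_distrib_right[symmetric] sum_distrib_left l2norm_sq adj_row_sum)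
  have "dirichlet E {..<n} z
      = (\<Sum>x<n. \<Sum>y<n. adj E x y * (z x)\<^sup>2 + adj E x y * (z y)\<^sup>2 - 2 * (z x * (adj E x y * z y)))"
    unfolding dirichlet_def by (intro sum.cong refl) (simp add: power2_eq_square algebra_simps)
  also have "\<dots> = 2 * d * (l2norm n z)\<^sup>2 - 2 * (\<Sum>x<n. z x * (\<Sum>y<n. adj E x y * z y))"
    unfolding sum.distrib sum_subtractf sum_adj_swap[OF symp_E, of "\<lambda>x y. (z y)\<^sup>2"] squares
    by (simp add: sum_distrib_left)
  also have "(\<Sum>x<n. z x * (\<Sum>y<n. adj E x y * z y)) = d * dot n z (mul_vec n normalized_adj z)"
    unfolding sum_adj_eq_normalized by (simp add: dot_def sum_distrib_left mult_ac)
  finally show ?thesis using d_pos by (simp add: field_simps)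
qed

lemma eigenvalue_bounds:
  assumes "a < n"
  shows "0 \<le> lam a" "lam a \<le> 2"
proof -
  have norm: "(l2norm n (v a))\<^sup>2 = 1" using orthonormal[OF assms assms] by (simp add: dot_self)
  have "dot n (v a) (mul_vec n normalized_adj (v a)) = (1 - lam a) * dot n (v a) (v a)"
    using eigenvector[OF assms] by (simp add: dot_def sum_distrib_left mult_ac)
  then have lam: "dirichlet E {..<n} (v a) = 2 * d * lam a"
    using dot_normalized_adj[of "v a"] d_pos norm by (simp add: dot_self field_simps)
  have "0 \<le> dirichlet E {..<n} (v a)" by (simp add: dirichlet_def sum_nonneg)
  then show "0 \<le> lam a" using lam d_pos by (simp add: zero_le_mult_iff)
  have "dirichlet E {..<n} (v a) \<le> 4 * real d * (\<Sum>x<n. (v a x)\<^sup>2)"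
    unfolding dirichlet_def
  proof (intro sum_adj_le symp_E)
    show "(v a x - v a y)\<^sup>2 \<le> 2 * (v a x)\<^sup>2 + 2 * (v a y)\<^sup>2" for x y
      using sum_squares_bound[of "v a x" "- v a y"] by (simp add: power2_diff)
  qed (simp add: adj_row_sum)
  then show "lam a \<le> 2" using lam norm d_pos by (simp add: l2norm_sq)
qed

end

definition clustering ::
    "real \<Rightarrow> nat \<Rightarrow> real \<Rightarrow> real \<Rightarrow> nat \<Rightarrow> edges \<Rightarrow> (nat \<Rightarrow> nat set) \<Rightarrow> bool" where
  "clustering \<beta> k \<phi> \<epsilon> n E C \<longleftrightarrow>
     (\<forall>i<k. C i \<noteq> {}) \<and> disjoint_family_on C {..<k} \<and> (\<Union>i<k. C i) = {..<n} \<and>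
     (\<forall>i<k. inner_conductance E (C i) \<ge> ereal \<phi>) \<and>
     (\<forall>i<k. outer_conductance E (C i) {..<n} \<le> \<epsilon>) \<and>
     (\<forall>i<k. \<forall>j<k. real (card (C i)) / real (card (C j)) \<le> \<beta>)"

lemma clusterable_iff_clustering: "clusterable \<beta> k \<phi> \<epsilon> n E \<longleftrightarrow> (\<exists>C. clustering \<beta> k \<phi> \<epsilon> n E C)"
  by (simp add: clusterable_def clustering_def)

locale clustered_spectrum = regular_graph_spectrum +
  fixes k :: nat and \<phi> \<epsilon> \<beta> :: real and C :: "nat \<Rightarrow> nat set"
  assumes k_ge_2: "2 \<le> k" and \<phi>: "0 < \<phi>" "\<phi> < 1" and \<epsilon>: "0 < \<epsilon>"
    and ratio: "\<epsilon> / \<phi>\<^sup>2 \<le> 1 / 10 ^ 5"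
    and clustering: "clustering \<beta> k \<phi> \<epsilon> n E C"
begin

lemma \<epsilon>_le: "\<epsilon> \<le> \<phi>\<^sup>2 / 10 ^ 5" "\<epsilon> \<le> 1 / 10 ^ 5"
proof -
  show "\<epsilon> \<le> \<phi>\<^sup>2 / 10 ^ 5" using ratio \<phi> by (simp add: divide_simps split: if_splits)
  moreover have "\<phi>\<^sup>2 \<le> 1" using \<phi> by (simp add: power_le_one)
  ultimately show "\<epsilon> \<le> 1 / 10 ^ 5" by simp
qed

lemma cluster_nonempty: "i < k \<Longrightarrow> C i \<noteq> {}"
  and clusters_disjoint: "disjoint_family_on C {..<k}"
  and clusters_cover: "(\<Union>i<k. C i) = {..<n}"
  and inner_conductance_cluster: "i < k \<Longrightarrow> ereal \<phi> \<le> inner_conductance E (C i)"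
  and outer_conductance_cluster: "i < k \<Longrightarrow> outer_conductance E (C i) {..<n} \<le> \<epsilon>"
  and cluster_ratio: "i < k \<Longrightarrow> j < k \<Longrightarrow> real (card (C i)) / real (card (C j)) \<le> \<beta>"
  using clustering by (simp_all add: clustering_def)

lemma cluster_subset: "i < k \<Longrightarrow> C i \<subseteq> {..<n}"
  using clusters_cover by blast

lemma finite_cluster: "i < k \<Longrightarrow> finite (C i)"
  using cluster_subset finite_subset by blast

lemma mem_cluster_iff: "i < k \<Longrightarrow> x \<in> C i \<Longrightarrow> j < k \<Longrightarrow> x \<in> C j \<longleftrightarrow> j = i"
  using clusters_disjoint by (auto simp: disjoint_family_on_def)

lemma sum_clusters: "(\<Sum>x<n. g x) = (\<Sum>i<k. \<Sum>x\<in>C i. g x)" for g :: "nat \<Rightarrow> 'a :: comm_monoid_add"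
  unfolding clusters_cover[symmetric] using clusters_disjoint finite_cluster
  by (intro sum.UNION_disjoint) (auto simp: disjoint_family_on_def)

lemma cluster_expands:
  assumes i: "i < k"
  shows "expands (\<phi> * d) E (C i)"
  unfolding expands_def
proof (intro allI impI)
  fix S assume S: "S \<subseteq> C i" "2 * card S \<le> card (C i)"
  have S_subset: "S \<subseteq> {..<n}" and fin: "finite S"
    using S(1) cluster_subset[OF i] finite_cluster[OF i] finite_subset by auto
  show "\<phi> * d * card S \<le> cut_weight E S (C i - S)"
  proof (cases "S = {}")
    case False
    then have pos: "0 < real d * card S" using fin d_pos by (simp add: card_gt_0_iff)
    have "2 * real (card S) \<le> card (C i)" using S(2) by linarith
    then have "real d * (2 * card S) \<le> real d * card (C i)" by (intro mult_left_mono) simp_all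
    then have "real (vol E S) \<le> real (vol E (C i)) / 2"
      using S_subset cluster_subset[OF i] by (simp add: vol_eq)
    moreover have "0 < vol E S" using pos S_subset by (simp add: vol_eq flip: of_nat_mult)
    ultimately have "inner_conductance E (C i) \<le> ereal (outer_conductance E S (C i))"
      unfolding inner_conductance_def using S(1) by (intro INF_lower) simp
    then have "\<phi> \<le> outer_conductance E S (C i)"
      using inner_conductance_cluster[OF i] by (metis order_trans ereal_less_eq(3))
    then have "\<phi> \<le> cut_weight E S (C i - S) / (d * card S)"
      unfolding outer_conductance_def using S_subset fin finite_cluster[OF i] by (simp add: card_cut_edges vol_eq)
    then show ?thesis using pos by (simp add: pos_le_divide_eq mult.assoc)
  qed (simp add: cut_weight_def)
qed

lemma cluster_cut_le:
  assumes i: "i < k"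
  shows "cut_weight E (C i) ({..<n} - C i) \<le> \<epsilon> * d * card (C i)"
proof -
  have "0 < real d * card (C i)"
    using cluster_nonempty[OF i] finite_cluster[OF i] d_pos by (simp add: card_gt_0_iff)
  then show ?thesis
    using outer_conductance_cluster[OF i] finite_cluster[OF i] cluster_subset[OF i]
    by (simp add: outer_conductance_def card_cut_edges vol_eq pos_divide_le_eq mult.assoc)
qed

lemma card_cluster_ge_2:
  assumes i: "i < k"
  shows "2 \<le> card (C i)"
proof (rule ccontr)
  assume "\<not> ?thesis"
  moreover have "card (C i) \<noteq> 0" using cluster_nonempty[OF i] finite_cluster[OF i] by simp
  ultimately obtain x where x: "C i = {x}" using card_1_singletonE[of "C i"] by fastforce
  then have x_less: "x < n" using cluster_subset[OF i] by auto
  have "(\<Sum>y<n. adj E x y) = adj E x x + (\<Sum>y\<in>{..<n} - {x}. adj E x y)"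
    using x_less by (intro sum.remove) auto
  moreover have "adj E x x = 0" using E_irrefl by (simp add: adj_def)
  ultimately have "real d = (\<Sum>y\<in>{..<n} - {x}. adj E x y)" using adj_row_sum[OF x_less] by simp
  then have "real d \<le> \<epsilon> * d" using cluster_cut_le[OF i] x by (simp add: cut_weight_def)
  then show False using \<epsilon>_le(2) d_pos by simp
qed

lemma n_eq_sum_card: "n = (\<Sum>i<k. card (C i))"
  using sum_clusters[of "\<lambda>_. 1 :: nat"] by simp

lemma two_k_le_n: "2 * k \<le> n"
  using sum_mono[of "{..<k}" "\<lambda>_. 2" "\<lambda>i. card (C i)"] card_cluster_ge_2 by (simp add: n_eq_sum_card[symmetric])

lemma n_ge_4: "4 \<le> n"
  using two_k_le_n k_ge_2 by linarith

lemma \<beta>_ge_1: "1 \<le> \<beta>"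
  using cluster_ratio[of 0 0] card_cluster_ge_2[of 0] k_ge_2 by simp

lemma card_cluster_ge:
  assumes i: "i < k"
  shows "real n \<le> \<beta> * k * card (C i)"
proof -
  have "card (C j) \<le> \<beta> * card (C i)" if "j < k" for j
    using cluster_ratio[OF that i] card_cluster_ge_2[OF i] by (simp add: pos_divide_le_eq)
  then have "(\<Sum>j<k. real (card (C j))) \<le> (\<Sum>j<k. \<beta> * card (C i))" by (intro sum_mono) auto
  moreover have "real n = (\<Sum>j<k. real (card (C j)))" by (subst n_eq_sum_card) simp
  ultimately show ?thesis by (simp add: mult_ac)
qed

abbreviation cluster_indicator :: "nat \<Rightarrow> nat \<Rightarrow> real" where
  "cluster_indicator i x \<equiv> of_bool (x \<in> C i)"

lemma cluster_combination:
  assumes "i < k" "x \<in> C i"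
  shows "mul_vec k (transposed cluster_indicator) c x = c i"
proof -
  have "mul_vec k (transposed cluster_indicator) c x = (\<Sum>j<k. of_bool (j = i) * c j)"
    unfolding mul_vec_def using mem_cluster_iff[OF assms] by (intro sum.cong) auto
  also have "\<dots> = c i" using assms by simp
  finally show ?thesis .
qed

lemma sum_cluster_indicator:
  assumes "i < k"
  shows "mul_vec n cluster_indicator z i = (\<Sum>x\<in>C i. z x)"
proof -
  have "mul_vec n cluster_indicator z i = (\<Sum>x<n. if x \<in> C i then z x else 0)"
    unfolding mul_vec_def by (intro sum.cong) auto
  also have "\<dots> = (\<Sum>x\<in>{..<n} \<inter> C i. z x)" by (simp add: sum.inter_restrict)
  finally have "mul_vec n cluster_indicator z i = (\<Sum>x\<in>{..<n} \<inter> C i. z x)" .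
  then show ?thesis using cluster_subset[OF assms] by (simp add: Int_absorb1)
qed

lemma dirichlet_cluster_constant_le:
  assumes z: "\<And>i x. i < k \<Longrightarrow> x \<in> C i \<Longrightarrow> z x = c i"
  shows "dirichlet E {..<n} z \<le> 4 * \<epsilon> * d * (l2norm n z)\<^sup>2"
proof -
  let ?differ = "\<lambda>x y. of_bool (z x \<noteq> z y) :: real"
  have "dirichlet E {..<n} z \<le> (\<Sum>x<n. \<Sum>y<n. adj E x y * (2 * (?differ x y * (z x)\<^sup>2) + 2 * (?differ x y * (z y)\<^sup>2)))"
    unfolding dirichlet_def
  proof (intro sum_mono mult_left_mono)
    show "(z x - z y)\<^sup>2 \<le> 2 * (?differ x y * (z x)\<^sup>2) + 2 * (?differ x y * (z y)\<^sup>2)" for x y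
      using sum_squares_bound[of "z x" "- z y"] by (cases "z x = z y") (simp_all add: power2_diff)
  qed simp
  also have "\<dots> = 2 * (\<Sum>x<n. \<Sum>y<n. adj E x y * (?differ x y * (z x)\<^sup>2))
      + 2 * (\<Sum>x<n. \<Sum>y<n. adj E x y * (?differ x y * (z y)\<^sup>2))"
    by (simp add: sum_distrib_left sum.distrib[symmetric] algebra_simps)
  also have "\<dots> = 4 * (\<Sum>x<n. \<Sum>y<n. adj E x y * (?differ x y * (z x)\<^sup>2))"
    unfolding sum_adj_swap[OF symp_E, of "\<lambda>x y. ?differ x y * (z y)\<^sup>2"] by (simp add: eq_commute)
  also have "(\<Sum>x<n. \<Sum>y<n. adj E x y * (?differ x y * (z x)\<^sup>2)) \<le> (\<Sum>i<k. (c i)\<^sup>2 * cut_weight E (C i) ({..<n} - C i))"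
    unfolding sum_clusters[of "\<lambda>x. \<Sum>y<n. _ x y"] cut_weight_def sum_distrib_left
  proof (intro sum_mono)
    fix i x assume i: "i \<in> {..<k}" and x: "x \<in> C i"
    have "(\<Sum>y<n. adj E x y * (?differ x y * (z x)\<^sup>2)) = (\<Sum>y\<in>{..<n} - C i. adj E x y * (?differ x y * (z x)\<^sup>2))"
      using i x z by (intro sum.mono_neutral_right) auto
    also have "\<dots> \<le> (\<Sum>y\<in>{..<n} - C i. (c i)\<^sup>2 * adj E x y)"
      using i x z by (intro sum_mono) (auto simp: adj_def)
    finally show "(\<Sum>y<n. adj E x y * (?differ x y * (z x)\<^sup>2)) \<le> (\<Sum>y\<in>{..<n} - C i. (c i)\<^sup>2 * adj E x y)" .
  qed
  also have "\<dots> \<le> (\<Sum>i<k. (c i)\<^sup>2 * (\<epsilon> * d * card (C i)))"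
    using cluster_cut_le by (intro sum_mono mult_left_mono) auto
  also have "\<dots> = \<epsilon> * d * (l2norm n z)\<^sup>2"
    unfolding l2norm_sq sum_clusters by (simp add: z sum_distrib_left mult_ac)
  finally show ?thesis by simp
qed

lemma low_eigenvalue_le:
  assumes "a < k"
  shows "lam a \<le> 2 * \<epsilon>"
proof -
  have "1 - 2 * \<epsilon> \<le> 1 - lam a"
  proof (rule courant_fischer_ge[where B = "transposed cluster_indicator", OF assms])
    show "k \<le> n" using two_k_le_n by linarith
    fix c :: "nat \<Rightarrow> real"
    let ?z = "mul_vec k (transposed cluster_indicator) c"
    show "0 < l2norm n ?z" if "\<exists>i<k. c i \<noteq> 0"
    proof -
      obtain i x where "i < k" "c i \<noteq> 0" "x \<in> C i" using \<open>\<exists>i<k. c i \<noteq> 0\<close> cluster_nonempty by blast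
      then show ?thesis using cluster_subset unfolding l2norm_pos_iff
        by (intro exI[of _ x]) (auto simp: cluster_combination)
    qed
    have "dirichlet E {..<n} ?z \<le> 4 * \<epsilon> * d * (l2norm n ?z)\<^sup>2"
      by (rule dirichlet_cluster_constant_le) (rule cluster_combination)
    then show "(1 - 2 * \<epsilon>) * (l2norm n ?z)\<^sup>2 \<le> dot n ?z (mul_vec n normalized_adj ?z)"
      using d_pos unfolding dot_normalized_adj by (simp add: field_simps)
  qed
  then show ?thesis by simp
qed

lemma high_eigenvalue_ge:
  assumes "k \<le> a" "a < n"
  shows "\<phi>\<^sup>2 / 2 \<le> lam a"
proof -
  have "1 - lam a \<le> 1 - \<phi>\<^sup>2 / 2"
  proof (rule courant_fischer_le[where B = cluster_indicator, OF assms])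
    fix z :: "nat \<Rightarrow> real" assume orthogonal: "\<forall>i<k. mul_vec n cluster_indicator z i = 0"
    have mean_zero: "(\<Sum>x\<in>C i. z x) = 0" if "i < k" for i
      unfolding sum_cluster_indicator[OF that, symmetric] using orthogonal that by blast
    have "\<phi>\<^sup>2 * d * (l2norm n z)\<^sup>2 = (\<Sum>i<k. \<phi>\<^sup>2 * d * (\<Sum>x\<in>C i. (z x)\<^sup>2))"
      by (simp add: l2norm_sq sum_clusters sum_distrib_left)
    also have "\<dots> \<le> (\<Sum>i<k. dirichlet E (C i) z)"
      using cluster_subset mean_zero \<phi> d_pos
      by (intro sum_mono cheeger_inequality finite_cluster symp_E cluster_expands adj_row_sum_le) auto
    also have "\<dots> \<le> (\<Sum>i<k. \<Sum>x\<in>C i. \<Sum>y<n. adj E x y * (z x - z y)\<^sup>2)"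
      unfolding dirichlet_def using cluster_subset by (intro sum_mono sum_mono2) auto
    also have "\<dots> = dirichlet E {..<n} z" unfolding dirichlet_def by (rule sum_clusters[symmetric])
    finally show "dot n z (mul_vec n normalized_adj z) \<le> (1 - \<phi>\<^sup>2 / 2) * (l2norm n z)\<^sup>2"
      using d_pos unfolding dot_normalized_adj by (simp add: field_simps)
  qed
  then show ?thesis by simp
qed

end

section \<open>Sup-norm bound on the low eigenvectors\<close>

lemma exp_le_one_minus:
  fixes x :: real
  assumes "0 \<le> x" "x \<le> 1 / 1000"
  shows "exp (- (11 / 10 * x)) \<le> 1 - x"
proof -
  have "x\<^sup>2 \<le> 1 / 1000 * x" unfolding power2_eq_square using assms by (intro mult_right_mono)
  moreover have "- x - 2 * x\<^sup>2 \<le> ln (1 - x)" using assms by (intro ln_one_minus_pos_lower_bound) auto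
  ultimately have "- (11 / 10 * x) \<le> ln (1 - x)" using assms(1) by linarith
  then show ?thesis using assms by (simp add: ln_ge_iff)
qed

context clustered_spectrum
begin

definition \<nu> :: "real \<Rightarrow> real" where
  "\<nu> r = real n powr (r * \<epsilon> / \<phi>\<^sup>2)"

lemma \<nu>_pos: "0 < \<nu> r"
  using n_ge_4 by (simp add: \<nu>_def)

lemma \<nu>_add: "\<nu> (r + s) = \<nu> r * \<nu> s"
  by (simp add: \<nu>_def powr_add[symmetric] add_divide_distrib distrib_right)

lemma \<nu>_mono: "r \<le> s \<Longrightarrow> \<nu> r \<le> \<nu> s"
  unfolding \<nu>_def using n_ge_4 \<epsilon> by (intro powr_mono divide_right_mono mult_right_mono) auto

lemma \<nu>_0 [simp]: "\<nu> 0 = 1"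
  using n_ge_4 by (simp add: \<nu>_def)

lemma \<nu>_ge_1: "0 \<le> r \<Longrightarrow> 1 \<le> \<nu> r"
  using \<nu>_mono[of 0 r] by simp

lemma \<nu>_eq_exp: "\<nu> r = exp (r * (\<epsilon> / \<phi>\<^sup>2) * ln n)"
  using n_ge_4 by (simp add: \<nu>_def powr_def)

lemma ln_n_ge_1: "1 \<le> ln n"
proof -
  have "exp 1 \<le> real n" using exp_le n_ge_4 by linarith
  then show ?thesis using n_ge_4 by (subst ln_ge_iff) auto
qed

lemma small_set_cut_ge:
  assumes S: "S \<subseteq> {..<n}" and small: "\<And>i. i < k \<Longrightarrow> 2 * card S \<le> card (C i)"
  shows "\<phi> * d * card S \<le> cut_weight E S ({..<n} - S)"
proof -
  have fin: "finite S" using finite_subset[OF S] by simp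
  have split: "(\<Sum>x\<in>S. g x) = (\<Sum>i<k. \<Sum>x\<in>S \<inter> C i. g x)" for g :: "nat \<Rightarrow> real"
  proof -
    have "(\<Sum>x\<in>S. g x) = (\<Sum>x<n. if x \<in> S then g x else 0)"
      using S by (simp add: sum.If_cases Int_absorb1)
    also have "\<dots> = (\<Sum>i<k. \<Sum>x\<in>S \<inter> C i. g x)"
      unfolding sum_clusters by (rule sum.cong[OF refl]) (simp add: sum.If_cases finite_cluster Int_commute)
    finally show ?thesis .
  qed
  have "\<phi> * d * card S = (\<Sum>i<k. \<phi> * d * card (S \<inter> C i))"
    using split[of "\<lambda>_. \<phi> * d"] by (simp add: mult.commute)
  also have "\<dots> \<le> (\<Sum>i<k. cut_weight E (S \<inter> C i) ({..<n} - S))"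
  proof (rule sum_mono)
    fix i assume "i \<in> {..<k}"
    then have i: "i < k" by simp
    have "card (S \<inter> C i) \<le> card S" using fin by (intro card_mono) auto
    then have "2 * card (S \<inter> C i) \<le> card (C i)" using small[OF i] by linarith
    then have "\<phi> * d * card (S \<inter> C i) \<le> cut_weight E (S \<inter> C i) (C i - S \<inter> C i)"
      using cluster_expands[OF i] by (simp add: expands_def)
    also have "\<dots> \<le> cut_weight E (S \<inter> C i) ({..<n} - S)"
      using cluster_subset[OF i] fin by (intro cut_weight_mono) auto
    finally show "\<phi> * d * card (S \<inter> C i) \<le> cut_weight E (S \<inter> C i) ({..<n} - S)" .
  qed
  also have "\<dots> = cut_weight E S ({..<n} - S)" unfolding cut_weight_def by (rule split[symmetric])
  finally show ?thesis .
qed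

lemma sum_drop_across:
  fixes w :: "nat \<Rightarrow> real" and l :: real
  assumes eigen: "\<And>x. x < n \<Longrightarrow> mul_vec n normalized_adj w x = (1 - l) * w x" and S: "S \<subseteq> {..<n}"
  shows "(\<Sum>x\<in>S. \<Sum>y\<in>{..<n} - S. adj E x y * (w x - w y)) = d * l * (\<Sum>x\<in>S. w x)"
proof -
  have row: "(\<Sum>y<n. adj E x y * (w x - w y)) = d * l * w x" if "x < n" for x
    by (simp add: right_diff_distrib sum_subtractf sum_distrib_right[symmetric] adj_row_sum[OF that]
        sum_adj_eq_normalized eigen[OF that])
       (simp add: algebra_simps)
  have "(\<Sum>x\<in>S. \<Sum>y\<in>S. adj E x y * (w x - w y)) = (\<Sum>x\<in>S. \<Sum>y\<in>S. adj E x y * (w y - w x))"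
    by (rule sum_adj_swap[OF symp_E])
  also have "\<dots> = - (\<Sum>x\<in>S. \<Sum>y\<in>S. adj E x y * (w x - w y))"
    by (simp add: sum_negf[symmetric] algebra_simps)
  finally have inside: "(\<Sum>x\<in>S. \<Sum>y\<in>S. adj E x y * (w x - w y)) = 0" by simp
  have "(\<Sum>x\<in>S. \<Sum>y\<in>{..<n} - S. adj E x y * (w x - w y))
      = (\<Sum>x\<in>S. (\<Sum>y<n. adj E x y * (w x - w y)) - (\<Sum>y\<in>S. adj E x y * (w x - w y)))"
    using S by (intro sum.cong refl sum_diff) auto
  also have "\<dots> = (\<Sum>x\<in>S. d * l * w x)"
    using row S by (simp add: sum_subtractf inside subset_eq)
  finally show ?thesis by (simp add: sum_distrib_left)
qed

definition superlevel :: "(nat \<Rightarrow> real) \<Rightarrow> real \<Rightarrow> nat set" where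
  "superlevel w \<theta> = {x. x < n \<and> \<theta> \<le> w x}"

definition drop_rate :: real where
  "drop_rate = 8 * \<epsilon> / \<phi>"

lemma superlevel_subset: "superlevel w \<theta> \<subseteq> {..<n}"
  by (auto simp: superlevel_def)

lemma finite_superlevel: "finite (superlevel w \<theta>)"
  by (simp add: superlevel_def)

lemma drop_rate_bounds: "0 < drop_rate" "drop_rate \<le> \<phi> / 12500" "drop_rate \<le> 1 / 12500"
proof -
  show "0 < drop_rate" using \<epsilon> \<phi> by (simp add: drop_rate_def)
  show "drop_rate \<le> \<phi> / 12500" using \<epsilon>_le(1) \<phi> by (simp add: drop_rate_def power2_eq_square field_simps)
  then show "drop_rate \<le> 1 / 12500" using \<phi> by linarith
qed

lemma superlevel_drop_subset:
  assumes "0 < \<theta>"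
  shows "superlevel w \<theta> \<subseteq> superlevel w (\<theta> * (1 - drop_rate))"
proof -
  have "\<theta> * (1 - drop_rate) \<le> \<theta>" using drop_rate_bounds(1) assms by (simp add: mult_left_le)
  then show ?thesis by (auto simp: superlevel_def)
qed

text \<open>By \<open>sum_drop_across\<close> the total drop along the edges leaving a superlevel set is small, so most of
  these edges lead into the slightly lower superlevel set.\<close>

lemma superlevel_growth:
  assumes eigen: "\<And>x. x < n \<Longrightarrow> mul_vec n normalized_adj w x = (1 - l) * w x"
    and l: "0 \<le> l" "l \<le> 2 * \<epsilon>" and \<theta>: "0 < \<theta>"
    and average: "(\<Sum>x\<in>superlevel w \<theta>. w x) \<le> 2 * \<theta> * card (superlevel w \<theta>)"
    and small: "\<And>i. i < k \<Longrightarrow> 2 * card (superlevel w \<theta>) \<le> card (C i)"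
  shows "(1 + \<phi> / 2) * card (superlevel w \<theta>) \<le> card (superlevel w (\<theta> * (1 - drop_rate)))"
proof -
  let ?S = "superlevel w \<theta>" and ?S' = "superlevel w (\<theta> * (1 - drop_rate))" and ?V = "{..<n}"
  note sub = superlevel_drop_subset[OF \<theta>, of w] and fin = finite_superlevel and in_V = superlevel_subset
  note rate = drop_rate_bounds
  have "drop_rate * \<theta> * cut_weight E ?S (?V - ?S') = (\<Sum>x\<in>?S. \<Sum>y\<in>?V - ?S'. adj E x y * (drop_rate * \<theta>))"
    by (simp add: cut_weight_def sum_distrib_left mult.commute)
  also have "\<dots> \<le> (\<Sum>x\<in>?S. \<Sum>y\<in>?V - ?S'. adj E x y * (w x - w y))"
    by (intro sum_mono mult_left_mono) (auto simp: superlevel_def algebra_simps)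
  also have "\<dots> \<le> (\<Sum>x\<in>?S. \<Sum>y\<in>?V - ?S. adj E x y * (w x - w y))"
    using sub by (intro sum_mono sum_mono2) (auto simp: superlevel_def)
  also have "\<dots> = d * l * (\<Sum>x\<in>?S. w x)" by (rule sum_drop_across[OF eigen in_V])
  also have "\<dots> \<le> d * (2 * \<epsilon>) * (2 * \<theta> * card ?S)"
    using average l \<theta> by (intro mult_mono) (auto intro!: sum_nonneg simp: superlevel_def)
  also have "\<dots> = drop_rate * \<theta> * (\<phi> / 2 * d * card ?S)" using \<phi> by (simp add: drop_rate_def)
  finally have far: "cut_weight E ?S (?V - ?S') \<le> \<phi> / 2 * d * card ?S" using rate \<theta> by simp
  have "?V - ?S = (?S' - ?S) \<union> (?V - ?S')" using sub in_V by blast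
  moreover have "(?S' - ?S) \<inter> (?V - ?S') = {}" by blast
  ultimately have "cut_weight E ?S (?V - ?S) = cut_weight E ?S (?S' - ?S) + cut_weight E ?S (?V - ?S')"
    using fin by (simp add: cut_weight_Un_right)
  then have "\<phi> / 2 * d * card ?S \<le> cut_weight E ?S (?S' - ?S)"
    using small_set_cut_ge[OF in_V small] far by simp
  also have "\<dots> = cut_weight E (?S' - ?S) ?S" by (rule cut_weight_commute[OF symp_E])
  also have "\<dots> \<le> (\<Sum>x\<in>?S' - ?S. real d)"
    unfolding cut_weight_def using in_V by (intro sum_mono adj_row_sum_le) (auto simp: superlevel_def)
  finally have "\<phi> / 2 * card ?S \<le> card (?S' - ?S)" using d_pos by simp
  moreover have "real (card ?S') = card ?S + card (?S' - ?S)"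
    using card_Diff_subset[OF fin sub] card_mono[OF fin sub] by simp
  ultimately show ?thesis by (simp add: distrib_right)
qed

lemma superlevel_average_step:
  assumes \<theta>: "0 < \<theta>"
    and average: "(\<Sum>x\<in>superlevel w \<theta>. w x) \<le> 2 * \<theta> * card (superlevel w \<theta>)"
    and growth: "(1 + \<phi> / 2) * card (superlevel w \<theta>) \<le> card (superlevel w (\<theta> * (1 - drop_rate)))"
  shows "(\<Sum>x\<in>superlevel w (\<theta> * (1 - drop_rate)). w x)
    \<le> 2 * (\<theta> * (1 - drop_rate)) * card (superlevel w (\<theta> * (1 - drop_rate)))"
proof -
  let ?S = "superlevel w \<theta>" and ?S' = "superlevel w (\<theta> * (1 - drop_rate))"
  note sub = superlevel_drop_subset[OF \<theta>, of w] and fin = finite_superlevel and rate = drop_rate_bounds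
  have "(\<Sum>x\<in>?S'. w x) = (\<Sum>x\<in>?S' - ?S. w x) + (\<Sum>x\<in>?S. w x)" by (rule sum.subset_diff[OF sub fin])
  also have "(\<Sum>x\<in>?S' - ?S. w x) \<le> (\<Sum>x\<in>?S' - ?S. \<theta>)" by (rule sum_mono) (auto simp: superlevel_def)
  also have "\<dots> = \<theta> * (real (card ?S') - card ?S)"
    using card_Diff_subset[OF fin sub] card_mono[OF fin sub] by simp
  finally have "(\<Sum>x\<in>?S'. w x) \<le> \<theta> * (real (card ?S') + card ?S)"
    using average by (simp add: algebra_simps)
  also have "\<dots> \<le> \<theta> * (2 * (1 - drop_rate) * card ?S')"
  proof (rule mult_left_mono)
    have "\<phi> * drop_rate \<le> 1 * drop_rate" using \<phi> rate by (intro mult_right_mono) auto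
    moreover have "(1 + \<phi> / 2) * (1 - 2 * drop_rate) = 1 + \<phi> / 2 - 2 * drop_rate - \<phi> * drop_rate"
      by (simp add: algebra_simps)
    ultimately have "1 \<le> (1 + \<phi> / 2) * (1 - 2 * drop_rate)" using rate \<phi> by linarith
    then have "card ?S \<le> ((1 + \<phi> / 2) * (1 - 2 * drop_rate)) * card ?S" by (simp add: mult_le_cancel_right1)
    also have "\<dots> = (1 - 2 * drop_rate) * ((1 + \<phi> / 2) * card ?S)" by simp
    also have "\<dots> \<le> (1 - 2 * drop_rate) * card ?S'" using growth rate by (intro mult_left_mono) auto
    finally show "real (card ?S') + card ?S \<le> 2 * (1 - drop_rate) * card ?S'" by (simp add: algebra_simps)
  qed (use \<theta> in simp)
  finally show ?thesis by (simp add: mult_ac)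
qed

lemma large_superlevel_bound:
  fixes \<theta> :: real
  assumes norm: "l2norm n w = 1" and \<theta>: "0 \<le> \<theta>"
    and large: "j < k" "card (C j) \<le> 2 * card (superlevel w \<theta>)"
  shows "n * \<theta>\<^sup>2 \<le> 2 * \<beta> * k"
proof -
  have "card (superlevel w \<theta>) * \<theta>\<^sup>2 = (\<Sum>x\<in>superlevel w \<theta>. \<theta>\<^sup>2)" by simp
  also have "\<dots> \<le> (\<Sum>x\<in>superlevel w \<theta>. (w x)\<^sup>2)"
    using \<theta> by (intro sum_mono power_mono) (auto simp: superlevel_def)
  also have "\<dots> \<le> (l2norm n w)\<^sup>2" unfolding l2norm_sq using superlevel_subset by (intro sum_mono2) auto
  finally have "card (superlevel w \<theta>) * \<theta>\<^sup>2 \<le> 1" by (simp add: norm)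
  moreover have "real n \<le> \<beta> * k * (2 * card (superlevel w \<theta>))"
    using card_cluster_ge[OF large(1)] large(2) \<beta>_ge_1
    by (elim order_trans) (intro mult_left_mono, simp_all)
  then have "n * \<theta>\<^sup>2 \<le> \<beta> * k * (2 * card (superlevel w \<theta>)) * \<theta>\<^sup>2" by (rule mult_right_mono) simp
  moreover have "0 \<le> 2 * \<beta> * k" using \<beta>_ge_1 by simp
  ultimately show ?thesis
    using mult_left_mono[of "card (superlevel w \<theta>) * \<theta>\<^sup>2" 1 "2 * \<beta> * k"] by (simp add: mult_ac)
qed

lemma drop_power_ge:
  assumes "real i \<le> 1 + 3 * ln n / \<phi>"
  shows "2 / 3 \<le> ((1 - drop_rate) ^ i)\<^sup>2 * \<nu> 60"
proof -
  have small: "11 / 5 * drop_rate \<le> 1 / 5000" using drop_rate_bounds(3) by simp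
  have "11 / 5 * drop_rate * i \<le> 11 / 5 * drop_rate * (1 + 3 * ln n / \<phi>)"
    using assms drop_rate_bounds by (intro mult_left_mono) auto
  also have "\<dots> = 11 / 5 * drop_rate + 264 / 5 * ((\<epsilon> / \<phi>\<^sup>2) * ln n)"
    using \<phi> by (simp add: drop_rate_def power2_eq_square field_simps)
  also have "\<dots> \<le> 1 / 5000 + 60 * ((\<epsilon> / \<phi>\<^sup>2) * ln n)"
    using small \<epsilon> ln_n_ge_1 by (intro add_mono mult_right_mono) auto
  finally have exponent: "- (1 / 5000) \<le> - (11 / 5 * drop_rate * i) + 60 * (\<epsilon> / \<phi>\<^sup>2) * ln n" by simp
  have "2 / 3 \<le> exp (- (1 / 5000) :: real)" using exp_ge_add_one_self[of "- (1 / 5000) :: real"] by simp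
  also have "\<dots> \<le> exp (- (11 / 5 * drop_rate * i)) * \<nu> 60"
    using exponent by (simp add: \<nu>_eq_exp exp_add[symmetric])
  also have "exp (- (11 / 5 * drop_rate * i)) = (exp (- (11 / 10 * drop_rate)) ^ i)\<^sup>2"
    by (simp add: exp_of_nat_mult[symmetric] exp_double[symmetric] algebra_simps)
  also have "(exp (- (11 / 10 * drop_rate)) ^ i)\<^sup>2 * \<nu> 60 \<le> ((1 - drop_rate) ^ i)\<^sup>2 * \<nu> 60"
    using drop_rate_bounds \<nu>_pos[of 60] by (intro mult_right_mono power_mono exp_le_one_minus) auto
  finally show ?thesis .
qed

lemma ln_one_plus_half_ge: "\<phi> / 3 \<le> ln (1 + \<phi> / 2)"
proof -
  have "ln (1 / (1 + \<phi> / 2)) \<le> 1 / (1 + \<phi> / 2) - 1" using \<phi> by (intro ln_le_minus_one) simp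
  then have "(\<phi> / 2) / (1 + \<phi> / 2) \<le> ln (1 + \<phi> / 2)" using \<phi> by (simp add: ln_div field_simps)
  moreover have "\<phi> / 3 \<le> (\<phi> / 2) / (1 + \<phi> / 2)" using \<phi> by (simp add: field_simps)
  ultimately show ?thesis by linarith
qed

context
  fixes w :: "nat \<Rightarrow> real" and l :: real and x0 :: nat
  assumes eigen: "\<And>x. x < n \<Longrightarrow> mul_vec n normalized_adj w x = (1 - l) * w x"
    and l: "0 \<le> l" "l \<le> 2 * \<epsilon>" and norm: "l2norm n w = 1"
    and x0: "x0 < n" "0 < w x0" and max: "\<And>x. x < n \<Longrightarrow> w x \<le> w x0"
begin

definition level :: "nat \<Rightarrow> real" where
  "level i = w x0 * (1 - drop_rate) ^ i"

definition small_level :: "nat \<Rightarrow> bool" where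
  "small_level i \<longleftrightarrow> (\<forall>j<k. 2 * card (superlevel w (level i)) \<le> card (C j))"

lemma level_pos: "0 < level i"
  using x0 drop_rate_bounds by (simp add: level_def)

lemma superlevel_exponential_growth:
  assumes "\<forall>j<i. small_level j"
  shows "(1 + \<phi> / 2) ^ i \<le> card (superlevel w (level i)) \<and>
    (\<Sum>x\<in>superlevel w (level i). w x) \<le> 2 * level i * card (superlevel w (level i))"
  using assms
proof (induction i)
  case 0
  have "x0 \<in> superlevel w (level 0)" using x0 by (simp add: superlevel_def level_def)
  then have "1 \<le> card (superlevel w (level 0))"
    using finite_superlevel by (metis One_nat_def Suc_leI card_gt_0_iff empty_iff)
  moreover have "(\<Sum>x\<in>superlevel w (level 0). w x) \<le> card (superlevel w (level 0)) * w x0"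
    using max by (intro sum_bounded_above) (auto simp: superlevel_def)
  moreover have "0 \<le> w x0 * card (superlevel w (level 0))" using x0 by simp
  ultimately show ?case by (simp add: level_def mult.commute)
next
  case (Suc i)
  then have IH: "(1 + \<phi> / 2) ^ i \<le> card (superlevel w (level i))"
    "(\<Sum>x\<in>superlevel w (level i). w x) \<le> 2 * level i * card (superlevel w (level i))" by auto
  have level_Suc: "level (Suc i) = level i * (1 - drop_rate)" by (simp add: level_def)
  have growth: "(1 + \<phi> / 2) * card (superlevel w (level i)) \<le> card (superlevel w (level (Suc i)))"
    unfolding level_Suc using Suc.prems by (intro superlevel_growth[OF eigen l level_pos IH(2)]) (auto simp: small_level_def)
  have "(1 + \<phi> / 2) ^ Suc i \<le> (1 + \<phi> / 2) * card (superlevel w (level i))"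
    using IH(1) \<phi> by (simp add: mult_left_mono)
  then show ?case
    using growth superlevel_average_step[OF level_pos IH(2)] unfolding level_Suc by simp
qed

lemma growth_phase_le:
  assumes "\<forall>j<i. small_level j"
  shows "real i \<le> 3 * ln n / \<phi>"
proof -
  have "card (superlevel w (level i)) \<le> n" using card_mono[OF _ superlevel_subset] by fastforce
  then have "(1 + \<phi> / 2) ^ i \<le> n"
    using superlevel_exponential_growth[OF assms] by (meson of_nat_mono order_trans)
  then have "ln ((1 + \<phi> / 2) ^ i) \<le> ln n" using \<phi> n_ge_4 by (subst ln_le_cancel_iff) auto
  then have "i * ln (1 + \<phi> / 2) \<le> ln n" using \<phi> by (simp add: ln_realpow)
  then have "i * (\<phi> / 3) \<le> ln n"
    using mult_left_mono[OF ln_one_plus_half_ge, of "real i"] by simp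
  then show ?thesis using \<phi> by (simp add: field_simps)
qed

lemma ex_large_level: "\<exists>i. real i \<le> 1 + 3 * ln n / \<phi> \<and> \<not> small_level i"
proof -
  have "\<exists>i. \<not> small_level i"
  proof (rule ccontr)
    assume "\<not> ?thesis"
    then have "real i \<le> 3 * ln n / \<phi>" for i by (intro growth_phase_le) blast
    then show False using reals_Archimedean2 not_le by blast
  qed
  then obtain i where i: "\<not> small_level i" "\<forall>j<i. small_level j"
    using exists_least_iff[of "\<lambda>i. \<not> small_level i"] by blast
  have "real i \<le> 1 + 3 * ln n / \<phi>"
  proof (cases i)
    case (Suc j)
    then have "real j \<le> 3 * ln n / \<phi>" using i(2) by (intro growth_phase_le) auto
    then show ?thesis using Suc by simp
  qed (use ln_n_ge_1 \<phi> in simp)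
  with i(1) show ?thesis by blast
qed

lemma eigenvector_max_bound: "(w x0)\<^sup>2 \<le> 3 * \<beta> * k * \<nu> 60 / n"
proof -
  obtain i j where i: "real i \<le> 1 + 3 * ln n / \<phi>"
    and j: "j < k" "card (C j) \<le> 2 * card (superlevel w (level i))"
    using ex_large_level unfolding small_level_def by (metis nat_le_linear)
  have "n * (w x0)\<^sup>2 * (2 / 3) \<le> n * (w x0)\<^sup>2 * (((1 - drop_rate) ^ i)\<^sup>2 * \<nu> 60)"
    by (intro mult_left_mono drop_power_ge[OF i]) auto
  also have "\<dots> = n * (level i)\<^sup>2 * \<nu> 60" by (simp add: level_def power_mult_distrib)
  also have "\<dots> \<le> 2 * \<beta> * k * \<nu> 60"
    using large_superlevel_bound[OF norm _ j] level_pos[of i] \<nu>_pos[of 60] by (intro mult_right_mono) auto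
  finally show ?thesis using n_ge_4 by (simp add: field_simps)
qed

end

lemma low_eigenvector_bound:
  assumes a: "a < k" and x: "x < n"
  shows "(v a x)\<^sup>2 \<le> 3 * \<beta> * k * \<nu> 60 / n"
proof -
  have a_less: "a < n" using a two_k_le_n by linarith
  have norm: "l2norm n (v a) = 1"
    using orthonormal[OF a_less a_less] by (simp add: dot_self abs_square_eq_1)
  obtain x0 where x0: "x0 < n" and max: "\<And>y. y < n \<Longrightarrow> \<bar>v a y\<bar> \<le> \<bar>v a x0\<bar>"
    using Max_in[of "(\<lambda>y. \<bar>v a y\<bar>) ` {..<n}"] Max_ge[of "(\<lambda>y. \<bar>v a y\<bar>) ` {..<n}"] x by fastforce
  define s where "s = sgn (v a x0)"
  have "0 < l2norm n (v a)" by (simp add: norm)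
  then have nonzero: "v a x0 \<noteq> 0" using max unfolding l2norm_pos_iff by fastforce
  then have s: "\<bar>s\<bar> = 1" "s * v a x0 = \<bar>v a x0\<bar>" by (auto simp: s_def sgn_if)
  have "(s * v a x0)\<^sup>2 \<le> 3 * \<beta> * k * \<nu> 60 / n"
  proof (rule eigenvector_max_bound[where l = "lam a"])
    show "mul_vec n normalized_adj (\<lambda>y. s * v a y) z = (1 - lam a) * (s * v a z)" if "z < n" for z
      using eigenvector[OF a_less that] by (simp add: mul_vec_def sum_distrib_left[symmetric] mult.left_commute[of _ s])
    show "s * v a z \<le> s * v a x0" if "z < n" for z
      using max[OF that] s abs_le_D1[of "s * v a z"] by (simp add: abs_mult)
    show "l2norm n (\<lambda>y. s * v a y) = 1"
      using norm l2norm_abs[of "\<lambda>y. s * v a y" n] l2norm_abs[of "v a" n] s(1) by (simp add: abs_mult)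
  qed (use s nonzero x0 eigenvalue_bounds(1)[OF a_less] low_eigenvalue_le[OF a] in auto)
  moreover have "(s * v a x0)\<^sup>2 = (v a x0)\<^sup>2" by (simp add: s(2))
  moreover have "(v a x)\<^sup>2 \<le> (v a x0)\<^sup>2" using max[OF x] by (simp add: abs_le_square_iff)
  ultimately show ?thesis by linarith
qed

definition coherence :: real where
  "coherence = 3 * \<beta> * (real k)\<^sup>2 * \<nu> 60"

lemma coherence_ge_12: "12 \<le> coherence"
proof -
  have "1 * (4 * 1) \<le> \<beta> * ((real k)\<^sup>2 * \<nu> 60)"
    using \<beta>_ge_1 k_ge_2 \<nu>_ge_1[of 60] power_mono[of 2 "real k" 2] by (intro mult_mono) auto
  then show ?thesis by (simp add: coherence_def)
qed

lemma eigenvector_entry_sq_le: "a < k \<Longrightarrow> x < n \<Longrightarrow> (v a x)\<^sup>2 \<le> coherence / (k * n)"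
  using low_eigenvector_bound[of a x] k_ge_2 by (simp add: coherence_def power2_eq_square)

lemma embedding_norm_sq_le:
  assumes "x < n"
  shows "(l2norm k (\<lambda>a. v a x))\<^sup>2 \<le> coherence / n" "(l2norm k (\<lambda>a. v a x))\<^sup>2 \<le> 1"
proof -
  have "(l2norm k (\<lambda>a. v a x))\<^sup>2 \<le> (\<Sum>a<k. coherence / (k * n))"
    unfolding l2norm_sq using eigenvector_entry_sq_le assms by (intro sum_mono) auto
  then show "(l2norm k (\<lambda>a. v a x))\<^sup>2 \<le> coherence / n" using k_ge_2 by simp
  have "(l2norm k (\<lambda>a. v a x))\<^sup>2 \<le> (\<Sum>a<n. (v a x)\<^sup>2)"
    unfolding l2norm_sq using two_k_le_n by (intro sum_mono2) auto
  also have "\<dots> = 1" using complete[OF assms assms] by (simp add: power2_eq_square)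
  finally show "(l2norm k (\<lambda>a. v a x))\<^sup>2 \<le> 1" .
qed

end

section \<open>Perturbation of the truncated inverse square\<close>

locale perturbed_low_rank = orthonormal_eigenbasis s w G \<sigma>
  for s :: nat and w G :: "nat \<Rightarrow> nat \<Rightarrow> real" and \<sigma> :: "nat \<Rightarrow> real" +
  fixes k :: nat and A :: "nat \<Rightarrow> nat \<Rightarrow> real" and D :: "nat \<Rightarrow> real" and \<delta> \<eta> \<mu> :: real
  assumes k: "k \<le> s"
    and gram: "\<And>a b. a < k \<Longrightarrow> b < k \<Longrightarrow> \<bar>(\<Sum>i<s. A i a * A i b) - (if a = b then 1 else 0)\<bar> \<le> \<delta> / k"
    and \<delta>: "0 \<le> \<delta>" "\<delta> \<le> 1 / 100"
    and D_ge: "\<And>a. a < k \<Longrightarrow> \<mu> \<le> D a" and \<mu>: "0 < \<mu>"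
    and noise: "\<And>i j. i < s \<Longrightarrow> j < s \<Longrightarrow> \<bar>G i j - (\<Sum>a<k. A i a * D a * A j a)\<bar> \<le> \<eta> / s"
    and \<eta>: "0 \<le> \<eta>" "\<eta> \<le> \<mu> / 20"
begin

abbreviation mulA :: "(nat \<Rightarrow> real) \<Rightarrow> nat \<Rightarrow> real" where
  "mulA \<equiv> mul_vec k A"

abbreviation mulAt :: "(nat \<Rightarrow> real) \<Rightarrow> nat \<Rightarrow> real" where
  "mulAt \<equiv> mul_vec s (\<lambda>a i. A i a)"

definition N :: "nat \<Rightarrow> nat \<Rightarrow> real" where
  "N i j = G i j - (\<Sum>a<k. A i a * D a * A j a)"

lemma D_pos: "a < k \<Longrightarrow> 0 < D a"
  using D_ge[of a] \<mu> by linarith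

lemma mul_vec_G: "mul_vec s G x i = mulA (\<lambda>a. D a * mulAt x a) i + mul_vec s N x i"
proof -
  have "mulA (\<lambda>a. D a * mulAt x a) i = (\<Sum>a<k. \<Sum>j<s. A i a * D a * A j a * x j)"
    by (simp add: mul_vec_def sum_distrib_left mult.assoc)
  also have "\<dots> = mul_vec s (\<lambda>i j. \<Sum>a<k. A i a * D a * A j a) x i"
    by (subst sum.swap) (simp add: mul_vec_def sum_distrib_right)
  finally show ?thesis by (simp add: mul_vec_def N_def left_diff_distrib sum_subtractf)
qed

lemma l2norm_N_le: "l2norm s (mul_vec s N x) \<le> \<eta> * l2norm s x"
  using noise \<eta> by (intro l2norm_mul_vec_le) (auto simp: N_def)

lemma quadratic_form_G: "dot s x (mul_vec s G x) = (\<Sum>a<k. D a * (mulAt x a)\<^sup>2) + dot s x (mul_vec s N x)"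
proof -
  have "dot s x (mul_vec s G x) = dot s (mulA (\<lambda>a. D a * mulAt x a)) x + dot s x (mul_vec s N x)"
    unfolding dot_commute[of s _ x] dot_add_right[symmetric] by (intro dot_cong mul_vec_G refl)
  then show ?thesis unfolding dot_mul_vec by (simp add: dot_def power2_eq_square mult.assoc)
qed

lemma quadratic_form_N: "\<bar>dot s x (mul_vec s N x)\<bar> \<le> \<eta> * (l2norm s x)\<^sup>2"
  using order_trans[OF abs_dot_le mult_left_mono[OF l2norm_N_le L2_set_nonneg]]
  by (simp add: power2_eq_square mult_ac)

lemma gram_near_id: "l2norm k (\<lambda>a. mulAt (mulA y) a - y a) \<le> \<delta> * l2norm k y"
proof -
  let ?K = "\<lambda>a b. (\<Sum>i<s. A i a * A i b) - (if a = b then 1 else 0)"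
  have "mulAt (mulA y) a - y a = mul_vec k ?K y a" if "a < k" for a
    unfolding mul_vec_mul_vec unfolding mul_vec_def left_diff_distrib sum_subtractf using that
    by (simp add: if_distribR if_distrib[of "\<lambda>t. t * (_::real)"] cong: if_cong)
  then have "l2norm k (\<lambda>a. mulAt (mulA y) a - y a) = l2norm k (mul_vec k ?K y)"
    by (intro L2_set_cong) auto
  also have "\<dots> \<le> \<delta> * l2norm k y" using gram \<delta> by (intro l2norm_mul_vec_le) auto
  finally show ?thesis .
qed

lemma l2norm_mulA_sq: "(l2norm s (mulA y))\<^sup>2 = dot k y (mulAt (mulA y))"
  unfolding dot_self[symmetric] by (rule dot_mul_vec)

lemma mulA_coercive: "(1 - \<delta>) * (l2norm k y)\<^sup>2 \<le> (l2norm s (mulA y))\<^sup>2"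
proof -
  have "dot k y (mulAt (mulA y)) = (l2norm k y)\<^sup>2 + dot k y (\<lambda>a. mulAt (mulA y) a - y a)"
    by (simp add: dot_self[symmetric] dot_add_right[symmetric])
  moreover have "\<bar>dot k y (\<lambda>a. mulAt (mulA y) a - y a)\<bar> \<le> l2norm k y * (\<delta> * l2norm k y)"
    by (rule order_trans[OF abs_dot_le mult_left_mono[OF gram_near_id L2_set_nonneg]])
  ultimately show ?thesis unfolding l2norm_mulA_sq by (simp add: power2_eq_square algebra_simps)
qed

lemma l2norm_mulA_pos:
  assumes "\<exists>a<k. y a \<noteq> 0"
  shows "0 < l2norm s (mulA y)"
proof -
  have "0 < (1 - \<delta>) * (l2norm k y)\<^sup>2"
    using assms \<delta> unfolding l2norm_pos_iff[symmetric] by (intro mult_pos_pos) auto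
  then have "0 < (l2norm s (mulA y))\<^sup>2" using mulA_coercive[of y] by linarith
  then show ?thesis by (simp add: order_less_le)
qed

lemma gram_solvable: "\<exists>y. \<forall>a<k. mulAt (mulA y) a = f a"
proof -
  define K where "K a b = (if b < k then \<Sum>i<s. A i a * A i b else - f a)" for a b
  obtain c where nonzero: "\<exists>j<Suc k. c j \<noteq> 0" and kernel: "\<forall>a<k. mul_vec (Suc k) K c a = 0"
    using underdetermined_system_solvable[of k "Suc k" K] by blast
  have scaled_solution: "mulAt (mulA c) a = f a * c k" if "a < k" for a
  proof -
    have "mul_vec (Suc k) K c a = mulAt (mulA c) a - f a * c k"
      unfolding mul_vec_mul_vec by (simp add: mul_vec_def K_def)
    then show ?thesis using kernel that by simp
  qed
  have "c k \<noteq> 0"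
  proof
    assume zero: "c k = 0"
    then have "\<exists>j<k. c j \<noteq> 0" using nonzero less_Suc_eq by auto
    then have "0 < (l2norm s (mulA c))\<^sup>2" by (intro zero_less_power l2norm_mulA_pos)
    also have "\<dots> = 0" unfolding l2norm_mulA_sq using scaled_solution zero by (simp add: dot_def)
    finally show False by simp
  qed
  moreover have "mulAt (mulA (\<lambda>b. c b / c k)) a = mulAt (mulA c) a / c k" for a
    unfolding mul_vec_mul_vec by (rule mul_vec_divide)
  ultimately show ?thesis using scaled_solution by (intro exI[of _ "\<lambda>b. c b / c k"]) simp
qed

lemma gram_solution_bounds:
  assumes y: "\<forall>a<k. mulAt (mulA y) a = f a"
  shows "l2norm k y \<le> (51 / 50) * l2norm k f" "l2norm s (mulA y) \<le> (101 / 100) * l2norm k f"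
proof -
  have "(l2norm s (mulA y))\<^sup>2 = dot k y f" unfolding l2norm_mulA_sq using y by (simp add: dot_def)
  then have norm_sq_le: "(l2norm s (mulA y))\<^sup>2 \<le> l2norm k y * l2norm k f" using abs_dot_le[of k y f] by linarith
  have "(99 / 100) * (l2norm k y)\<^sup>2 \<le> (1 - \<delta>) * (l2norm k y)\<^sup>2" using \<delta> by (intro mult_right_mono) auto
  then have "((99 / 100) * l2norm k y) * l2norm k y \<le> l2norm k f * l2norm k y"
    using norm_sq_le mulA_coercive[of y] by (simp add: power2_eq_square mult_ac)
  then have y_le: "(99 / 100) * l2norm k y \<le> l2norm k f"
    using L2_set_nonneg[of y "{..<k}"] by (cases "l2norm k y = 0") auto
  then show "l2norm k y \<le> (51 / 50) * l2norm k f" using L2_set_nonneg[of f "{..<k}"] by linarith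
  have "(l2norm s (mulA y))\<^sup>2 \<le> (100 / 99 * l2norm k f) * l2norm k f"
    using norm_sq_le y_le mult_right_mono[of "l2norm k y" "100 / 99 * l2norm k f" "l2norm k f"] by simp
  also have "\<dots> \<le> ((101 / 100) * l2norm k f)\<^sup>2" by (simp add: power2_eq_square mult_right_mono)
  finally show "l2norm s (mulA y) \<le> (101 / 100) * l2norm k f" by (rule power2_le_imp_le) simp
qed

lemma mulAt_mulA_norm_ge:
  assumes y: "\<exists>a<k. y a \<noteq> 0"
  shows "(1 - \<delta>) * (l2norm s (mulA y))\<^sup>2 \<le> (l2norm k (mulAt (mulA y)))\<^sup>2"
proof -
  define x where "x = mulA y"
  have pos: "0 < (l2norm s x)\<^sup>2" unfolding x_def by (intro zero_less_power l2norm_mulA_pos y)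
  have "(l2norm s x)\<^sup>2 \<le> l2norm k y * l2norm k (mulAt x)"
    using abs_dot_le[of k y "mulAt x"] by (simp add: x_def l2norm_mulA_sq)
  then have "((l2norm s x)\<^sup>2)\<^sup>2 \<le> (l2norm k y * l2norm k (mulAt x))\<^sup>2" by (intro power_mono) auto
  then have "(1 - \<delta>) * ((l2norm s x)\<^sup>2)\<^sup>2 \<le> (1 - \<delta>) * (l2norm k y * l2norm k (mulAt x))\<^sup>2"
    using \<delta> by (intro mult_left_mono) auto
  also have "\<dots> = ((1 - \<delta>) * (l2norm k y)\<^sup>2) * (l2norm k (mulAt x))\<^sup>2" by (simp add: power_mult_distrib)
  also have "\<dots> \<le> (l2norm s x)\<^sup>2 * (l2norm k (mulAt x))\<^sup>2"
    using mulA_coercive[of y] by (intro mult_right_mono) (auto simp: x_def)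
  finally have "(l2norm s x)\<^sup>2 * ((1 - \<delta>) * (l2norm s x)\<^sup>2) \<le> (l2norm s x)\<^sup>2 * (l2norm k (mulAt x))\<^sup>2"
    by (simp add: power2_eq_square[of "(l2norm s x)\<^sup>2"] mult_ac)
  then show ?thesis using pos mult_le_cancel_left_pos by (auto simp: x_def)
qed

lemma large_eigenvalue_ge:
  assumes "l < k"
  shows "9 / 10 * \<mu> \<le> \<sigma> l"
proof (rule courant_fischer_ge[where B = A, OF assms k])
  fix y :: "nat \<Rightarrow> real"
  let ?x = "mulA y"
  show "0 < l2norm s ?x" if "\<exists>j<k. y j \<noteq> 0"
    using that by (rule l2norm_mulA_pos)
  show "9 / 10 * \<mu> * (l2norm s ?x)\<^sup>2 \<le> dot s ?x (mul_vec s G ?x)"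
  proof (cases "\<exists>a<k. y a \<noteq> 0")
    case True
    have "\<mu> * \<delta> \<le> \<mu> * (1 / 100)" using \<mu> \<delta> by (intro mult_left_mono) auto
    then have "9 / 10 * \<mu> \<le> \<mu> * (1 - \<delta>) - \<eta>" using \<mu> \<eta> unfolding right_diff_distrib by linarith
    then have "9 / 10 * \<mu> * (l2norm s ?x)\<^sup>2 \<le> \<mu> * ((1 - \<delta>) * (l2norm s ?x)\<^sup>2) - \<eta> * (l2norm s ?x)\<^sup>2"
      using mult_right_mono[of "9 / 10 * \<mu>" "\<mu> * (1 - \<delta>) - \<eta>" "(l2norm s ?x)\<^sup>2"] by (simp add: algebra_simps)
    also have "\<dots> \<le> \<mu> * (l2norm k (mulAt ?x))\<^sup>2 - \<eta> * (l2norm s ?x)\<^sup>2"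
      using mulAt_mulA_norm_ge[OF True] \<mu> by simp
    also have "\<mu> * (l2norm k (mulAt ?x))\<^sup>2 \<le> (\<Sum>a<k. D a * (mulAt ?x a)\<^sup>2)"
      unfolding l2norm_sq sum_distrib_left using D_ge by (intro sum_mono mult_right_mono) auto
    finally show ?thesis unfolding quadratic_form_G using quadratic_form_N[of ?x] by linarith
  next
    case False
    then have "?x = (\<lambda>_. 0)" by (auto simp: mul_vec_def)
    then show ?thesis by (simp add: dot_def L2_set_def)
  qed
qed

lemma small_eigenvalue_abs_le:
  assumes "k \<le> l" "l < s"
  shows "\<bar>\<sigma> l\<bar> \<le> \<eta>"
proof -
  have "\<sigma> l \<le> \<eta>"
  proof (rule courant_fischer_le[where B = "\<lambda>a i. A i a", OF assms])
    fix x :: "nat \<Rightarrow> real" assume "\<forall>a<k. mulAt x a = 0"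
    then show "dot s x (mul_vec s G x) \<le> \<eta> * (l2norm s x)\<^sup>2"
      unfolding quadratic_form_G using quadratic_form_N[of x] by simp
  qed
  moreover have "- \<eta> \<le> \<sigma> l"
  proof -
    have norm: "(l2norm s (w l))\<^sup>2 = 1" using orthonormal[OF assms(2,2)] by (simp add: dot_self)
    have "dot s (w l) (mul_vec s G (w l)) = \<sigma> l * dot s (w l) (w l)"
      using eigenvector[OF assms(2)] by (simp add: dot_def sum_distrib_left mult_ac)
    then have "\<sigma> l = (\<Sum>a<k. D a * (mulAt (w l) a)\<^sup>2) + dot s (w l) (mul_vec s N (w l))"
      by (simp add: quadratic_form_G dot_self norm)
    moreover have "0 \<le> (\<Sum>a<k. D a * (mulAt (w l) a)\<^sup>2)"
      using D_pos by (intro sum_nonneg mult_nonneg_nonneg) (auto simp: less_imp_le)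
    ultimately show ?thesis using quadratic_form_N[of "w l"] by (simp add: norm)
  qed
  ultimately show ?thesis by linarith
qed

definition truncated_inverse :: "(nat \<Rightarrow> real) \<Rightarrow> nat \<Rightarrow> real" where
  "truncated_inverse b l = (if l < k then coords b l / \<sigma> l else 0)"

lemma coords_mul_vec_add:
  assumes "l < s" "\<And>i. i < s \<Longrightarrow> x i = mul_vec s G y i + z i"
  shows "coords x l = \<sigma> l * coords y l + coords z l"
proof -
  have "coords x l = coords (\<lambda>i. mul_vec s G y i + z i) l"
    unfolding coords_def using assms(2) by (intro mul_vec_cong) auto
  then show ?thesis using coords_mul_vec[OF assms(1)] by (simp add: coords_def mul_vec_add)
qed

lemma truncated_inverse_residual:
  assumes b: "\<And>i. i < s \<Longrightarrow> b i = mul_vec s G \<omega> i + r i"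
    and \<omega>: "\<And>i. i < s \<Longrightarrow> \<omega> i = mul_vec s G \<zeta> i + \<rho> i"
  shows "l2norm s (\<lambda>l. truncated_inverse b l - coords \<omega> l)
    \<le> 10 / 9 * l2norm s r / \<mu> + \<eta> * l2norm s \<zeta> + l2norm s \<rho>"
proof -
  let ?bound = "\<lambda>l. (10 / 9 / \<mu> * \<bar>coords r l\<bar> + \<eta> * \<bar>coords \<zeta> l\<bar>) + \<bar>coords \<rho> l\<bar>"
  have nonneg: "0 \<le> 10 / 9 / \<mu> * \<bar>coords r l\<bar>" "0 \<le> \<eta> * \<bar>coords \<zeta> l\<bar>" for l using \<mu> \<eta> by auto
  have "l2norm s (\<lambda>l. truncated_inverse b l - coords \<omega> l) \<le> l2norm s ?bound"
  proof (rule l2norm_mono_abs)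
    fix l assume l: "l < s"
    show "\<bar>truncated_inverse b l - coords \<omega> l\<bar> \<le> \<bar>?bound l\<bar>"
    proof (cases "l < k")
      case True
      note \<sigma> = large_eigenvalue_ge[OF True]
      then have \<sigma>_pos: "0 < \<sigma> l" using \<mu> by linarith
      have "truncated_inverse b l - coords \<omega> l = coords r l / \<sigma> l"
        using coords_mul_vec_add[OF l b] \<sigma>_pos True by (simp add: truncated_inverse_def field_simps)
      also have "\<bar>coords r l / \<sigma> l\<bar> \<le> \<bar>coords r l\<bar> / (9 / 10 * \<mu>)"
        unfolding abs_divide using \<sigma> \<sigma>_pos \<mu> by (intro divide_left_mono) auto
      finally show ?thesis using nonneg[of l] by simp
    next
      case False
      have "\<bar>\<sigma> l * coords \<zeta> l\<bar> \<le> \<eta> * \<bar>coords \<zeta> l\<bar>"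
        unfolding abs_mult using small_eigenvalue_abs_le[of l] l False by (intro mult_right_mono) auto
      then show ?thesis
        using nonneg[of l] False coords_mul_vec_add[OF l \<omega>] by (simp add: truncated_inverse_def)
    qed
  qed
  also have "\<dots> \<le> l2norm s (\<lambda>l. 10 / 9 / \<mu> * \<bar>coords r l\<bar>) + l2norm s (\<lambda>l. \<eta> * \<bar>coords \<zeta> l\<bar>)
      + l2norm s (\<lambda>l. \<bar>coords \<rho> l\<bar>)"
    by (rule order_trans[OF L2_set_triangle_ineq]) (intro add_right_mono L2_set_triangle_ineq)
  also have "\<dots> = 10 / 9 / \<mu> * l2norm s r + \<eta> * l2norm s \<zeta> + l2norm s \<rho>"
    using \<mu> \<eta> by (simp add: l2norm_scale l2norm_abs l2norm_coords del: times_divide_eq_left)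
  finally show ?thesis by simp
qed

lemma gram_solution_in_range:
  assumes y: "\<forall>a<k. mulAt (mulA y) a = f a"
  obtains \<zeta> where "\<And>i. i < s \<Longrightarrow> mulA y i = mul_vec s G \<zeta> i + - mul_vec s N \<zeta> i"
    and "l2norm s \<zeta> \<le> 26 / 25 * l2norm k f / \<mu>"
proof -
  obtain z where z: "\<forall>a<k. mulAt (mulA z) a = y a / D a" using gram_solvable[of "\<lambda>a. y a / D a"] by blast
  have "mulA (\<lambda>a. D a * mulAt (mulA z) a) i = mulA y i" for i
    using z D_pos by (intro mul_vec_cong) force
  then have range: "mulA y i = mul_vec s G (mulA z) i + - mul_vec s N (mulA z) i" for i
    by (simp add: mul_vec_G)
  have "l2norm k (\<lambda>a. y a / D a) \<le> l2norm k (\<lambda>a. (1 / \<mu>) * y a)"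
  proof (rule l2norm_mono_abs)
    fix a assume a: "a < k"
    show "\<bar>y a / D a\<bar> \<le> \<bar>1 / \<mu> * y a\<bar>"
      using D_ge[OF a] D_pos[OF a] \<mu> by (simp add: abs_mult frac_le)
  qed
  also have "\<dots> = 1 / \<mu> * l2norm k y" using \<mu> by (intro l2norm_scale) simp
  also have "\<dots> = l2norm k y / \<mu>" by simp
  also have "\<dots> \<le> 51 / 50 * l2norm k f / \<mu>" using gram_solution_bounds(1)[OF y] \<mu> by (intro divide_right_mono) auto
  finally have "l2norm s (mulA z) \<le> 101 / 100 * (51 / 50 * l2norm k f / \<mu>)"
    using gram_solution_bounds(2)[OF z] by linarith
  also have "\<dots> \<le> 26 / 25 * l2norm k f / \<mu>" using \<mu> by (simp add: field_simps)
  finally show ?thesis using that range by blast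
qed

lemma l2norm_residual_le:
  assumes y: "\<forall>a<k. mulAt (mulA y) a = f a"
  shows "l2norm s (\<lambda>i. e i + - mul_vec s N (mulA y) i) \<le> l2norm s e + 101 / 100 * \<eta> * l2norm k f"
proof -
  have "l2norm s (\<lambda>i. e i + - mul_vec s N (mulA y) i) \<le> l2norm s e + l2norm s (\<lambda>i. - mul_vec s N (mulA y) i)"
    by (rule L2_set_triangle_ineq)
  also have "\<dots> \<le> l2norm s e + \<eta> * l2norm s (mulA y)"
    using l2norm_N_le[of "mulA y"] by (simp add: L2_set_def)
  also have "\<dots> \<le> l2norm s e + \<eta> * (101 / 100 * l2norm k f)"
    using gram_solution_bounds(2)[OF y] \<eta>(1) by (intro add_left_mono mult_left_mono)
  finally show ?thesis by simp
qed

lemma truncated_inverse_error: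
  assumes b: "\<And>i. i < s \<Longrightarrow> b i = mulA (\<lambda>a. D a * f a) i + e i"
    and y: "\<forall>a<k. mulAt (mulA y) a = f a"
  shows "l2norm s (\<lambda>l. truncated_inverse b l - coords (mulA y) l)
    \<le> (4 * \<eta> * l2norm k f + 6 / 5 * l2norm s e) / \<mu>"
proof -
  let ?F = "l2norm k f" and ?\<gamma> = "l2norm s e"
  obtain \<zeta> where range: "\<And>i. i < s \<Longrightarrow> mulA y i = mul_vec s G \<zeta> i + - mul_vec s N \<zeta> i"
    and \<zeta>: "l2norm s \<zeta> \<le> 26 / 25 * ?F / \<mu>"
    using gram_solution_in_range[OF y] by blast
  define r where "r i = e i + - mul_vec s N (mulA y) i" for i
  have r_le: "l2norm s r \<le> ?\<gamma> + 101 / 100 * \<eta> * ?F"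
    unfolding r_def by (rule l2norm_residual_le[OF y])
  have "mulA (\<lambda>a. D a * f a) i = mulA (\<lambda>a. D a * mulAt (mulA y) a) i" for i
    using y by (intro mul_vec_cong) simp
  then have "b i = mul_vec s G (mulA y) i + r i" if "i < s" for i
    unfolding b[OF that] r_def by (simp add: mul_vec_G)
  from truncated_inverse_residual[OF this range]
  have "l2norm s (\<lambda>l. truncated_inverse b l - coords (mulA y) l)
      \<le> 10 / 9 * l2norm s r / \<mu> + \<eta> * l2norm s \<zeta> + l2norm s (\<lambda>i. - mul_vec s N \<zeta> i)" .
  also have "\<dots> \<le> 10 / 9 * l2norm s r / \<mu> + \<eta> * l2norm s \<zeta> + \<eta> * l2norm s \<zeta>"
    using l2norm_N_le[of \<zeta>] by (simp add: L2_set_def)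
  also have "\<dots> \<le> 10 / 9 * (?\<gamma> + 101 / 100 * \<eta> * ?F) / \<mu> + \<eta> * (26 / 25 * ?F / \<mu>) + \<eta> * (26 / 25 * ?F / \<mu>)"
    using r_le \<zeta> \<mu> \<eta> by (intro add_mono mult_left_mono divide_right_mono) auto
  also have "\<dots> = (10 / 9 * ?\<gamma> + 1441 / 450 * (\<eta> * ?F)) / \<mu>"
    using \<mu> by (simp add: field_simps)
  also have "\<dots> \<le> (4 * \<eta> * ?F + 6 / 5 * ?\<gamma>) / \<mu>"
  proof (rule divide_right_mono)
    have "0 \<le> \<eta> * ?F" using \<eta>(1) by simp
    then show "10 / 9 * ?\<gamma> + 1441 / 450 * (\<eta> * ?F) \<le> 4 * \<eta> * ?F + 6 / 5 * ?\<gamma>"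
      using L2_set_nonneg[of e "{..<s}"] by linarith
  qed (use \<mu> in simp)
  finally show ?thesis .
qed

lemma dot_gram_solution_close:
  assumes y: "\<forall>a<k. mulAt (mulA y) a = f a" and f: "l2norm k f \<le> F" and g: "l2norm k g \<le> F"
  shows "\<bar>dot k y g - dot k f g\<bar> \<le> 11 / 10 * \<delta> * F\<^sup>2"
proof -
  let ?d = "\<lambda>a. mulAt (mulA y) a - y a"
  have F: "0 \<le> F" using f L2_set_nonneg[of f "{..<k}"] by linarith
  have "dot k f g = dot k y g + dot k ?d g"
    unfolding dot_add_left[symmetric] using y by (intro dot_cong) simp_all
  then have "\<bar>dot k y g - dot k f g\<bar> = \<bar>dot k ?d g\<bar>" by simp
  also have "\<dots> \<le> (\<delta> * (51 / 50 * F)) * F"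
  proof -
    have "l2norm k y \<le> 51 / 50 * F" using gram_solution_bounds(1)[OF y] f by linarith
    then have "l2norm k ?d \<le> \<delta> * (51 / 50 * F)"
      using \<delta>(1) by (intro order_trans[OF gram_near_id] mult_left_mono)
    then show ?thesis using g \<delta> F by (intro order_trans[OF abs_dot_le] mult_mono) auto
  qed
  also have "\<dots> \<le> 11 / 10 * \<delta> * F\<^sup>2" using \<delta> F by (simp add: power2_eq_square)
  finally show ?thesis .
qed

theorem truncated_inverse_square_accurate:
  assumes x: "\<And>i. i < s \<Longrightarrow> bx i = mulA (\<lambda>a. D a * fx a) i + ex i"
    and y: "\<And>i. i < s \<Longrightarrow> b_y i = mulA (\<lambda>a. D a * fy a) i + ey i"
    and f: "l2norm k fx \<le> F" "l2norm k fy \<le> F" and e: "l2norm s ex \<le> \<gamma>" "l2norm s ey \<le> \<gamma>"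
    and \<tau>: "(4 * \<eta> * F + 6 / 5 * \<gamma>) / \<mu> \<le> \<tau>"
  shows "\<bar>(\<Sum>l<k. coords bx l * coords b_y l / (\<sigma> l)\<^sup>2) - dot k fx fy\<bar> \<le> 11 / 10 * \<delta> * F\<^sup>2 + 21 / 10 * F * \<tau> + \<tau>\<^sup>2"
proof -
  obtain wx where wx: "\<forall>a<k. mulAt (mulA wx) a = fx a" using gram_solvable by blast
  obtain wy where wy: "\<forall>a<k. mulAt (mulA wy) a = fy a" using gram_solvable by blast
  let ?ox = "coords (mulA wx)" and ?oy = "coords (mulA wy)"
  have F: "0 \<le> F" using f(1) L2_set_nonneg[of fx "{..<k}"] by linarith
  have "(4 * \<eta> * l2norm k f + 6 / 5 * l2norm s e) / \<mu> \<le> \<tau>" if "l2norm k f \<le> F" "l2norm s e \<le> \<gamma>" for f e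
    using that \<eta> \<mu> by (intro order_trans[OF _ \<tau>] divide_right_mono add_mono mult_left_mono) auto
  then have error: "l2norm s (\<lambda>l. truncated_inverse bx l - ?ox l) \<le> \<tau>"
      "l2norm s (\<lambda>l. truncated_inverse b_y l - ?oy l) \<le> \<tau>"
    using truncated_inverse_error[OF x wx] truncated_inverse_error[OF y wy] f e by (meson order_trans)+
  have "l2norm s ?ox \<le> 101 / 100 * F" "l2norm s ?oy \<le> 101 / 100 * F"
    using gram_solution_bounds(2)[OF wx] gram_solution_bounds(2)[OF wy] f unfolding l2norm_coords by linarith+
  from abs_dot_perturbed_le[OF this error]
  have "\<bar>dot s (truncated_inverse bx) (truncated_inverse b_y) - dot s ?ox ?oy\<bar> \<le> 2 * (101 / 100 * F) * \<tau> + \<tau>\<^sup>2" .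
  also have "\<dots> \<le> 21 / 10 * F * \<tau> + \<tau>\<^sup>2"
  proof -
    have "0 \<le> \<tau>" by (rule order_trans[OF L2_set_nonneg error(1)])
    then show ?thesis using mult_nonneg_nonneg[OF F] by simp
  qed
  also have "dot s ?ox ?oy = dot k wx fy"
    unfolding parseval[symmetric] dot_mul_vec using wy by (intro dot_cong) simp_all
  also have "dot s (truncated_inverse bx) (truncated_inverse b_y) = (\<Sum>l<k. coords bx l * coords b_y l / (\<sigma> l)\<^sup>2)"
    unfolding dot_def using k
    by (intro sum.mono_neutral_cong_right) (auto simp: truncated_inverse_def power2_eq_square)
  finally have "\<bar>(\<Sum>l<k. coords bx l * coords b_y l / (\<sigma> l)\<^sup>2) - dot k wx fy\<bar> \<le> 21 / 10 * F * \<tau> + \<tau>\<^sup>2" .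
  then show ?thesis using dot_gram_solution_close[OF wx f] by linarith
qed

end

section \<open>Independent samples\<close>

abbreviation expect :: "'a pmf \<Rightarrow> ('a \<Rightarrow> real) \<Rightarrow> real" where
  "expect p f \<equiv> measure_pmf.expectation p f"

lemma expect_cong: "(\<And>x. x \<in> set_pmf p \<Longrightarrow> f x = g x) \<Longrightarrow> expect p f = expect p g"
  by (intro integral_cong_AE) (auto simp: AE_measure_pmf_iff)

lemma expect_mono:
  assumes "finite (set_pmf p)" "\<And>x. x \<in> set_pmf p \<Longrightarrow> f x \<le> g x"
  shows "expect p f \<le> expect p g"
  using assms by (intro integral_mono_AE integrable_measure_pmf_finite) (auto simp: AE_measure_pmf_iff)

lemma expect_add: "finite (set_pmf p) \<Longrightarrow> expect p (\<lambda>x. f x + g x) = expect p f + expect p g"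
  by (intro Bochner_Integration.integral_add integrable_measure_pmf_finite)

lemma expect_diff_const: "finite (set_pmf p) \<Longrightarrow> expect p (\<lambda>x. f x - c) = expect p f - c"
  by (subst Bochner_Integration.integral_diff) (auto intro: integrable_measure_pmf_finite)

lemma expect_sum: "finite (set_pmf p) \<Longrightarrow> expect p (\<lambda>x. \<Sum>i\<in>I. f i x) = (\<Sum>i\<in>I. expect p (f i))"
  by (intro Bochner_Integration.integral_sum integrable_measure_pmf_finite)

lemma expect_lessThan:
  fixes f :: "nat \<Rightarrow> real"
  assumes "set_pmf p \<subseteq> {..<n}"
  shows "expect p f = (\<Sum>i<n. pmf p i * f i)"
  using assms by (subst integral_measure_pmf[of "{..<n}"]) auto

lemma expect_bind:
  assumes "finite (set_pmf p)" "\<And>x. x \<in> set_pmf p \<Longrightarrow> finite (set_pmf (f x))"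
  shows "expect (bind_pmf p f) h = expect p (\<lambda>x. expect (f x) h)"
proof -
  have "expect (bind_pmf p f) h = (\<Sum>x\<in>set_pmf p. pmf p x *\<^sub>R expect (f x) h)"
    using assms by (intro pmf_expectation_bind) auto
  also have "\<dots> = expect p (\<lambda>x. expect (f x) h)"
    using assms by (intro integral_measure_pmf[symmetric]) auto
  finally show ?thesis .
qed

lemma expect_swap:
  assumes "finite (set_pmf p)" "finite (set_pmf q)"
  shows "expect p (\<lambda>x. expect q (f x)) = expect q (\<lambda>y. expect p (\<lambda>x. f x y))"
  using assms
  by (simp add: integral_measure_pmf[of "set_pmf p"] integral_measure_pmf[of "set_pmf q"]
      sum_distrib_left mult.left_commute) (rule sum.swap)

lemma expect_square_deviation_le:
  assumes fin: "finite (set_pmf p)" and \<mu>: "expect p g = \<mu>"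
  shows "expect p (\<lambda>x. (g x - \<mu>)\<^sup>2) \<le> expect p (\<lambda>x. (g x)\<^sup>2)"
proof -
  have "expect p (\<lambda>x. (g x - \<mu>)\<^sup>2) = expect p (\<lambda>x. (g x)\<^sup>2 + ((- 2 * \<mu>) * g x + \<mu>\<^sup>2))"
    by (intro expect_cong) (simp add: power2_eq_square algebra_simps)
  also have "\<dots> = expect p (\<lambda>x. (g x)\<^sup>2) - \<mu>\<^sup>2"
    by (simp only: expect_add[OF fin] integral_mult_right_zero \<mu>) (simp add: power2_eq_square)
  finally show ?thesis by simp
qed

lemma finite_replicate_pmf: "finite (set_pmf p) \<Longrightarrow> finite (set_pmf (replicate_pmf m p))"
  using finite_lists_length_eq[of "set_pmf p" m]
  by (simp add: set_replicate_pmf lists_eq_set Collect_conj_eq[symmetric])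

lemma expect_replicate_Suc:
  assumes "finite (set_pmf p)"
  shows "expect (replicate_pmf (Suc m) p) h = expect p (\<lambda>x. expect (replicate_pmf m p) (\<lambda>xs. h (x # xs)))"
proof -
  have "replicate_pmf (Suc m) p = bind_pmf p (\<lambda>x. map_pmf ((#) x) (replicate_pmf m p))"
    by (simp add: map_pmf_def)
  then show ?thesis using assms by (simp add: expect_bind finite_replicate_pmf del: replicate_pmf.simps)
qed

lemma expect_replicate_prod:
  assumes "finite (set_pmf p)"
  shows "expect (replicate_pmf m p) (\<lambda>xs. prod_list (map h xs)) = (expect p h) ^ m"
proof (induction m)
  case (Suc m)
  then show ?case by (subst expect_replicate_Suc[OF assms]) simp
qed simp

lemma expect_replicate_sum:
  assumes fin: "finite (set_pmf p)"
  shows "expect (replicate_pmf m p) (\<lambda>xs. sum_list (map g xs)) = m * expect p g"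
proof (induction m)
  case (Suc m)
  then show ?case
    by (subst expect_replicate_Suc[OF fin]) (simp add: expect_add fin finite_replicate_pmf algebra_simps)
qed simp

lemma expect_replicate_sum_variance:
  assumes fin: "finite (set_pmf p)" and \<mu>: "expect p g = \<mu>"
  shows "expect (replicate_pmf m p) (\<lambda>xs. (sum_list (map g xs) - m * \<mu>)\<^sup>2) = m * expect p (\<lambda>x. (g x - \<mu>)\<^sup>2)"
proof (induction m)
  case (Suc m)
  let ?R = "replicate_pmf m p"
  let ?S = "\<lambda>xs. sum_list (map g xs) - m * \<mu>"
  note fin_R = finite_replicate_pmf[OF fin, of m]
  have centered: "expect ?R ?S = 0"
    by (simp add: expect_diff_const[OF fin_R] expect_replicate_sum[OF fin] \<mu>)
  have "expect (replicate_pmf (Suc m) p) (\<lambda>xs. (sum_list (map g xs) - real (Suc m) * \<mu>)\<^sup>2)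
      = expect p (\<lambda>x. expect ?R (\<lambda>xs. (g x + sum_list (map g xs) - real (Suc m) * \<mu>)\<^sup>2))"
    by (subst expect_replicate_Suc[OF fin]) simp
  also have "\<dots> = expect p (\<lambda>x. expect ?R (\<lambda>xs. (g x - \<mu>)\<^sup>2 + (2 * (g x - \<mu>) * ?S xs + (?S xs)\<^sup>2)))"
    by (simp add: power2_eq_square algebra_simps)
  also have "\<dots> = expect p (\<lambda>x. (g x - \<mu>)\<^sup>2 + m * expect p (\<lambda>x. (g x - \<mu>)\<^sup>2))"
    by (simp only: expect_add[OF fin_R] integral_mult_right_zero centered Suc.IH) simp
  also have "\<dots> = real (Suc m) * expect p (\<lambda>x. (g x - \<mu>)\<^sup>2)"
    by (simp add: expect_add[OF fin] algebra_simps)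
  finally show ?case .
qed simp

lemma expect_replicate_mean_variance:
  assumes fin: "finite (set_pmf p)" and \<mu>: "expect p g = \<mu>" and m: "0 < m"
  shows "expect (replicate_pmf m p) (\<lambda>xs. (sum_list (map g xs) / m - \<mu>)\<^sup>2) = expect p (\<lambda>x. (g x - \<mu>)\<^sup>2) / m"
proof -
  have "expect (replicate_pmf m p) (\<lambda>xs. (sum_list (map g xs) / m - \<mu>)\<^sup>2)
      = expect (replicate_pmf m p) (\<lambda>xs. (sum_list (map g xs) - m * \<mu>)\<^sup>2 / (real m)\<^sup>2)"
    using m by (intro expect_cong) (simp add: power2_eq_square field_simps)
  also have "\<dots> = m * expect p (\<lambda>x. (g x - \<mu>)\<^sup>2) / (real m)\<^sup>2"
    by (simp add: expect_replicate_sum_variance[OF fin \<mu>])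
  finally show ?thesis using m by (simp add: power2_eq_square)
qed

lemma prob_mono:
  "(\<And>x. x \<in> set_pmf p \<Longrightarrow> P x \<Longrightarrow> Q x) \<Longrightarrow> measure_pmf.prob p {x. P x} \<le> measure_pmf.prob p {x. Q x}"
  by (intro measure_pmf.finite_measure_mono_AE) (auto simp: AE_measure_pmf_iff)

lemma prob_compl_ge:
  assumes "measure_pmf.prob p {x. \<not> P x} \<le> c"
  shows "1 - c \<le> measure_pmf.prob p {x. P x}"
  using assms measure_pmf.prob_compl[of "{x. P x}" p] by (simp add: Collect_neg_eq Compl_eq_Diff_UNIV)

lemma prob_union_bound:
  fixes c :: real
  assumes "finite I" "\<And>i. i \<in> I \<Longrightarrow> measure_pmf.prob p {x. \<not> P i x} \<le> c"
  shows "measure_pmf.prob p {x. \<not> (\<forall>i\<in>I. P i x)} \<le> card I * c"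
proof -
  have "{x. \<not> (\<forall>i\<in>I. P i x)} = (\<Union>i\<in>I. {x. \<not> P i x})" by auto
  then have "measure_pmf.prob p {x. \<not> (\<forall>i\<in>I. P i x)} \<le> (\<Sum>i\<in>I. measure_pmf.prob p {x. \<not> P i x})"
    using measure_pmf.finite_measure_subadditive_finite[OF assms(1), of "\<lambda>i. {x. \<not> P i x}" p] by simp
  also have "\<dots> \<le> card I * c" by (rule sum_bounded_above) (rule assms(2))
  finally show ?thesis .
qed

lemma prob_bind_le:
  assumes fin: "finite (set_pmf p)" "\<And>x. x \<in> set_pmf p \<Longrightarrow> finite (set_pmf (f x))"
    and p: "measure_pmf.prob p {x. \<not> P x} \<le> c1" and c2: "0 \<le> c2"
    and f: "\<And>x. x \<in> set_pmf p \<Longrightarrow> P x \<Longrightarrow> measure_pmf.prob (f x) B \<le> c2"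
  shows "measure_pmf.prob (bind_pmf p f) B \<le> c1 + c2"
proof -
  have "measure_pmf.prob (bind_pmf p f) B = expect p (\<lambda>x. measure_pmf.prob (f x) B)"
    using expect_bind[where h = "indicator B", OF fin] by simp
  also have "\<dots> \<le> expect p (\<lambda>x. indicator {x. \<not> P x} x + c2)"
  proof (rule expect_mono[OF fin(1)])
    fix x assume x: "x \<in> set_pmf p"
    show "measure_pmf.prob (f x) B \<le> indicator {x. \<not> P x} x + c2"
      using f[OF x] c2 measure_pmf.prob_le_1[of "f x" B] by (cases "P x") (auto intro: order_trans)
  qed
  also have "\<dots> = measure_pmf.prob p {x. \<not> P x} + c2" by (subst expect_add[OF fin(1)]) simp
  finally show ?thesis using p by linarith
qed

lemma markov_inequality:
  assumes fin: "finite (set_pmf p)" and h: "\<And>x. x \<in> set_pmf p \<Longrightarrow> 0 \<le> h x" and c: "0 < c"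
  shows "measure_pmf.prob p {x. c \<le> h x} \<le> expect p h / c"
  using integral_Markov_inequality_measure[of "measure_pmf p" h "{}" c] h c integrable_measure_pmf_finite[OF fin, of h]
  by (simp add: AE_measure_pmf_iff)

lemma chebyshev_inequality:
  assumes fin: "finite (set_pmf p)" and c: "0 < c"
  shows "measure_pmf.prob p {x. \<not> \<bar>h x - \<mu>\<bar> \<le> c} \<le> expect p (\<lambda>x. (h x - \<mu>)\<^sup>2) / c\<^sup>2"
proof -
  have "measure_pmf.prob p {x. \<not> \<bar>h x - \<mu>\<bar> \<le> c} \<le> measure_pmf.prob p {x. c\<^sup>2 \<le> (h x - \<mu>)\<^sup>2}"
    using c by (intro prob_mono) (simp add: abs_le_square_iff[symmetric])
  also have "\<dots> \<le> expect p (\<lambda>x. (h x - \<mu>)\<^sup>2) / c\<^sup>2" using c by (intro markov_inequality fin) auto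
  finally show ?thesis .
qed

lemma exponential_moment_le:
  assumes fin: "finite (set_pmf p)" and g: "\<And>x. x \<in> set_pmf p \<Longrightarrow> g x \<in> {a..b}"
    and \<mu>: "expect p g = \<mu>" and l: "0 < l"
  shows "expect p (\<lambda>x. exp (l * (g x - \<mu>))) \<le> exp (l\<^sup>2 * (b - a)\<^sup>2 / 8)"
proof -
  interpret interval_bounded_random_variable "measure_pmf p" g a b
    by unfold_locales (use g in \<open>auto simp: AE_measure_pmf_iff\<close>)
  have "ennreal (expect p (\<lambda>x. exp (l * (g x - \<mu>)))) = (\<integral>\<^sup>+x. ennreal (exp (l * (g x - \<mu>))) \<partial>measure_pmf p)"
    using fin by (intro nn_integral_eq_integral[symmetric] integrable_measure_pmf_finite) auto
  also have "\<dots> \<le> ennreal (exp (l\<^sup>2 * (b - a)\<^sup>2 / 8))"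
    unfolding \<mu>[symmetric] by (rule Hoeffdings_lemma_nn_integral[OF l])
  finally show ?thesis by simp
qed

lemma hoeffding_upper:
  assumes fin: "finite (set_pmf p)" and g: "\<And>x. x \<in> set_pmf p \<Longrightarrow> g x \<in> {a..b}" and ab: "a < b"
    and \<mu>: "expect p g = \<mu>" and r: "0 < r" and m: "0 < m"
  shows "measure_pmf.prob (replicate_pmf m p) {xs. r \<le> sum_list (map g xs) - m * \<mu>} \<le> exp (- 2 * r\<^sup>2 / (m * (b - a)\<^sup>2))"
proof -
  define l where "l = 4 * r / (m * (b - a)\<^sup>2)"
  have l: "0 < l" using r ab m by (simp add: l_def)
  define h where "h x = exp (l * (g x - \<mu>))" for x
  have prod: "prod_list (map h xs) = exp (l * (sum_list (map g xs) - length xs * \<mu>))" for xs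
    by (induction xs) (auto simp: h_def exp_add[symmetric] algebra_simps)
  have "measure_pmf.prob (replicate_pmf m p) {xs. r \<le> sum_list (map g xs) - m * \<mu>}
      \<le> measure_pmf.prob (replicate_pmf m p) {xs. exp (l * r) \<le> prod_list (map h xs)}"
    using l by (intro prob_mono) (auto simp: prod set_replicate_pmf)
  also have "\<dots> \<le> (expect p h) ^ m / exp (l * r)"
    unfolding expect_replicate_prod[OF fin, symmetric]
    by (intro markov_inequality finite_replicate_pmf fin) (simp_all add: prod)
  also have "\<dots> \<le> exp (l\<^sup>2 * (b - a)\<^sup>2 / 8) ^ m / exp (l * r)"
    using exponential_moment_le[OF fin g \<mu> l]
    by (intro divide_right_mono power_mono) (auto simp: h_def[abs_def] intro!: integral_nonneg_AE)
  also have "\<dots> = exp (m * (l\<^sup>2 * (b - a)\<^sup>2 / 8) - l * r)" by (simp add: exp_diff exp_of_nat_mult[symmetric])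
  also have "m * (l\<^sup>2 * (b - a)\<^sup>2 / 8) - l * r = - 2 * r\<^sup>2 / (m * (b - a)\<^sup>2)"
  proof -
    have "m * ((4 * r / (m * w\<^sup>2))\<^sup>2 * w\<^sup>2 / 8) - 4 * r / (m * w\<^sup>2) * r = - 2 * r\<^sup>2 / (m * w\<^sup>2)" if "0 < w" for w :: real
      using that m by (simp add: field_simps power2_eq_square)
    from this[of "b - a"] show ?thesis using ab by (simp add: l_def)
  qed
  finally show ?thesis .
qed

lemma hoeffding_abs:
  assumes fin: "finite (set_pmf p)" and g: "\<And>x. x \<in> set_pmf p \<Longrightarrow> \<bar>g x\<bar> \<le> c" and c: "0 < c"
    and \<mu>: "expect p g = \<mu>" and r: "0 < r" and m: "0 < m"
  shows "measure_pmf.prob (replicate_pmf m p) {xs. r \<le> \<bar>sum_list (map g xs) - m * \<mu>\<bar>}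
    \<le> 2 * exp (- r\<^sup>2 / (2 * m * c\<^sup>2))"
proof -
  let ?P = "measure_pmf.prob (replicate_pmf m p)"
  have tail: "?P {xs. r \<le> sum_list (map h xs) - m * \<nu>} \<le> exp (- r\<^sup>2 / (2 * m * c\<^sup>2))"
    if "\<And>x. x \<in> set_pmf p \<Longrightarrow> \<bar>h x\<bar> \<le> c" "expect p h = \<nu>" for h and \<nu> :: real
  proof -
    have "?P {xs. r \<le> sum_list (map h xs) - m * \<nu>} \<le> exp (- 2 * r\<^sup>2 / (m * (c - - c)\<^sup>2))"
      using that c r m by (intro hoeffding_upper fin) (auto simp: abs_le_iff minus_le_iff)
    also have "- 2 * r\<^sup>2 / (m * (c - - c)\<^sup>2) = - r\<^sup>2 / (2 * m * c\<^sup>2)" by (simp add: power2_eq_square)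
    finally show ?thesis .
  qed
  have neg: "sum_list (map (\<lambda>x. - g x) xs) = - sum_list (map g xs)" for xs by (induction xs) auto
  have "?P {xs. r \<le> \<bar>sum_list (map g xs) - m * \<mu>\<bar>}
      \<le> ?P ({xs. r \<le> sum_list (map g xs) - m * \<mu>} \<union> {xs. r \<le> sum_list (map (\<lambda>x. - g x) xs) - m * (- \<mu>)})"
    by (intro measure_pmf.finite_measure_mono) (auto simp: neg)
  also have "\<dots> \<le> ?P {xs. r \<le> sum_list (map g xs) - m * \<mu>}
      + ?P {xs. r \<le> sum_list (map (\<lambda>x. - g x) xs) - m * (- \<mu>)}"
    by (rule measure_Un_le) auto
  also have "\<dots> \<le> exp (- r\<^sup>2 / (2 * m * c\<^sup>2)) + exp (- r\<^sup>2 / (2 * m * c\<^sup>2))"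
    using g \<mu> by (intro add_mono tail) auto
  finally show ?thesis by simp
qed

lemma majority_failure:
  assumes fin: "finite (set_pmf p)" and bad: "measure_pmf.prob p {x. bad x} \<le> 1 / 4" and m: "0 < m"
  shows "measure_pmf.prob (replicate_pmf m p) {xs. m \<le> 2 * length (filter bad xs)} \<le> exp (- real m / 8)"
proof -
  define g where "g x = (of_bool (bad x) :: real)" for x
  define \<mu> where "\<mu> = measure_pmf.prob p {x. bad x}"
  have count: "sum_list (map g xs) = length (filter bad xs)" for xs by (induction xs) (auto simp: g_def)
  have "measure_pmf.prob (replicate_pmf m p) {xs. m \<le> 2 * length (filter bad xs)}
      \<le> measure_pmf.prob (replicate_pmf m p) {xs. m / 4 \<le> sum_list (map g xs) - m * \<mu>}"
  proof (intro prob_mono)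
    fix xs assume "m \<le> 2 * length (filter bad xs)"
    moreover have "m * \<mu> \<le> m * (1 / 4)" unfolding \<mu>_def using bad by (intro mult_left_mono) auto
    ultimately show "m / 4 \<le> sum_list (map g xs) - m * \<mu>" by (simp add: count)
  qed
  also have "\<dots> \<le> exp (- 2 * (m / 4)\<^sup>2 / (real m * (1 - 0)\<^sup>2))"
  proof (intro hoeffding_upper fin)
    have "g = indicator {x. bad x}" by (auto simp: g_def indicator_def)
    then show "expect p g = \<mu>" by (simp add: \<mu>_def)
  qed (use m in \<open>auto simp: g_def\<close>)
  also have "- 2 * (m / 4)\<^sup>2 / (real m * (1 - 0)\<^sup>2) = - real m / 8" using m by (simp add: power2_eq_square)
  finally show ?thesis .
qed

lemma median_far_imp_majority_far:
  assumes "\<not> \<bar>median xs - c\<bar> \<le> r"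
  shows "length xs \<le> 2 * length (filter (\<lambda>x. \<not> \<bar>x - c\<bar> \<le> r) xs)"
proof -
  let ?far = "\<lambda>x. \<not> \<bar>x - c\<bar> \<le> r"
  have majority: "length xs \<le> 2 * length (filter ?far xs)"
    if "\<And>x. \<not> P x \<Longrightarrow> ?far x" "2 * length (filter P xs) \<le> length xs" for P
  proof -
    have "length (filter (\<lambda>x. \<not> P x) xs) \<le> length (filter ?far xs)"
      using that(1) by (induction xs) auto
    then show ?thesis using that(2) sum_length_filter_compl[of P xs] by linarith
  qed
  consider (above) "c + r < median xs" | (below) "median xs < c - r" using assms by linarith
  then show ?thesis
  proof cases
    case above
    then show ?thesis by (intro majority[OF _ length_filter_less_median]) auto
  next
    case below
    then show ?thesis by (intro majority[OF _ length_filter_median_less]) auto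
  qed
qed

lemma median_amplification:
  assumes fin: "finite (set_pmf p)" and m: "0 < m" and I: "finite I"
    and dev: "\<And>i. i \<in> I \<Longrightarrow> measure_pmf.prob p {x. \<not> \<bar>h i x - c i\<bar> \<le> r} \<le> 1 / 4"
  shows "measure_pmf.prob (replicate_pmf m p) {xs. \<not> (\<forall>i\<in>I. \<bar>median (map (h i) xs) - c i\<bar> \<le> r)}
    \<le> card I * exp (- real m / 8)"
proof (rule prob_union_bound[OF I])
  fix i assume i: "i \<in> I"
  have "measure_pmf.prob (replicate_pmf m p) {xs. \<not> \<bar>median (map (h i) xs) - c i\<bar> \<le> r}
    \<le> measure_pmf.prob (replicate_pmf m p) {xs. m \<le> 2 * length (filter (\<lambda>x. \<not> \<bar>h i x - c i\<bar> \<le> r) xs)}"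
  proof (rule prob_mono)
    fix xs assume "xs \<in> set_pmf (replicate_pmf m p)" and "\<not> \<bar>median (map (h i) xs) - c i\<bar> \<le> r"
    then show "m \<le> 2 * length (filter (\<lambda>x. \<not> \<bar>h i x - c i\<bar> \<le> r) xs)"
      using median_far_imp_majority_far by (fastforce simp: set_replicate_pmf filter_map o_def)
  qed
  also have "\<dots> \<le> exp (- real m / 8)" by (rule majority_failure[OF fin dev[OF i] m])
  finally show "measure_pmf.prob (replicate_pmf m p) {xs. \<not> \<bar>median (map (h i) xs) - c i\<bar> \<le> r} \<le> exp (- real m / 8)" .
qed

section \<open>Collision statistics\<close>

definition inner_pmf :: "nat \<Rightarrow> nat pmf \<Rightarrow> nat pmf \<Rightarrow> real" where
  "inner_pmf n p q = (\<Sum>i<n. pmf p i * pmf q i)"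

definition batch_pmf :: "nat \<Rightarrow> nat \<Rightarrow> nat pmf \<Rightarrow> nat pmf \<Rightarrow> real pmf" where
  "batch_pmf n M p q = bind_pmf (replicate_pmf M p) (\<lambda>xs. bind_pmf (replicate_pmf M q) (\<lambda>ys.
     return_pmf (\<Sum>i<n. empirical xs i * empirical ys i)))"

lemma empirical_sum:
  fixes w :: "nat \<Rightarrow> real"
  assumes "set xs \<subseteq> {..<n}"
  shows "(\<Sum>i<n. empirical xs i * w i) = sum_list (map w xs) / length xs"
proof -
  have "sum_list (map w xs) = (\<Sum>i<n. real (count_list xs i) * w i)"
    using assms
  proof (induction xs)
    case (Cons x xs)
    have "(\<Sum>i<n. real (count_list (x # xs) i) * w i)
        = (\<Sum>i<n. real (count_list xs i) * w i + (if i = x then w i else 0))"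
      by (intro sum.cong refl) (auto simp: algebra_simps)
    also have "\<dots> = (\<Sum>i<n. real (count_list xs i) * w i) + w x"
      using Cons.prems by (simp add: sum.distrib)
    finally show ?case using Cons by simp
  qed simp
  then show ?thesis by (simp add: empirical_def sum_divide_distrib)
qed

definition empirical_deviation :: "nat \<Rightarrow> nat pmf \<Rightarrow> nat list \<Rightarrow> (nat \<Rightarrow> real) \<Rightarrow> real" where
  "empirical_deviation n p xs w = (\<Sum>i<n. empirical xs i * w i) - (\<Sum>i<n. pmf p i * w i)"

lemma finite_support: "set_pmf p \<subseteq> {..<n :: nat} \<Longrightarrow> finite (set_pmf p)"
  using finite_subset by blast

context
  fixes n M :: nat and p :: "nat pmf"
  assumes p: "set_pmf p \<subseteq> {..<n}" and M: "0 < M"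
begin

lemma empirical_sum_replicate:
  "xs \<in> set_pmf (replicate_pmf M p) \<Longrightarrow> (\<Sum>i<n. empirical xs i * w i) = sum_list (map w xs) / M"
  using empirical_sum[of xs n w] p by (auto simp: set_replicate_pmf)

lemma expect_empirical_sum:
  "expect (replicate_pmf M p) (\<lambda>xs. \<Sum>i<n. empirical xs i * w i) = (\<Sum>i<n. pmf p i * w i)"
proof -
  have "expect (replicate_pmf M p) (\<lambda>xs. \<Sum>i<n. empirical xs i * w i)
      = expect (replicate_pmf M p) (\<lambda>xs. sum_list (map w xs) / M)"
    by (intro expect_cong empirical_sum_replicate)
  then show ?thesis using M by (simp add: expect_replicate_sum[OF finite_support[OF p]] expect_lessThan[OF p])
qed

lemma empirical_deviation_sq_le:
  "expect (replicate_pmf M p) (\<lambda>xs. (empirical_deviation n p xs w)\<^sup>2) \<le> (\<Sum>i<n. pmf p i * (w i)\<^sup>2) / M"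
proof -
  let ?\<mu> = "\<Sum>i<n. pmf p i * w i"
  have \<mu>: "expect p w = ?\<mu>" by (rule expect_lessThan[OF p])
  have "expect (replicate_pmf M p) (\<lambda>xs. (empirical_deviation n p xs w)\<^sup>2)
      = expect (replicate_pmf M p) (\<lambda>xs. (sum_list (map w xs) / M - ?\<mu>)\<^sup>2)"
    by (intro expect_cong) (simp add: empirical_deviation_def empirical_sum_replicate)
  also have "\<dots> = expect p (\<lambda>x. (w x - ?\<mu>)\<^sup>2) / M"
    by (rule expect_replicate_mean_variance[OF finite_support[OF p] \<mu> M])
  also have "\<dots> \<le> expect p (\<lambda>x. (w x)\<^sup>2) / M"
    by (intro divide_right_mono expect_square_deviation_le finite_support[OF p] \<mu>) simp
  finally show ?thesis by (simp add: expect_lessThan[OF p])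
qed

lemma empirical_entry_deviation_sq_le:
  assumes i: "i < n"
  shows "expect (replicate_pmf M p) (\<lambda>xs. (empirical xs i - pmf p i)\<^sup>2) \<le> pmf p i / M"
proof -
  define w where "w j = (of_bool (j = i) :: real)" for j
  have "empirical_deviation n p xs w = empirical xs i - pmf p i" for xs
    using i by (simp add: empirical_deviation_def w_def)
  then have "expect (replicate_pmf M p) (\<lambda>xs. (empirical xs i - pmf p i)\<^sup>2) \<le> (\<Sum>j<n. pmf p j * (w j)\<^sup>2) / M"
    using empirical_deviation_sq_le[of w] by simp
  also have "(\<Sum>j<n. pmf p j * (w j)\<^sup>2) = (\<Sum>j<n. if j = i then pmf p j else 0)"
    by (intro sum.cong) (auto simp: w_def)
  also have "\<dots> = pmf p i" using i by simp
  finally show ?thesis .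
qed

end

lemma inner_pmf_le:
  fixes p q :: "nat pmf"
  assumes "(\<Sum>i<n. (pmf p i)\<^sup>2) \<le> \<Phi>" "(\<Sum>i<n. (pmf q i)\<^sup>2) \<le> \<Phi>"
  shows "inner_pmf n p q \<le> \<Phi>"
proof -
  have "inner_pmf n p q \<le> (\<Sum>i<n. ((pmf p i)\<^sup>2 + (pmf q i)\<^sup>2) / 2)"
    unfolding inner_pmf_def
  proof (rule sum_mono)
    show "pmf p i * pmf q i \<le> ((pmf p i)\<^sup>2 + (pmf q i)\<^sup>2) / 2" for i
      using sum_squares_bound[of "pmf p i" "pmf q i"] by simp
  qed
  also have "\<dots> = ((\<Sum>i<n. (pmf p i)\<^sup>2) + (\<Sum>i<n. (pmf q i)\<^sup>2)) / 2"
    by (simp add: sum_divide_distrib[symmetric] sum.distrib)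
  finally show ?thesis using assms by simp
qed

lemma weighted_square_sum_le:
  fixes p q :: "nat pmf"
  assumes "(\<Sum>i<n. (pmf p i)\<^sup>2) \<le> \<Phi>" "(\<Sum>i<n. (pmf q i)\<^sup>2) \<le> \<Phi>"
  shows "(\<Sum>i<n. pmf p i * (pmf q i)\<^sup>2) \<le> sqrt \<Phi> * \<Phi>"
proof -
  have "pmf p i \<le> sqrt \<Phi>" if "i < n" for i
  proof -
    have "(pmf p i)\<^sup>2 \<le> (\<Sum>i<n. (pmf p i)\<^sup>2)" using that by (intro member_le_sum) auto
    then show ?thesis using assms(1) by (intro real_le_rsqrt) simp
  qed
  then have "(\<Sum>i<n. pmf p i * (pmf q i)\<^sup>2) \<le> (\<Sum>i<n. sqrt \<Phi> * (pmf q i)\<^sup>2)"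
    by (intro sum_mono mult_right_mono) auto
  also have "\<dots> \<le> sqrt \<Phi> * \<Phi>"
    using assms sum_nonneg[of "{..<n}" "\<lambda>i. (pmf p i)\<^sup>2"]
    by (simp add: sum_distrib_left[symmetric] mult_left_mono)
  finally show ?thesis .
qed

context
  fixes n M :: nat and p q :: "nat pmf"
  assumes p: "set_pmf p \<subseteq> {..<n}" and q: "set_pmf q \<subseteq> {..<n}" and M: "0 < M"
begin

lemma finite_batch_pmf: "finite (set_pmf (batch_pmf n M p q))"
  using finite_support[OF p] finite_support[OF q] by (simp add: batch_pmf_def finite_replicate_pmf)

lemma expect_batch:
  "expect (batch_pmf n M p q) h
    = expect (replicate_pmf M p) (\<lambda>xs. expect (replicate_pmf M q) (\<lambda>ys. h (\<Sum>i<n. empirical xs i * empirical ys i)))"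
  unfolding batch_pmf_def using finite_support[OF p] finite_support[OF q]
  by (simp add: expect_bind finite_replicate_pmf)

lemma batch_mean: "expect (batch_pmf n M p q) (\<lambda>z. z) = inner_pmf n p q"
proof -
  have "expect (batch_pmf n M p q) (\<lambda>z. z)
      = expect (replicate_pmf M p) (\<lambda>xs. expect (replicate_pmf M q) (\<lambda>ys. \<Sum>i<n. empirical ys i * empirical xs i))"
    by (simp add: expect_batch mult.commute)
  also have "\<dots> = expect (replicate_pmf M p) (\<lambda>xs. \<Sum>i<n. empirical xs i * pmf q i)"
    unfolding expect_empirical_sum[OF q M] by (simp add: mult.commute)
  finally show ?thesis unfolding expect_empirical_sum[OF p M] inner_pmf_def .
qed

lemma bilinear_deviation_le:
  "expect (replicate_pmf M p) (\<lambda>xs. expect (replicate_pmf M q) (\<lambda>ys.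
      (empirical_deviation n p xs (\<lambda>i. empirical ys i - pmf q i))\<^sup>2)) \<le> inner_pmf n p q / (real M)\<^sup>2"
proof -
  let ?P = "replicate_pmf M p" and ?Q = "replicate_pmf M q"
  note fin = finite_replicate_pmf[OF finite_support[OF p], of M] finite_replicate_pmf[OF finite_support[OF q], of M]
  have "expect ?P (\<lambda>xs. expect ?Q (\<lambda>ys. (empirical_deviation n p xs (\<lambda>i. empirical ys i - pmf q i))\<^sup>2))
      = expect ?Q (\<lambda>ys. expect ?P (\<lambda>xs. (empirical_deviation n p xs (\<lambda>i. empirical ys i - pmf q i))\<^sup>2))"
    by (rule expect_swap[OF fin])
  also have "\<dots> \<le> expect ?Q (\<lambda>ys. (\<Sum>i<n. pmf p i * (empirical ys i - pmf q i)\<^sup>2) / M)"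
    by (intro expect_mono fin empirical_deviation_sq_le p M)
  also have "\<dots> = (\<Sum>i<n. pmf p i * expect ?Q (\<lambda>ys. (empirical ys i - pmf q i)\<^sup>2)) / M"
    by (simp add: expect_sum[OF fin(2)])
  also have "\<dots> \<le> (\<Sum>i<n. pmf p i * (pmf q i / M)) / M"
    using empirical_entry_deviation_sq_le[OF q M] by (intro divide_right_mono sum_mono mult_left_mono) auto
  also have "\<dots> = inner_pmf n p q / (real M)\<^sup>2"
    by (simp add: inner_pmf_def sum_divide_distrib power2_eq_square)
  finally show ?thesis .
qed

lemma batch_second_moment:
  "expect (batch_pmf n M p q) (\<lambda>z. (z - inner_pmf n p q)\<^sup>2)
    \<le> 3 * (inner_pmf n p q / (real M)\<^sup>2
         + ((\<Sum>i<n. pmf p i * (pmf q i)\<^sup>2) / M + (\<Sum>i<n. pmf q i * (pmf p i)\<^sup>2) / M))"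
proof -
  let ?P = "replicate_pmf M p" and ?Q = "replicate_pmf M q"
  let ?both = "\<lambda>xs ys. empirical_deviation n p xs (\<lambda>i. empirical ys i - pmf q i)"
  let ?left = "\<lambda>xs. empirical_deviation n p xs (pmf q)" and ?right = "\<lambda>ys. empirical_deviation n q ys (pmf p)"
  note fin = finite_replicate_pmf[OF finite_support[OF p], of M] finite_replicate_pmf[OF finite_support[OF q], of M]
  have decomposition: "((\<Sum>i<n. empirical xs i * empirical ys i) - inner_pmf n p q)\<^sup>2
      \<le> 3 * ((?both xs ys)\<^sup>2 + ((?left xs)\<^sup>2 + (?right ys)\<^sup>2))" for xs ys
  proof -
    have "(\<Sum>i<n. empirical xs i * empirical ys i) - inner_pmf n p q = ?both xs ys + ?left xs + ?right ys"
      by (simp add: empirical_deviation_def inner_pmf_def sum_subtractf right_diff_distrib mult.commute)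
    moreover have "(a + b + c)\<^sup>2 \<le> 3 * (a\<^sup>2 + (b\<^sup>2 + c\<^sup>2))" for a b c :: real
      using zero_le_power2[of "a - b"] zero_le_power2[of "a - c"] zero_le_power2[of "b - c"]
      by (simp add: power2_eq_square algebra_simps)
    ultimately show ?thesis by simp
  qed
  have "expect (batch_pmf n M p q) (\<lambda>z. (z - inner_pmf n p q)\<^sup>2)
      = expect ?P (\<lambda>xs. expect ?Q (\<lambda>ys. ((\<Sum>i<n. empirical xs i * empirical ys i) - inner_pmf n p q)\<^sup>2))"
    by (rule expect_batch)
  also have "\<dots> \<le> expect ?P (\<lambda>xs. expect ?Q (\<lambda>ys. 3 * ((?both xs ys)\<^sup>2 + ((?left xs)\<^sup>2 + (?right ys)\<^sup>2))))"
    by (intro expect_mono fin decomposition)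
  also have "\<dots> = 3 * (expect ?P (\<lambda>xs. expect ?Q (\<lambda>ys. (?both xs ys)\<^sup>2))
      + (expect ?P (\<lambda>xs. (?left xs)\<^sup>2) + expect ?Q (\<lambda>ys. (?right ys)\<^sup>2)))"
    by (simp only: expect_add[OF fin(1)] expect_add[OF fin(2)] integral_mult_right_zero) simp
  also have "\<dots> \<le> 3 * (inner_pmf n p q / (real M)\<^sup>2
      + ((\<Sum>i<n. pmf p i * (pmf q i)\<^sup>2) / M + (\<Sum>i<n. pmf q i * (pmf p i)\<^sup>2) / M))"
    by (intro mult_left_mono add_mono bilinear_deviation_le empirical_deviation_sq_le p q M) simp
  finally show ?thesis .
qed

lemma batch_second_moment_le:
  assumes \<Phi>: "(\<Sum>i<n. (pmf p i)\<^sup>2) \<le> \<Phi>" "(\<Sum>i<n. (pmf q i)\<^sup>2) \<le> \<Phi>"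
  shows "expect (batch_pmf n M p q) (\<lambda>z. (z - inner_pmf n p q)\<^sup>2) \<le> 3 * (\<Phi> * (1 + 2 * (M * sqrt \<Phi>))) / (real M)\<^sup>2"
proof -
  have "expect (batch_pmf n M p q) (\<lambda>z. (z - inner_pmf n p q)\<^sup>2)
      \<le> 3 * (\<Phi> / (real M)\<^sup>2 + (sqrt \<Phi> * \<Phi> / M + sqrt \<Phi> * \<Phi> / M))"
    using inner_pmf_le[OF \<Phi>] weighted_square_sum_le[OF \<Phi>] weighted_square_sum_le[OF \<Phi>(2,1)]
    by (intro order_trans[OF batch_second_moment] mult_left_mono add_mono divide_right_mono) auto
  also have "\<dots> = 3 * (\<Phi> * (1 + 2 * (M * sqrt \<Phi>))) / (real M)\<^sup>2"
    using M by (simp add: field_simps power2_eq_square)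
  finally show ?thesis .
qed

lemma batch_mean_deviation:
  fixes R r \<Phi> :: real
  defines "B \<equiv> nat \<lceil>R / M\<rceil>"
  assumes \<Phi>: "(\<Sum>i<n. (pmf p i)\<^sup>2) \<le> \<Phi>" "(\<Sum>i<n. (pmf q i)\<^sup>2) \<le> \<Phi>" and R: "0 < R" and r: "0 < r"
    and enough: "12 * (\<Phi> * (1 + 2 * (M * sqrt \<Phi>))) \<le> R * M * r\<^sup>2"
  shows "measure_pmf.prob (map_pmf (\<lambda>zs. sum_list zs / B) (replicate_pmf B (batch_pmf n M p q)))
     {z. \<not> \<bar>z - inner_pmf n p q\<bar> \<le> r} \<le> 1 / 4"
proof -
  define c where "c = inner_pmf n p q"
  define V where "V = expect (batch_pmf n M p q) (\<lambda>z. (z - c)\<^sup>2)"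
  have B_ge: "R / M \<le> B" unfolding B_def by linarith
  then have B_pos: "0 < B" using divide_pos_pos[OF R, of M] M by (simp add: B_def)
  have "V \<le> 3 * (\<Phi> * (1 + 2 * (M * sqrt \<Phi>))) / (real M)\<^sup>2"
    unfolding V_def c_def by (rule batch_second_moment_le[OF \<Phi>])
  also have "\<dots> \<le> R * M * r\<^sup>2 / 4 / (real M)\<^sup>2" using enough by (intro divide_right_mono) auto
  also have "\<dots> = (R / M) * r\<^sup>2 / 4" using M by (simp add: power2_eq_square)
  also have "\<dots> \<le> B * r\<^sup>2 / 4" using B_ge by (intro divide_right_mono mult_right_mono) auto
  finally have V_le: "V / B / r\<^sup>2 \<le> 1 / 4" using B_pos r by (simp add: field_simps)
  have "measure_pmf.prob (replicate_pmf B (batch_pmf n M p q)) {zs. \<not> \<bar>sum_list zs / B - c\<bar> \<le> r}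
      \<le> expect (replicate_pmf B (batch_pmf n M p q)) (\<lambda>zs. (sum_list (map (\<lambda>z. z) zs) / B - c)\<^sup>2) / r\<^sup>2"
    using chebyshev_inequality[OF finite_replicate_pmf[OF finite_batch_pmf] r] by simp
  also have "\<dots> = V / B / r\<^sup>2"
    unfolding V_def c_def by (simp only: expect_replicate_mean_variance[OF finite_batch_pmf batch_mean B_pos])
  finally have "measure_pmf.prob (replicate_pmf B (batch_pmf n M p q)) {zs. \<not> \<bar>sum_list zs / B - c\<bar> \<le> r} \<le> 1 / 4"
    using V_le by (rule order_trans)
  then show ?thesis by (simp add: measure_map_pmf vimage_def c_def)
qed

end

section \<open>Distribution of the random computations\<close>

lemma result_ret [simp]: "result (ret a) = return_pmf a"
  by (simp add: result_def ret_def)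

lemma result_bind [simp]: "result (bind_comp m f) = bind_pmf (result m) (\<lambda>a. result (f a))"
  by (simp add: result_def bind_comp_def map_bind_pmf bind_map_pmf pmf.map_comp o_def case_prod_unfold)

lemma result_tick [simp]: "result (tick T) = return_pmf ()"
  by (simp add: result_def tick_def)

lemma result_draw [simp]: "result (draw p) = p"
  by (simp add: result_def draw_def pmf.map_comp o_def)

lemma result_with_space [simp]: "result (with_space b m) = result m"
  by (simp add: result_def with_space_def pmf.map_comp o_def case_prod_unfold)

lemma result_for_each_const: "result (for_each (\<lambda>_. m) xs) = replicate_pmf (length xs) (result m)"
  by (induction xs) auto

lemma finite_result_for_each:
  "(\<And>x. x \<in> set xs \<Longrightarrow> finite (set_pmf (result (f x)))) \<Longrightarrow> finite (set_pmf (result (for_each f xs)))"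
  by (induction xs) auto

lemma result_for_each_nth:
  "i < length xs \<Longrightarrow> map_pmf (\<lambda>ys. ys ! i) (result (for_each f xs)) = result (f (xs ! i))"
proof (induction xs arbitrary: i)
  case (Cons x xs)
  show ?case
  proof (cases i)
    case 0
    then show ?thesis by (simp add: map_bind_pmf bind_return_pmf')
  next
    case (Suc j)
    then have "map_pmf (\<lambda>ys. ys ! j) (result (for_each f xs)) = result (f (xs ! j))"
      using Cons by simp
    then show ?thesis using Suc by (simp add: map_pmf_def bind_assoc_pmf bind_return_pmf)
  qed
qed simp

lemma result_accumulate:
  "result (accumulate B m acc) = map_pmf (\<lambda>zs. acc + sum_list zs) (replicate_pmf B (result m))"
proof (induction B arbitrary: acc)
  case (Suc B)
  have "result (accumulate (Suc B) m acc)
      = bind_pmf (result m) (\<lambda>z. map_pmf (\<lambda>zs. acc + z + sum_list zs) (replicate_pmf B (result m)))"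
    by (simp add: Suc.IH bind_return_pmf)
  then show ?case by (simp add: map_bind_pmf map_pmf_def bind_assoc_pmf bind_return_pmf add.assoc)
qed simp

lemma result_rw_batch:
  "result (rw_batch n E t M x y) = batch_pmf n M (result (lazy_walk E t x)) (result (lazy_walk E t y))"
  by (simp add: rw_batch_def batch_pmf_def result_for_each_const bind_return_pmf)

lemma result_est_rw_dot:
  "result (est_rw_dot cw n E R t M x y) = map_pmf (\<lambda>zs. sum_list zs / nat \<lceil>R / real M\<rceil>)
     (replicate_pmf (nat \<lceil>R / real M\<rceil>) (batch_pmf n M (result (lazy_walk E t x)) (result (lazy_walk E t y))))"
  by (simp add: est_rw_dot_def Let_def result_accumulate result_rw_batch bind_return_pmf map_pmf_def bind_assoc_pmf)

context regular_graph_spectrum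
begin

abbreviation walk :: "nat \<Rightarrow> nat \<Rightarrow> nat pmf" where
  "walk t x \<equiv> result (lazy_walk E t x)"

lemma neighbours_finite_nonempty:
  assumes "x < n"
  shows "finite {y. E x y}" "{y. E x y} \<noteq> {}"
proof -
  have "0 < card {y. E x y}" using card_neighbours[OF assms] d_pos by simp
  then show "finite {y. E x y}" "{y. E x y} \<noteq> {}" unfolding card_gt_0_iff by blast+
qed

lemma set_lazy_step: "x < n \<Longrightarrow> set_pmf (lazy_step E x) \<subseteq> {..<n}"
  using set_pmf_of_set[OF neighbours_finite_nonempty(2,1), of x] E_bound
  by (auto simp: lazy_step_def split: if_splits)

lemma expect_lazy_step:
  assumes "x < n"
  shows "expect (lazy_step E x) h = h x / 2 + (\<Sum>y<n. adj E x y * h y) / d / 2"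
proof -
  note nbrs = neighbours_finite_nonempty[OF assms]
  have "expect (lazy_step E x) h
      = expect (bernoulli_pmf (1 / 2)) (\<lambda>stay. expect (if stay then return_pmf x else pmf_of_set {y. E x y}) h)"
    unfolding lazy_step_def using nbrs by (intro expect_bind) auto
  also have "\<dots> = h x / 2 + (\<Sum>y | E x y. h y) / d / 2"
    using nbrs by (simp add: integral_pmf_of_set card_neighbours[OF assms])
  finally show ?thesis by (simp add: sum_adj)
qed

lemma set_walk: "x < n \<Longrightarrow> set_pmf (walk t x) \<subseteq> {..<n}"
proof (induction t arbitrary: x)
  case (Suc t)
  then show ?case using set_lazy_step[OF Suc.prems] by auto
qed simp

lemma pmf_walk:
  assumes "x < n" "i < n"
  shows "pmf (walk t x) i = mul_vec n (transposed v) (\<lambda>a. (1 - lam a / 2) ^ t * v a x) i"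
  using assms(1)
proof (induction t arbitrary: x)
  case 0
  then show ?case using complete[OF 0 assms(2)] by (simp add: pmf_return mul_vec_def mult.commute)
next
  case (Suc t)
  let ?P = "\<lambda>y. pmf (walk t y) i"
  have "pmf (walk (Suc t) x) i = ?P x / 2 + (\<Sum>y<n. adj E x y * ?P y) / d / 2"
    using expect_lazy_step[OF Suc.prems, of ?P] by (simp add: pmf_bind)
  also have "(\<Sum>y<n. adj E x y * ?P y) = (\<Sum>a<n. (1 - lam a / 2) ^ t * v a i * (\<Sum>y<n. adj E x y * v a y))"
    unfolding sum_distrib_left by (subst sum.swap) (simp add: Suc.IH mul_vec_def sum_distrib_left mult_ac)
  also have "\<dots> = (\<Sum>a<n. d * ((1 - lam a / 2) ^ t * v a i * ((1 - lam a) * v a x)))"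
    using Suc.prems by (intro sum.cong refl) (simp add: sum_adj_eq_normalized eigenvector)
  also have "\<dots> = d * (\<Sum>a<n. (1 - lam a / 2) ^ t * v a i * ((1 - lam a) * v a x))"
    by (simp add: sum_distrib_left)
  also have "?P x / 2 + d * (\<Sum>a<n. (1 - lam a / 2) ^ t * v a i * ((1 - lam a) * v a x)) / d / 2
      = mul_vec n (transposed v) (\<lambda>a. (1 - lam a / 2) ^ Suc t * v a x) i"
    using d_pos
    by (simp add: Suc.IH[OF Suc.prems] mul_vec_def sum_divide_distrib sum.distrib[symmetric])
       (intro sum.cong refl, simp add: field_simps)
  finally show ?case .
qed

lemma inner_pmf_walk:
  assumes "x < n" "y < n"
  shows "inner_pmf n (walk t x) (walk t y) = (\<Sum>a<n. (1 - lam a / 2) ^ (2 * t) * v a x * v a y)"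
proof -
  let ?c = "\<lambda>x a. (1 - lam a / 2) ^ t * v a x"
  have "inner_pmf n (walk t x) (walk t y) = dot n (mul_vec n (transposed v) (?c x)) (mul_vec n (transposed v) (?c y))"
    using assms by (simp add: inner_pmf_def dot_def pmf_walk)
  also have "\<dots> = dot n (?c x) (?c y)" unfolding parseval[of "mul_vec n _ _"] by (intro dot_cong) (simp_all add: coords_combination)
  also have "\<dots> = (\<Sum>a<n. (1 - lam a / 2) ^ (2 * t) * v a x * v a y)"
    unfolding dot_def mult_2 power_add by (simp add: mult_ac)
  finally show ?thesis .
qed

end

section \<open>Truncated inverse squares of symmetric matrices\<close>

lemma mat_inverse_diagonal:
  fixes f :: "nat \<Rightarrow> 'a :: field"
  assumes "\<And>i. i < k \<Longrightarrow> f i \<noteq> 0"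
  shows "mat_inverse (mat_diag k f) = Some (mat_diag k (\<lambda>i. 1 / f i))"
proof -
  let ?D = "mat_diag k f" and ?D' = "mat_diag k (\<lambda>i. 1 / f i)"
  have carrier: "?D \<in> carrier_mat k k" "?D' \<in> carrier_mat k k" by auto
  have inverse: "?D * ?D' = 1\<^sub>m k" "?D' * ?D = 1\<^sub>m k"
    using assms unfolding mat_diag_diag by (auto simp: mat_diag_def intro!: eq_matI)
  then have "?D \<in> Units (ring_mat TYPE('a) k ())" using carrier
    by (auto simp: Units_def ring_mat_def simp del: mat_diag_diag)
  then obtain D where D: "mat_inverse ?D = Some D" using mat_inverse(1)[OF carrier(1)] by fastforce
  then have left_inverse: "D * ?D = 1\<^sub>m k" and D_carrier: "D \<in> carrier_mat k k"
    using mat_inverse(2)[OF carrier(1)] by auto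
  have "D = D * (?D * ?D')" unfolding inverse(1) using D_carrier by simp
  also have "\<dots> = D * ?D * ?D'" by (rule assoc_mult_mat[OF D_carrier carrier, symmetric])
  also have "\<dots> = ?D'" unfolding left_inverse by (rule left_mult_one_mat[OF carrier(2)])
  finally show ?thesis using D by simp
qed

lemma bilinear_form_diagonal:
  fixes W :: "real mat"
  assumes W: "W \<in> carrier_mat s k" and x: "x \<in> carrier_vec s" and y: "y \<in> carrier_vec s"
  shows "x \<bullet> ((c \<cdot>\<^sub>m (W * mat_diag k g * transpose_mat W)) *\<^sub>v y)
    = c * (\<Sum>l<k. g l * (\<Sum>i<s. W $$ (i, l) * x $ i) * (\<Sum>i<s. W $$ (i, l) * y $ i))"
proof -
  define Q where "Q = W * mat_diag k g * transpose_mat W"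
  have Q_carrier: "Q \<in> carrier_mat s s" unfolding Q_def mat_diag_mult_right[OF W] using W by auto
  have Q: "Q $$ (i, j) = (\<Sum>l<k. g l * W $$ (i, l) * W $$ (j, l))" if "i < s" "j < s" for i j
    using that W unfolding Q_def mat_diag_mult_right[OF W]
    by (simp add: scalar_prod_def atLeast0LessThan mult_ac)
  have "x \<bullet> ((c \<cdot>\<^sub>m Q) *\<^sub>v y) = (\<Sum>i<s. x $ i * (\<Sum>j<s. c * Q $$ (i, j) * y $ j))"
    using x y Q_carrier by (auto simp: scalar_prod_def atLeast0LessThan intro!: sum.cong)
  also have "\<dots> = (\<Sum>i<s. \<Sum>j<s. \<Sum>l<k. c * (g l * (W $$ (i, l) * x $ i) * (W $$ (j, l) * y $ j)))"
    by (intro sum.cong refl) (simp add: Q sum_distrib_left sum_distrib_right mult_ac)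
  also have "\<dots> = (\<Sum>l<k. \<Sum>i<s. \<Sum>j<s. c * (g l * (W $$ (i, l) * x $ i) * (W $$ (j, l) * y $ j)))"
    by (subst sum.swap[of _ "{..<k}" "{..<s}"]) (rule sum.swap)
  also have "\<dots> = c * (\<Sum>l<k. g l * (\<Sum>i<s. W $$ (i, l) * x $ i) * (\<Sum>i<s. W $$ (i, l) * y $ i))"
    unfolding mult.assoc[of "g _"] sum_product by (simp add: sum_distrib_left mult_ac)
  finally show ?thesis by (simp add: Q_def)
qed

lemma truncated_bilinear_form:
  fixes W :: "real mat" and c :: real and k :: nat
  assumes c: "0 \<le> c" and x: "x \<in> carrier_vec s" and y: "y \<in> carrier_vec s"
  defines "Wk \<equiv> mat s k (\<lambda>(i, j). W $$ (i, j))" and "scaled_coords \<equiv> \<lambda>x l. \<Sum>i<s. W $$ (i, l) * (sqrt c * x $ i)"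
  shows "x \<bullet> ((c \<cdot>\<^sub>m (Wk * mat_diag k (\<lambda>l. 1 / (\<sigma> l)\<^sup>2) * transpose_mat Wk)) *\<^sub>v y)
    = (\<Sum>l<k. scaled_coords x l * scaled_coords y l / (\<sigma> l)\<^sup>2)"
proof -
  let ?p = "\<lambda>x l. \<Sum>i<s. Wk $$ (i, l) * x $ i"
  have scaled: "scaled_coords x l = sqrt c * ?p x l" if "l < k" for x l
    using that by (simp add: scaled_coords_def Wk_def sum_distrib_left mult_ac)
  have "x \<bullet> ((c \<cdot>\<^sub>m (Wk * mat_diag k (\<lambda>l. 1 / (\<sigma> l)\<^sup>2) * transpose_mat Wk)) *\<^sub>v y)
      = c * (\<Sum>l<k. 1 / (\<sigma> l)\<^sup>2 * ?p x l * ?p y l)"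
    using x y by (intro bilinear_form_diagonal) (simp_all add: Wk_def)
  also have "\<dots> = (\<Sum>l<k. (sqrt c * sqrt c) * (?p x l * ?p y l / (\<sigma> l)\<^sup>2))"
    unfolding sum_distrib_left[of c] using c by (intro sum.cong refl) simp
  also have "\<dots> = (\<Sum>l<k. scaled_coords x l * scaled_coords y l / (\<sigma> l)\<^sup>2)"
    by (intro sum.cong refl) (simp only: scaled lessThan_iff mult_ac times_divide_eq_right)
  finally show ?thesis .
qed

lemma eigensolver_eigenbasis:
  assumes "eigensolver eig" and A: "A \<in> carrier_mat m m" "transpose_mat A = A" and eig: "eig A = (W, D)"
  shows "orthonormal_eigenbasis m (\<lambda>l i. W $$ (i, l)) (\<lambda>i j. A $$ (i, j)) (\<lambda>l. D $$ (l, l))"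
    and "D = mat_diag m (\<lambda>l. D $$ (l, l))"
proof -
  have "case eig A of (W, D) \<Rightarrow>
      W \<in> carrier_mat m m \<and> D \<in> carrier_mat m m \<and> W * transpose_mat W = 1\<^sub>m m \<and> transpose_mat W * W = 1\<^sub>m m \<and>
      diagonal_mat D \<and> (\<forall>i j. i \<le> j \<and> j < m \<longrightarrow> D $$ (j, j) \<le> D $$ (i, i)) \<and> A = W * D * transpose_mat W"
    by (rule assms(1)[unfolded eigensolver_def, THEN spec, THEN spec, THEN mp, OF conjI[OF A]])
  then have W: "W \<in> carrier_mat m m" and D: "D \<in> carrier_mat m m" "diagonal_mat D"
    and W_orthogonal: "transpose_mat W * W = 1\<^sub>m m" and A_eq: "A = W * D * transpose_mat W"
    and antimono: "\<forall>i j. i \<le> j \<and> j < m \<longrightarrow> D $$ (j, j) \<le> D $$ (i, i)"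
    unfolding eig prod.case by blast+
  show D_diag: "D = mat_diag m (\<lambda>l. D $$ (l, l))"
    using D by (intro eq_matI) (auto simp: mat_diag_def diagonal_mat_def)
  have "A * W = W * D * (transpose_mat W * W)"
    unfolding A_eq using W D by (intro assoc_mult_mat[of _ m m _ m _ m]) auto
  also have "\<dots> = W * D" using W D by (simp add: W_orthogonal)
  also have "\<dots> = mat m m (\<lambda>(i, l). W $$ (i, l) * D $$ (l, l))"
    by (subst D_diag) (rule mat_diag_mult_right[OF W])
  finally have A_mult_W: "A * W = mat m m (\<lambda>(i, l). W $$ (i, l) * D $$ (l, l))" .
  show "orthonormal_eigenbasis m (\<lambda>l i. W $$ (i, l)) (\<lambda>i j. A $$ (i, j)) (\<lambda>l. D $$ (l, l))"
  proof
    show "dot m (\<lambda>i. W $$ (i, a)) (\<lambda>i. W $$ (i, b)) = (if a = b then 1 else 0)" if "a < m" "b < m" for a b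
      using arg_cong[OF W_orthogonal, of "\<lambda>M. M $$ (a, b)"] that W
      by (simp add: dot_def scalar_prod_def atLeast0LessThan)
    show "mul_vec m (\<lambda>i j. A $$ (i, j)) (\<lambda>i. W $$ (i, a)) i = D $$ (a, a) * W $$ (i, a)" if "a < m" "i < m" for a i
      using arg_cong[OF A_mult_W, of "\<lambda>M. M $$ (i, a)"] that W A
      by (simp add: mul_vec_def scalar_prod_def atLeast0LessThan mult.commute)
    show "D $$ (b, b) \<le> D $$ (a, a)" if "a \<le> b" "b < m" for a b using antimono that by blast
  qed
qed

definition oracle_output ::
    "(real mat \<Rightarrow> real mat \<times> real mat) \<Rightarrow> nat \<Rightarrow> nat \<Rightarrow> nat \<Rightarrow> real mat \<Rightarrow> real mat option" where
  "oracle_output eig n k s G = (let (W, D) = eig ((real n / real s) \<cdot>\<^sub>m G); Wk = mat s k (\<lambda>(i, j). W $$ (i, j)) in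
     case mat_inverse (mat k k (\<lambda>(i, j). D $$ (i, j))) of
       None \<Rightarrow> None
     | Some Di \<Rightarrow> Some ((real n / real s) \<cdot>\<^sub>m (Wk * (Di * Di) * transpose_mat Wk)))"

lemma oracle_output_eq:
  assumes eig: "eig ((real n / real s) \<cdot>\<^sub>m G) = (W, D)" and D: "D = mat_diag s \<sigma>"
    and k: "k \<le> s" and \<sigma>: "\<And>l. l < k \<Longrightarrow> \<sigma> l \<noteq> 0"
  defines "Wk \<equiv> mat s k (\<lambda>(i, j). W $$ (i, j))"
  shows "oracle_output eig n k s G
    = Some ((real n / real s) \<cdot>\<^sub>m (Wk * mat_diag k (\<lambda>l. 1 / (\<sigma> l)\<^sup>2) * transpose_mat Wk))"
proof -
  have "mat k k (\<lambda>(i, j). D $$ (i, j)) = mat_diag k \<sigma>"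
    using k unfolding D by (intro eq_matI) (auto simp: mat_diag_def)
  moreover have "mat_diag k (\<lambda>l. 1 / \<sigma> l) * mat_diag k (\<lambda>l. 1 / \<sigma> l) = mat_diag k (\<lambda>l. 1 / (\<sigma> l)\<^sup>2)"
    by (simp add: mat_diag_diag power2_eq_square)
  ultimately show ?thesis
    using mat_inverse_diagonal[of k \<sigma>, OF \<sigma>] by (simp add: oracle_output_def eig Wk_def Let_def)
qed

section \<open>Accuracy of the oracle for accurate estimates\<close>

context clustered_spectrum
begin

abbreviation t :: nat where
  "t \<equiv> walk_length n \<phi>"

definition collision :: "nat \<Rightarrow> nat \<Rightarrow> real" where
  "collision x y = inner_pmf n (walk t x) (walk t y)"

definition damping :: "nat \<Rightarrow> real" where
  "damping a = (1 - lam a / 2) ^ (2 * t)"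

definition min_damping :: real where
  "min_damping = 99 / 100 * \<nu> (- 44)"

lemma collision_commute: "collision x y = collision y x"
  by (simp add: collision_def inner_pmf_def mult.commute)

lemma t_bounds: "20 * ln n / \<phi>\<^sup>2 \<le> t" "t \<le> 20 * ln n / \<phi>\<^sup>2 + 1"
proof -
  have "0 \<le> 20 * ln n / \<phi>\<^sup>2" using ln_n_ge_1 by simp
  then show "20 * ln n / \<phi>\<^sup>2 \<le> t" "t \<le> 20 * ln n / \<phi>\<^sup>2 + 1"
    unfolding walk_length_def by linarith+
qed

lemma min_damping_pos: "0 < min_damping"
  using \<nu>_pos by (simp add: min_damping_def)

lemma damping_ge:
  assumes "a < k"
  shows "min_damping \<le> damping a"
proof -
  have "11 / 5 * \<epsilon> * t \<le> 11 / 5 * \<epsilon> * (20 * ln n / \<phi>\<^sup>2 + 1)" using t_bounds(2) \<epsilon> by (intro mult_left_mono) auto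
  also have "\<dots> = 11 / 5 * \<epsilon> + 44 * (\<epsilon> / \<phi>\<^sup>2) * ln n" by (simp add: algebra_simps)
  finally have "exp (- (11 / 5 * \<epsilon>)) * \<nu> (- 44) \<le> exp (- (11 / 5 * \<epsilon> * t))"
    by (simp add: \<nu>_eq_exp exp_add[symmetric])
  also have "\<dots> = exp (- (11 / 10 * \<epsilon>)) ^ (2 * t)" by (simp add: exp_of_nat_mult[symmetric] algebra_simps)
  also have "\<dots> \<le> damping a"
    unfolding damping_def
  proof (rule power_mono)
    have "exp (- (11 / 10 * \<epsilon>)) \<le> 1 - \<epsilon>" using \<epsilon> \<epsilon>_le(2) by (intro exp_le_one_minus) auto
    then show "exp (- (11 / 10 * \<epsilon>)) \<le> 1 - lam a / 2" using low_eigenvalue_le[OF assms] by linarith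
  qed simp
  finally have "exp (- (11 / 5 * \<epsilon>)) * \<nu> (- 44) \<le> damping a" .
  moreover have "99 / 100 \<le> exp (- (11 / 5 * \<epsilon>))"
    using exp_ge_add_one_self[of "- (11 / 5 * \<epsilon>)"] \<epsilon>_le(2) by simp
  ultimately show ?thesis
    unfolding min_damping_def using mult_right_mono[of "99 / 100" "exp (- (11 / 5 * \<epsilon>))" "\<nu> (- 44)"] \<nu>_pos[of "- 44"]
    by linarith
qed

lemma damping_bounds:
  assumes "a < n"
  shows "0 \<le> damping a" "damping a \<le> 1"
  using eigenvalue_bounds[OF assms] by (auto simp: damping_def intro: power_le_one)

lemma damping_tail:
  assumes "k \<le> a" "a < n"
  shows "damping a \<le> 1 / real n ^ 10"
proof -
  have "1 - lam a / 2 \<le> exp (- lam a / 2)" using exp_ge_add_one_self[of "- lam a / 2"] by simp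
  then have "damping a \<le> exp (- lam a / 2) ^ (2 * t)"
    unfolding damping_def using eigenvalue_bounds(2)[OF assms(2)] by (intro power_mono) auto
  also have "\<dots> = exp (- (lam a * t))" by (simp add: exp_of_nat_mult[symmetric] algebra_simps)
  also have "\<dots> \<le> exp (- (10 * ln n))"
  proof -
    have "10 * ln n = \<phi>\<^sup>2 / 2 * (20 * ln n / \<phi>\<^sup>2)" using \<phi> by simp
    also have "\<dots> \<le> lam a * t"
      using high_eigenvalue_ge[OF assms] t_bounds(1) ln_n_ge_1 eigenvalue_bounds(1)[OF assms(2)]
      by (intro mult_mono) auto
    finally show ?thesis by simp
  qed
  also have "\<dots> = 1 / real n ^ 10"
    using n_ge_4 by (simp add: exp_minus exp_of_nat_mult[of 10 "ln n", simplified] divide_inverse)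
  finally show ?thesis .
qed

lemma collision_low_rank:
  assumes x: "x < n" and y: "y < n"
  shows "\<bar>collision x y - (\<Sum>a<k. damping a * v a x * v a y)\<bar> \<le> 1 / real n ^ 10"
proof -
  have "{..<n} = {..<k} \<union> {k..<n}" using two_k_le_n by auto
  then have "collision x y = (\<Sum>a<k. damping a * v a x * v a y) + (\<Sum>a\<in>{k..<n}. damping a * v a x * v a y)"
    unfolding collision_def inner_pmf_walk[OF x y] damping_def[symmetric]
    by (simp add: sum.union_disjoint ivl_disj_int)
  moreover have "\<bar>\<Sum>a\<in>{k..<n}. damping a * v a x * v a y\<bar> \<le> 1 / real n ^ 10"
  proof -
    have "\<bar>damping a * v a x * v a y\<bar> \<le> 1 / real n ^ 10 * (((v a x)\<^sup>2 + (v a y)\<^sup>2) / 2)" if "a \<in> {k..<n}" for a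
    proof -
      have "\<bar>v a x\<bar> * \<bar>v a y\<bar> \<le> ((v a x)\<^sup>2 + (v a y)\<^sup>2) / 2"
        using sum_squares_bound[of "\<bar>v a x\<bar>" "\<bar>v a y\<bar>"] by simp
      then have "damping a * (\<bar>v a x\<bar> * \<bar>v a y\<bar>) \<le> 1 / real n ^ 10 * (((v a x)\<^sup>2 + (v a y)\<^sup>2) / 2)"
        using damping_tail[of a] that by (intro mult_mono) auto
      then show ?thesis using damping_bounds(1)[of a] that by (simp add: abs_mult mult.assoc)
    qed
    then have "\<bar>\<Sum>a\<in>{k..<n}. damping a * v a x * v a y\<bar>
        \<le> (\<Sum>a\<in>{k..<n}. 1 / real n ^ 10 * (((v a x)\<^sup>2 + (v a y)\<^sup>2) / 2))"
      by (rule order_trans[OF sum_abs sum_mono])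
    also have "\<dots> \<le> (\<Sum>a<n. 1 / real n ^ 10 * (((v a x)\<^sup>2 + (v a y)\<^sup>2) / 2))"
      by (intro sum_mono2) auto
    also have "\<dots> = 1 / real n ^ 10 * (((\<Sum>a<n. v a x * v a x) + (\<Sum>a<n. v a y * v a y)) / 2)"
      by (simp add: sum_distrib_left[symmetric] sum_divide_distrib[symmetric] sum.distrib power2_eq_square)
    also have "\<dots> = 1 / real n ^ 10" using complete[OF x x] complete[OF y y] by simp
    finally show ?thesis .
  qed
  ultimately show ?thesis by simp
qed

lemma walk_norm_sq_le:
  assumes x: "x < n"
  shows "(\<Sum>i<n. (pmf (walk t x) i)\<^sup>2) \<le> 2 * coherence / n"
proof -
  have "damping a * v a x * v a x \<le> (v a x)\<^sup>2" if "a < k" for a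
  proof -
    have "damping a * (v a x)\<^sup>2 \<le> 1 * (v a x)\<^sup>2"
      using damping_bounds(2)[of a] that two_k_le_n by (intro mult_right_mono) auto
    then show ?thesis by (simp add: power2_eq_square mult.assoc)
  qed
  then have "(\<Sum>a<k. damping a * v a x * v a x) \<le> (l2norm k (\<lambda>a. v a x))\<^sup>2"
    unfolding l2norm_sq by (intro sum_mono) auto
  also have "\<dots> \<le> coherence / n" by (rule embedding_norm_sq_le(1)[OF x])
  finally have low_rank: "(\<Sum>a<k. damping a * v a x * v a x) \<le> coherence / n" .
  have "real n \<le> real n ^ 10" using n_ge_4 by (intro self_le_power) auto
  then have "1 / real n ^ 10 \<le> coherence / n" using n_ge_4 coherence_ge_12 by (intro frac_le) auto
  then have "collision x x \<le> coherence / n + coherence / n"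
    using low_rank collision_low_rank[OF x x] by linarith
  then show ?thesis by (simp add: collision_def inner_pmf_def power2_eq_square)
qed

lemma \<nu>_le_sqrt: "r \<le> 50000 \<Longrightarrow> \<nu> r \<le> sqrt n"
proof -
  assume "r \<le> 50000"
  then have "\<nu> r \<le> \<nu> 50000" by (rule \<nu>_mono)
  also have "\<dots> \<le> real n powr (1 / 2)"
    unfolding \<nu>_def using ratio n_ge_4 by (intro powr_mono) (auto simp: mult.commute)
  finally show ?thesis by (simp add: powr_half_sqrt)
qed

lemma min_damping_ge: "198 / 100 / n \<le> min_damping"
proof -
  have "2 * sqrt n \<le> sqrt n * sqrt n" using n_ge_4 by (intro mult_right_mono real_le_rsqrt) auto
  then have "2 * \<nu> 44 \<le> n" using \<nu>_le_sqrt[of 44] by simp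
  then have "2 / n \<le> 1 / \<nu> 44" using \<nu>_pos[of 44] n_ge_4 by (simp add: field_simps)
  also have "1 / \<nu> 44 = \<nu> (- 44)" using \<nu>_add[of "- 44" 44] \<nu>_pos[of 44] by (simp add: field_simps)
  finally show ?thesis by (simp add: min_damping_def)
qed

end

locale oracle_precision = clustered_spectrum +
  fixes \<xi> :: real
  assumes \<xi>: "1 / real n ^ 5 < \<xi>" "\<xi> < 1"
begin

definition gram_tol :: real where
  "gram_tol = \<xi> / (10 * coherence)"

text \<open>The estimates must be accurate to within \<open>est_tol 2\<close> in \<open>init_oracle\<close> and to within
  \<open>est_tol 1\<close> in \<open>query_dot\<close>.\<close>

definition est_tol :: "nat \<Rightarrow> real" where
  "est_tol j = \<xi> * min_damping / (100 * n * sqrt coherence ^ j)"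

definition gram_error :: real where
  "gram_error = n * (est_tol 2 + 1 / real n ^ 10)"

definition query_error :: real where
  "query_error = sqrt n * (est_tol 1 + 1 / real n ^ 10)"

definition embedding_radius :: real where
  "embedding_radius = sqrt (min 1 (coherence / n))"

lemma \<xi>_pos: "0 < \<xi>"
  using order.strict_trans1[OF _ \<xi>(1), of 0] by simp

lemma coherence_pos: "0 < coherence"
  using coherence_ge_12 by linarith

lemma gram_tol_pos: "0 < gram_tol"
  using \<xi>_pos coherence_pos by (simp add: gram_tol_def)

lemma est_tol_pos: "0 < est_tol j"
  using \<xi>_pos min_damping_pos coherence_pos n_ge_4 by (simp add: est_tol_def)

lemma errors_nonneg: "0 \<le> gram_error" "0 \<le> query_error"
  using est_tol_pos[of 1] est_tol_pos[of 2] by (auto simp: gram_error_def query_error_def)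

lemma embedding_radius_bounds:
  "0 \<le> embedding_radius" "embedding_radius \<le> 1" "embedding_radius \<le> sqrt (coherence / n)" "1 / n \<le> embedding_radius\<^sup>2"
proof -
  have "1 / n \<le> coherence / n" using coherence_ge_12 by (intro divide_right_mono) auto
  moreover have "1 / n \<le> 1" using n_ge_4 by simp
  ultimately show "1 / n \<le> embedding_radius\<^sup>2" using coherence_pos by (simp add: embedding_radius_def)
qed (use coherence_pos in \<open>auto simp: embedding_radius_def\<close>)

lemma embedding_norm_le: "x < n \<Longrightarrow> l2norm k (\<lambda>a. v a x) \<le> embedding_radius"
  unfolding embedding_radius_def using embedding_norm_sq_le[of x] by (intro real_le_rsqrt) simp

text \<open>The error caused by the discarded part of the spectrum does not decrease with the number of
  samples. It is small enough only because \<open>4 \<le> n\<close>.\<close>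

lemma spectral_tail_le: "1 / real n ^ 10 \<le> min_damping * \<xi> / (30 * (real n)\<^sup>2)"
proof -
  have n: "0 < real n" using n_ge_4 by simp
  have "(4 :: real)\<^sup>2 \<le> (real n)\<^sup>2" using n_ge_4 by (intro power_mono) auto
  then have "30 / real n ^ 8 \<le> 198 / 100 * (real n)\<^sup>2 / real n ^ 8" by (intro divide_right_mono) auto
  also have "\<dots> = 198 / 100 / n * (1 / real n ^ 5)" using n by (simp add: field_simps eval_nat_numeral)
  also have "\<dots> \<le> min_damping * \<xi>" using min_damping_ge min_damping_pos \<xi>(1) by (intro mult_mono) auto
  finally have "30 / real n ^ 8 / (30 * (real n)\<^sup>2) \<le> min_damping * \<xi> / (30 * (real n)\<^sup>2)"
    by (intro divide_right_mono) auto
  also have "30 / real n ^ 8 / (30 * (real n)\<^sup>2) = 1 / real n ^ 10" by (simp flip: power_add)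
  finally show ?thesis .
qed

lemma gram_tol_le: "gram_tol \<le> 1 / 100"
proof -
  have "\<xi> / (10 * coherence) \<le> 1 / (10 * 12)" using coherence_ge_12 \<xi> by (intro frac_le) auto
  then show ?thesis by (simp add: gram_tol_def)
qed

lemma gram_error_eq: "gram_error = \<xi> * min_damping / (100 * coherence) + n / real n ^ 10"
  using n_ge_4 coherence_pos by (simp add: gram_error_def est_tol_def distrib_left)

lemma gram_error_le: "gram_error \<le> min_damping / 20"
proof -
  have "\<xi> * min_damping / (100 * coherence) \<le> 1 * min_damping / (100 * 12)"
    using coherence_ge_12 \<xi> min_damping_pos by (intro frac_le mult_right_mono) auto
  moreover have "n / real n ^ 10 \<le> min_damping / 120"
  proof -
    have "n * (1 / real n ^ 10) \<le> n * (min_damping * \<xi> / (30 * (real n)\<^sup>2))"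
      by (intro mult_left_mono spectral_tail_le) simp
    also have "\<dots> = min_damping * \<xi> / (30 * n)" using n_ge_4 by (simp add: power2_eq_square)
    also have "\<dots> \<le> min_damping * 1 / (30 * 4)"
      using \<xi> n_ge_4 min_damping_pos by (intro frac_le mult_left_mono) auto
    finally show ?thesis by simp
  qed
  ultimately show ?thesis using min_damping_pos unfolding gram_error_eq by linarith
qed

lemma gram_error_radius_le: "gram_error * embedding_radius\<^sup>2 \<le> 13 / 300 * min_damping * (\<xi> / n)"
proof -
  note radius = embedding_radius_bounds
  have "embedding_radius\<^sup>2 \<le> (sqrt (coherence / n))\<^sup>2" using radius by (intro power_mono)
  then have radius_sq_le: "embedding_radius\<^sup>2 \<le> coherence / n" using coherence_pos by simp
  have radius_sq_le_1: "embedding_radius\<^sup>2 \<le> 1" using radius by (simp add: power_le_one)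
  have "gram_error * embedding_radius\<^sup>2 = \<xi> * min_damping / (100 * coherence) * embedding_radius\<^sup>2
      + n / real n ^ 10 * embedding_radius\<^sup>2"
    by (simp add: gram_error_eq distrib_right)
  also have "\<dots> \<le> \<xi> * min_damping / (100 * coherence) * (coherence / n)
      + n * (min_damping * \<xi> / (30 * (real n)\<^sup>2)) * 1"
  proof (intro add_mono mult_mono radius_sq_le_1 mult_left_mono radius_sq_le)
    show "n / real n ^ 10 \<le> n * (min_damping * \<xi> / (30 * (real n)\<^sup>2))"
      using mult_left_mono[OF spectral_tail_le, of "real n"] by simp
  qed (use \<xi>_pos min_damping_pos coherence_pos in auto)
  also have "\<dots> = 13 / 300 * min_damping * (\<xi> / n)"
    using n_ge_4 coherence_pos by (simp add: power2_eq_square field_simps)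
  finally show ?thesis .
qed

lemma query_error_radius_le: "query_error * embedding_radius \<le> 13 / 300 * min_damping * (\<xi> / n)"
proof -
  note radius = embedding_radius_bounds
  have n: "0 < real n" "1 \<le> sqrt n" using n_ge_4 by auto
  have "query_error * embedding_radius = sqrt n * est_tol 1 * embedding_radius + sqrt n * (1 / real n ^ 10) * embedding_radius"
    by (simp add: query_error_def distrib_right distrib_left)
  also have "\<dots> \<le> sqrt n * est_tol 1 * sqrt (coherence / n) + sqrt n * (min_damping * \<xi> / (30 * (real n)\<^sup>2)) * 1"
    using radius est_tol_pos[of 1] spectral_tail_le \<xi>_pos min_damping_pos
    by (intro add_mono mult_mono mult_left_mono) auto
  also have "\<dots> \<le> 1 / 100 * min_damping * (\<xi> / n) + n * (min_damping * \<xi> / (30 * (real n)\<^sup>2))"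
  proof (rule add_mono)
    show "sqrt n * est_tol 1 * sqrt (coherence / n) \<le> 1 / 100 * min_damping * (\<xi> / n)"
      using n coherence_pos by (simp add: est_tol_def real_sqrt_divide mult.commute)
    have "sqrt n * 1 \<le> sqrt n * sqrt n" using n(2) by (intro mult_left_mono) auto
    then have "sqrt n \<le> n" by simp
    then show "sqrt n * (min_damping * \<xi> / (30 * (real n)\<^sup>2)) * 1 \<le> n * (min_damping * \<xi> / (30 * (real n)\<^sup>2))"
      using \<xi>_pos min_damping_pos by (simp add: mult_right_mono divide_right_mono)
  qed
  also have "\<dots> = 13 / 300 * min_damping * (\<xi> / n)"
    using n by (simp add: power2_eq_square field_simps)
  finally show ?thesis .
qed

lemma error_budget:
  defines "\<tau> \<equiv> (4 * gram_error * embedding_radius + 6 / 5 * query_error) / min_damping"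
  shows "11 / 10 * gram_tol * embedding_radius\<^sup>2 + 21 / 10 * embedding_radius * \<tau> + \<tau>\<^sup>2 \<le> \<xi> / n"
proof -
  note radius = embedding_radius_bounds
  have radius_pos: "0 < embedding_radius" using radius(1,4) n_ge_4 by (cases "embedding_radius = 0") auto
  have "embedding_radius * \<tau> = (4 * (gram_error * embedding_radius\<^sup>2) + 6 / 5 * (query_error * embedding_radius)) / min_damping"
    by (simp add: \<tau>_def power2_eq_square algebra_simps)
  also have "\<dots> \<le> (4 * (13 / 300 * min_damping * (\<xi> / n)) + 6 / 5 * (13 / 300 * min_damping * (\<xi> / n))) / min_damping"
    using gram_error_radius_le query_error_radius_le min_damping_pos by (intro divide_right_mono add_mono mult_left_mono) auto
  also have "\<dots> = 169 / 750 * (\<xi> / n)" using min_damping_pos by (simp add: field_simps)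
  finally have radius_\<tau>: "embedding_radius * \<tau> \<le> 169 / 750 * (\<xi> / n)" .
  have \<tau>_nonneg: "0 \<le> \<tau>" using errors_nonneg radius(1) min_damping_pos by (simp add: \<tau>_def)
  have \<xi>n: "0 < \<xi> / n" "\<xi> / n \<le> 1 / n" using \<xi> \<xi>_pos n_ge_4 by (auto intro: divide_right_mono)
  have "embedding_radius * \<tau> \<le> embedding_radius * (1 / 4 * embedding_radius)"
    using radius_\<tau> radius(4) \<xi>n by (simp add: power2_eq_square)
  then have "\<tau> \<le> 1 / 4 * embedding_radius" using radius_pos by simp
  then have "\<tau>\<^sup>2 \<le> 1 / 4 * (embedding_radius * \<tau>)"
    using mult_right_mono[of \<tau> "1 / 4 * embedding_radius" \<tau>] \<tau>_nonneg by (simp add: power2_eq_square)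
  moreover have "gram_tol * embedding_radius\<^sup>2 \<le> 1 / 10 * (\<xi> / n)"
  proof -
    have "embedding_radius\<^sup>2 \<le> (sqrt (coherence / n))\<^sup>2" using radius by (intro power_mono)
    then have "gram_tol * embedding_radius\<^sup>2 \<le> gram_tol * (coherence / n)"
      using coherence_pos gram_tol_pos by (intro mult_left_mono) auto
    then show ?thesis using coherence_pos by (simp add: gram_tol_def)
  qed
  ultimately have "11 / 10 * (gram_tol * embedding_radius\<^sup>2) + 21 / 10 * (embedding_radius * \<tau>) + \<tau>\<^sup>2 \<le> \<xi> / n"
    using radius_\<tau> \<xi>n(1) by linarith
  then show ?thesis by (simp only: mult.assoc)
qed

definition isotropic_sample :: "nat list \<Rightarrow> bool" where
  "isotropic_sample IS \<longleftrightarrow> (\<forall>a<k. \<forall>b<k.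
     \<bar>real n / length IS * (\<Sum>i<length IS. v a (IS ! i) * v b (IS ! i)) - (if a = b then 1 else 0)\<bar> \<le> gram_tol / k)"

definition accurate_gram :: "nat list \<Rightarrow> real mat \<Rightarrow> bool" where
  "accurate_gram IS G \<longleftrightarrow> G \<in> carrier_mat (length IS) (length IS) \<and> transpose_mat G = G \<and>
     (\<forall>i<length IS. \<forall>j<length IS. \<bar>G $$ (i, j) - collision (IS ! i) (IS ! j)\<bar> \<le> est_tol 2)"

definition accurate_query :: "nat list \<Rightarrow> nat \<Rightarrow> real vec \<Rightarrow> bool" where
  "accurate_query IS x \<alpha> \<longleftrightarrow> \<alpha> \<in> carrier_vec (length IS) \<and>
     (\<forall>i<length IS. \<bar>\<alpha> $ i - collision x (IS ! i)\<bar> \<le> est_tol 1)"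

definition accurate_oracle :: "nat list \<Rightarrow> real mat \<Rightarrow> bool" where
  "accurate_oracle IS \<Psi> \<longleftrightarrow> (\<forall>x y \<alpha>x \<alpha>y. x < n \<longrightarrow> y < n \<longrightarrow> accurate_query IS x \<alpha>x \<longrightarrow> accurate_query IS y \<alpha>y \<longrightarrow>
     \<bar>\<alpha>x \<bullet> (\<Psi> *\<^sub>v \<alpha>y) - spectral_embedding k u x \<bullet> spectral_embedding k u y\<bar> \<le> \<xi> / n)"

definition scaled_embedding :: "nat list \<Rightarrow> nat \<Rightarrow> nat \<Rightarrow> real" where
  "scaled_embedding IS i a = sqrt (n / length IS) * v a (IS ! i)"

lemma scaled_embedding_mult:
  "scaled_embedding IS i a * scaled_embedding IS j b = n / length IS * (v a (IS ! i) * v b (IS ! j))"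
proof -
  have "scaled_embedding IS i a * scaled_embedding IS j b
      = (sqrt (n / length IS) * sqrt (n / length IS)) * (v a (IS ! i) * v b (IS ! j))"
    unfolding scaled_embedding_def by (simp only: mult_ac)
  then show ?thesis by (simp only: real_sqrt_mult_self) simp
qed

context
  fixes IS :: "nat list"
  assumes IS: "set IS \<subseteq> {..<n}" "k \<le> length IS"
begin

lemma nth_sample_less: "i < length IS \<Longrightarrow> IS ! i < n"
  using IS(1) nth_mem by fastforce

lemma gram_entry_close:
  assumes "accurate_gram IS G" "i < length IS" "j < length IS"
  shows "\<bar>n / length IS * G $$ (i, j) - (\<Sum>a<k. scaled_embedding IS i a * damping a * scaled_embedding IS j a)\<bar>
    \<le> gram_error / length IS"
proof -
  let ?c = "n / length IS" and ?low = "\<Sum>a<k. damping a * v a (IS ! i) * v a (IS ! j)"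
  have "scaled_embedding IS i a * damping a * scaled_embedding IS j a = ?c * (damping a * v a (IS ! i) * v a (IS ! j))" for a
    using scaled_embedding_mult[of IS i a j a] by (simp add: mult_ac)
  then have "?c * G $$ (i, j) - (\<Sum>a<k. scaled_embedding IS i a * damping a * scaled_embedding IS j a)
      = ?c * (G $$ (i, j) - ?low)"
    by (simp add: sum_distrib_left right_diff_distrib)
  moreover have "\<bar>G $$ (i, j) - ?low\<bar> \<le> est_tol 2 + 1 / real n ^ 10"
    using assms collision_low_rank[of "IS ! i" "IS ! j"] nth_sample_less unfolding accurate_gram_def by fastforce
  then have "\<bar>?c * (G $$ (i, j) - ?low)\<bar> \<le> ?c * (est_tol 2 + 1 / real n ^ 10)"
    unfolding abs_mult by (intro mult_mono) auto
  ultimately show ?thesis by (simp add: gram_error_def)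
qed

lemma perturbed_low_rank_sample:
  assumes sample: "isotropic_sample IS" and G: "accurate_gram IS G"
    and eig: "eigensolver eig" "eig ((real n / real (length IS)) \<cdot>\<^sub>m G) = (W, D)"
  shows "perturbed_low_rank (length IS) (\<lambda>l i. W $$ (i, l)) (\<lambda>i j. ((real n / real (length IS)) \<cdot>\<^sub>m G) $$ (i, j))
      (\<lambda>l. D $$ (l, l)) k (scaled_embedding IS) damping gram_tol gram_error min_damping"
    and "D = mat_diag (length IS) (\<lambda>l. D $$ (l, l))"
proof -
  let ?scaled_gram = "(real n / real (length IS)) \<cdot>\<^sub>m G"
  have G_carrier: "G \<in> carrier_mat (length IS) (length IS)" and G_sym: "transpose_mat G = G"
    using G by (auto simp: accurate_gram_def)
  have "G $$ (j, i) = G $$ (i, j)" if "i < length IS" "j < length IS" for i j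
    using arg_cong[OF G_sym, of "\<lambda>M. M $$ (i, j)"] G_carrier that by simp
  then have scaled_gram: "?scaled_gram \<in> carrier_mat (length IS) (length IS)" "transpose_mat ?scaled_gram = ?scaled_gram"
    using G_carrier by (auto intro!: eq_matI)
  note eigenbasis = eigensolver_eigenbasis[OF eig(1) scaled_gram eig(2)]
  show "D = mat_diag (length IS) (\<lambda>l. D $$ (l, l))" by (rule eigenbasis(2))
  interpret sample: orthonormal_eigenbasis "length IS" "\<lambda>l i. W $$ (i, l)" "\<lambda>i j. ?scaled_gram $$ (i, j)" "\<lambda>l. D $$ (l, l)"
    by (rule eigenbasis(1))
  show "perturbed_low_rank (length IS) (\<lambda>l i. W $$ (i, l)) (\<lambda>i j. ?scaled_gram $$ (i, j))
      (\<lambda>l. D $$ (l, l)) k (scaled_embedding IS) damping gram_tol gram_error min_damping"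
  proof
    show "\<bar>(\<Sum>i<length IS. scaled_embedding IS i a * scaled_embedding IS i b) - (if a = b then 1 else 0)\<bar> \<le> gram_tol / k"
      if "a < k" "b < k" for a b
      using sample that unfolding isotropic_sample_def by (simp add: scaled_embedding_mult sum_distrib_left)
    show "\<bar>?scaled_gram $$ (i, j) - (\<Sum>a<k. scaled_embedding IS i a * damping a * scaled_embedding IS j a)\<bar> \<le> gram_error / length IS"
      if "i < length IS" "j < length IS" for i j
      using gram_entry_close[OF G that] that G_carrier by simp
  qed (use IS damping_ge min_damping_pos gram_tol_pos gram_tol_le errors_nonneg gram_error_le in auto)
qed

lemma query_residual_le:
  assumes x: "x < n" and \<alpha>: "accurate_query IS x \<alpha>"
  shows "l2norm (length IS) (\<lambda>i. sqrt (n / length IS) * \<alpha> $ i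
    - mul_vec k (scaled_embedding IS) (\<lambda>a. damping a * v a x) i) \<le> query_error"
proof -
  let ?s = "length IS"
  have s: "0 < real ?s" using IS(2) k_ge_2 by (simp del: length_greater_0_conv)
  have "\<bar>sqrt (n / ?s) * \<alpha> $ i - mul_vec k (scaled_embedding IS) (\<lambda>a. damping a * v a x) i\<bar>
      \<le> sqrt (n / ?s) * (est_tol 1 + 1 / real n ^ 10)" if i: "i < ?s" for i
  proof -
    let ?low = "\<Sum>a<k. damping a * v a x * v a (IS ! i)"
    have "mul_vec k (scaled_embedding IS) (\<lambda>a. damping a * v a x) i = sqrt (n / ?s) * ?low"
      by (simp add: mul_vec_def scaled_embedding_def sum_distrib_left mult_ac)
    then have "\<bar>sqrt (n / ?s) * \<alpha> $ i - mul_vec k (scaled_embedding IS) (\<lambda>a. damping a * v a x) i\<bar>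
        = sqrt (n / ?s) * \<bar>\<alpha> $ i - ?low\<bar>"
      by (simp add: right_diff_distrib[symmetric] abs_mult)
    moreover have "\<bar>\<alpha> $ i - ?low\<bar> \<le> est_tol 1 + 1 / real n ^ 10"
      using \<alpha> i collision_low_rank[OF x nth_sample_less[OF i]] unfolding accurate_query_def by fastforce
    ultimately show ?thesis by (simp add: mult_left_mono)
  qed
  then have "l2norm ?s (\<lambda>i. sqrt (n / ?s) * \<alpha> $ i - mul_vec k (scaled_embedding IS) (\<lambda>a. damping a * v a x) i)
      \<le> sqrt ?s * (sqrt (n / ?s) * (est_tol 1 + 1 / real n ^ 10))"
    using est_tol_pos[of 1] by (intro l2norm_le_const) auto
  also have "\<dots> = query_error" using s by (simp add: query_error_def real_sqrt_divide)
  finally show ?thesis .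
qed

lemma dot_spectral_embedding:
  "spectral_embedding k u x \<bullet> spectral_embedding k u y = dot k (\<lambda>a. v a x) (\<lambda>a. v a y)"
  by (simp add: spectral_embedding_def scalar_prod_def dot_def atLeast0LessThan)

lemma truncated_inverse_square_oracle_accurate:
  assumes low_rank: "perturbed_low_rank (length IS) (\<lambda>l i. W $$ (i, l)) G \<sigma> k (scaled_embedding IS) damping
    gram_tol gram_error min_damping"
  defines "Wk \<equiv> mat (length IS) k (\<lambda>(i, j). W $$ (i, j))"
  shows "accurate_oracle IS ((real n / real (length IS)) \<cdot>\<^sub>m (Wk * mat_diag k (\<lambda>l. 1 / (\<sigma> l)\<^sup>2) * transpose_mat Wk))"
  unfolding accurate_oracle_def
proof (intro allI impI)
  let ?s = "length IS" and ?c = "real n / real (length IS)"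
  let ?\<tau> = "(4 * gram_error * embedding_radius + 6 / 5 * query_error) / min_damping"
  interpret L: perturbed_low_rank ?s "\<lambda>l i. W $$ (i, l)" G \<sigma> k "scaled_embedding IS" damping
    gram_tol gram_error min_damping by (rule low_rank)
  fix x y \<alpha>x \<alpha>y
  assume x: "x < n" and y: "y < n" and \<alpha>: "accurate_query IS x \<alpha>x" "accurate_query IS y \<alpha>y"
  define b where "b \<alpha> i = sqrt ?c * \<alpha> $ i" for \<alpha> :: "real vec" and i
  define e where "e \<alpha> x i = b \<alpha> i - L.mulA (\<lambda>a. damping a * v a x) i" for \<alpha> x i
  have oracle_value: "\<alpha>x \<bullet> ((?c \<cdot>\<^sub>m (Wk * mat_diag k (\<lambda>l. 1 / (\<sigma> l)\<^sup>2) * transpose_mat Wk)) *\<^sub>v \<alpha>y)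
      = (\<Sum>l<k. L.coords (b \<alpha>x) l * L.coords (b \<alpha>y) l / (\<sigma> l)\<^sup>2)"
    unfolding Wk_def L.coords_def mul_vec_def b_def
    using \<alpha> by (intro truncated_bilinear_form) (auto simp: accurate_query_def)
  have "\<bar>(\<Sum>l<k. L.coords (b \<alpha>x) l * L.coords (b \<alpha>y) l / (\<sigma> l)\<^sup>2) - dot k (\<lambda>a. v a x) (\<lambda>a. v a y)\<bar>
      \<le> 11 / 10 * gram_tol * embedding_radius\<^sup>2 + 21 / 10 * embedding_radius * ?\<tau> + ?\<tau>\<^sup>2"
  proof (rule L.truncated_inverse_square_accurate[where ex = "e \<alpha>x x" and ey = "e \<alpha>y y" and \<gamma> = query_error])
    show "l2norm ?s (e \<alpha>x x) \<le> query_error" "l2norm ?s (e \<alpha>y y) \<le> query_error"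
      unfolding e_def b_def by (intro query_residual_le x y \<alpha>)+
  qed (simp_all add: e_def embedding_norm_le x y)
  then show "\<bar>\<alpha>x \<bullet> ((?c \<cdot>\<^sub>m (Wk * mat_diag k (\<lambda>l. 1 / (\<sigma> l)\<^sup>2) * transpose_mat Wk)) *\<^sub>v \<alpha>y)
      - spectral_embedding k u x \<bullet> spectral_embedding k u y\<bar> \<le> \<xi> / n"
    unfolding oracle_value dot_spectral_embedding using error_budget by (rule order_trans)
qed

theorem oracle_output_accurate:
  assumes sample: "isotropic_sample IS" and G: "accurate_gram IS G" and eig: "eigensolver eig"
  shows "\<exists>\<Psi>. oracle_output eig n k (length IS) G = Some \<Psi> \<and> \<Psi> \<in> carrier_mat (length IS) (length IS) \<and>
    accurate_oracle IS \<Psi>"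
proof -
  let ?s = "length IS" and ?c = "real n / real (length IS)"
  obtain W D where eig_G: "eig (?c \<cdot>\<^sub>m G) = (W, D)" by fastforce
  let ?\<sigma> = "\<lambda>l. D $$ (l, l)"
  define Wk where "Wk = mat ?s k (\<lambda>(i, j). W $$ (i, j))"
  define \<Psi> where "\<Psi> = ?c \<cdot>\<^sub>m (Wk * mat_diag k (\<lambda>l. 1 / (?\<sigma> l)\<^sup>2) * transpose_mat Wk)"
  note low_rank = perturbed_low_rank_sample[OF sample G eig eig_G]
  have "oracle_output eig n k ?s G = Some \<Psi>"
    unfolding \<Psi>_def Wk_def
  proof (rule oracle_output_eq[where eig = eig and G = G and n = n, OF eig_G low_rank(2) IS(2)])
    show "?\<sigma> l \<noteq> 0" if "l < k" for l
      using perturbed_low_rank.large_eigenvalue_ge[OF low_rank(1) that] min_damping_pos by linarith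
  qed
  moreover have "\<Psi> \<in> carrier_mat ?s ?s"
    unfolding \<Psi>_def by (subst mat_diag_mult_right[of Wk ?s]) (auto simp: Wk_def)
  moreover have "accurate_oracle IS \<Psi>"
    unfolding \<Psi>_def Wk_def by (rule truncated_inverse_square_oracle_accurate[OF low_rank(1)])
  ultimately show ?thesis by blast
qed

end

end

section \<open>Success probability\<close>

text \<open>The factor \<open>1 + 2 * cM * sqrt (6 * \<beta>)\<close> bounds the contribution of \<open>M\<close> to the variance of a
  collision estimate.\<close>

definition sufficient_constants :: "real \<Rightarrow> real \<Rightarrow> hidden \<Rightarrow> bool" where
  "sufficient_constants \<beta> cM H \<longleftrightarrow>
     1668600 * \<beta> ^ 4 \<le> c_s H \<and>
     7000000 * (1 + 2 * cM * sqrt (6 * \<beta>)) * \<beta> ^ 3 \<le> c_init H \<and>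
     7000000 * (1 + 2 * cM * sqrt (6 * \<beta>)) * \<beta> ^ 3 \<le> c_query H \<and>
     8 * (140 + 2 * c_s H) \<le> c_reps H"

lemma result_est_colli_prob:
  "result (est_colli_prob cw n E reps R t M IS) =
    map_pmf (\<lambda>Gs. mat (length IS) (length IS) (\<lambda>p. median (map (\<lambda>G. G $$ p) Gs)))
      (replicate_pmf reps (map_pmf (\<lambda>rows. mat (length IS) (length IS) (\<lambda>(i, j). rows ! min i j ! (max i j - min i j)))
        (result (for_each (\<lambda>i. for_each (\<lambda>j. est_rw_dot cw n E R t M (IS ! i) (IS ! j)) [i..<length IS]) [0..<length IS]))))"
  by (simp add: est_colli_prob_def Let_def result_for_each_const bind_return_pmf map_pmf_def case_prod_unfold)

lemma result_query_dot:
  "result (query_dot H cw n E k \<phi> \<epsilon> \<xi> IS \<Psi> M x y) =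
    map_pmf (\<lambda>rows. vec (length IS) (\<lambda>i. median (map (\<lambda>r. fst (r ! i)) rows))
        \<bullet> (\<Psi> *\<^sub>v vec (length IS) (\<lambda>i. median (map (\<lambda>r. snd (r ! i)) rows))))
      (replicate_pmf (repetitions H n) (result (for_each (\<lambda>i. do {
          a \<leftarrow> est_rw_dot cw n E (R_query H n k \<phi> \<epsilon> \<xi> M) (walk_length n \<phi>) M x (IS ! i);
          b \<leftarrow> est_rw_dot cw n E (R_query H n k \<phi> \<epsilon> \<xi> M) (walk_length n \<phi>) M y (IS ! i);
          ret (a, b) }) [0..<length IS])))"
  by (simp add: query_dot_def Let_def result_for_each_const bind_return_pmf map_pmf_def)

lemma result_init_oracle:
  "result (init_oracle H cw ce eig n E k \<phi> \<epsilon> \<xi> M) =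
     bind_pmf (replicate_pmf (sample_size H n k \<phi> \<epsilon> \<xi>) (pmf_of_set {..<n})) (\<lambda>IS.
       map_pmf (\<lambda>G. (IS, oracle_output eig n k (sample_size H n k \<phi> \<epsilon> \<xi>) G))
         (result (est_colli_prob cw n E (repetitions H n) (R_init H n k \<phi> \<epsilon> \<xi> M) (walk_length n \<phi>) M IS)))"
  by (simp add: init_oracle_def Let_def oracle_output_def case_prod_unfold result_for_each_const bind_return_pmf map_pmf_def)

locale oracle_setup = oracle_precision +
  fixes H :: hidden and cM :: real
  assumes constants: "sufficient_constants \<beta> cM H"
begin

abbreviation s :: nat where
  "s \<equiv> sample_size H n k \<phi> \<epsilon> \<xi>"

abbreviation reps :: nat where
  "reps \<equiv> repetitions H n"

definition feasible :: "nat \<Rightarrow> bool" where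
  "feasible M \<longleftrightarrow> 1 \<le> M \<and> real M \<le> cM * (real n powr (1/2 - 20 * \<epsilon> / \<phi>\<^sup>2) / real k)"

definition walk_budget :: "real \<Rightarrow> real \<Rightarrow> nat \<Rightarrow> nat \<Rightarrow> real" where
  "walk_budget c r i M = c * (real n powr (1 + r * \<epsilon> / \<phi>\<^sup>2) / real M * (real k ^ i / \<xi>\<^sup>2))"

lemma R_init_eq: "R_init H n k \<phi> \<epsilon> \<xi> M = walk_budget (c_init H) 920 14 M"
  by (simp add: R_init_def walk_budget_def)

lemma R_query_eq: "R_query H n k \<phi> \<epsilon> \<xi> M = walk_budget (c_query H) 440 6 M"
  by (simp add: R_query_def walk_budget_def)

lemma walk_budget_mult: "0 < M \<Longrightarrow> walk_budget c r i M * M = c * (n * \<nu> r * (real k ^ i / \<xi>\<^sup>2))"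
  using n_ge_4 by (simp add: walk_budget_def powr_add \<nu>_def)

lemma walk_budget_pos: "0 < c \<Longrightarrow> 0 < M \<Longrightarrow> 0 < walk_budget c r i M"
  using n_ge_4 k_ge_2 \<xi>_pos by (simp add: walk_budget_def)

lemma feasible_bound:
  assumes "feasible M"
  shows "real M * k \<le> cM * (sqrt n * \<nu> (- 20))" and feasible_imp_cM_pos: "0 < cM"
proof -
  have "real n powr (1/2 - 20 * \<epsilon> / \<phi>\<^sup>2) = real n powr (1/2) * \<nu> (- 20)"
    unfolding \<nu>_def powr_add[symmetric] by simp
  then have "real M \<le> cM * (sqrt n * \<nu> (- 20)) / k"
    using assms by (simp add: feasible_def powr_half_sqrt)
  moreover have k: "0 < real k" using k_ge_2 by simp
  ultimately show bound: "real M * k \<le> cM * (sqrt n * \<nu> (- 20))" by (simp add: pos_le_divide_eq)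
  have "0 < real M * k" using assms k by (simp add: feasible_def)
  then have "0 < cM * (sqrt n * \<nu> (- 20))" using bound by linarith
  moreover have "0 < sqrt n * \<nu> (- 20)" using \<nu>_pos n_ge_4 by simp
  ultimately show "0 < cM" using zero_less_mult_pos2 by blast
qed

lemma variance_factor_le:
  assumes "feasible M"
  shows "1 + 2 * (M * sqrt (2 * coherence / n)) \<le> (1 + 2 * cM * sqrt (6 * \<beta>)) * \<nu> 10"
proof -
  have n: "0 < real n" using n_ge_4 by simp
  have "2 * coherence / n = 6 * \<beta> * (k * \<nu> 30 / sqrt n)\<^sup>2"
    using \<nu>_add[of 30 30] n by (simp add: coherence_def power2_eq_square)
  then have "sqrt (2 * coherence / n) = sqrt (6 * \<beta>) * (k * \<nu> 30 / sqrt n)"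
    using \<nu>_pos[of 30] by (simp add: real_sqrt_mult)
  then have "M * sqrt (2 * coherence / n) = (M * k) * (sqrt (6 * \<beta>) * \<nu> 30 / sqrt n)" by simp
  also have "\<dots> \<le> (cM * (sqrt n * \<nu> (- 20))) * (sqrt (6 * \<beta>) * \<nu> 30 / sqrt n)"
    using feasible_bound[OF assms] \<nu>_pos[of 30] \<beta>_ge_1 by (intro mult_right_mono) auto
  also have "\<dots> = cM * sqrt (6 * \<beta>) * (\<nu> (- 20) * \<nu> 30)" using n by simp
  also have "\<nu> (- 20) * \<nu> 30 = \<nu> 10" using \<nu>_add[of "- 20" 30] by simp
  finally have "M * sqrt (2 * coherence / n) \<le> cM * sqrt (6 * \<beta>) * \<nu> 10" .
  moreover have "1 \<le> \<nu> 10" by (rule \<nu>_ge_1) simp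
  ultimately show ?thesis by (simp add: distrib_right)
qed

lemma budget_constant_ge_1:
  assumes "feasible M"
  shows "1 \<le> 7000000 * (1 + 2 * cM * sqrt (6 * \<beta>)) * \<beta> ^ 3"
proof -
  have "1 * 1 \<le> 7000000 * (1 + 2 * cM * sqrt (6 * \<beta>)) * \<beta> ^ 3"
    using feasible_imp_cM_pos[OF assms] \<beta>_ge_1 by (intro mult_mono) auto
  then show ?thesis by simp
qed

lemma \<nu>_power: "\<nu> r ^ m = \<nu> (m * r)"
  by (induction m) (auto simp: \<nu>_add[symmetric] distrib_right)

lemma coherence_power_le:
  assumes "j \<le> 2" "2 * (j + 1) \<le> i" "60 * (real j + 1) + 98 \<le> r"
  shows "240000 * coherence ^ (j + 1) * \<nu> 10 \<le> 7000000 * \<beta> ^ 3 * \<nu> r * real k ^ i * min_damping\<^sup>2"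
proof -
  let ?m = "j + 1"
  have "coherence ^ ?m = 3 ^ ?m * \<beta> ^ ?m * real k ^ (2 * ?m) * \<nu> (60 * (real j + 1))"
    unfolding coherence_def power_mult_distrib power_mult \<nu>_power by (simp add: add.commute mult.commute)
  also have "\<dots> \<le> 3 ^ 3 * \<beta> ^ 3 * real k ^ i * \<nu> (r - 98)"
    using assms \<beta>_ge_1 k_ge_2 \<nu>_pos[of "60 * (real j + 1)"]
    by (intro mult_mono \<nu>_mono power_increasing) auto
  finally have "240000 * coherence ^ ?m * \<nu> 10 \<le> 240000 * (3 ^ 3 * \<beta> ^ 3 * real k ^ i * \<nu> (r - 98)) * \<nu> 10"
    using \<nu>_pos[of 10] by (intro mult_right_mono mult_left_mono) auto
  also have "\<dots> = 6480000 * (\<beta> ^ 3 * real k ^ i * (\<nu> (r - 98) * \<nu> 10))" by simp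
  also have "\<nu> (r - 98) * \<nu> 10 = \<nu> r * (\<nu> (- 44))\<^sup>2" by (simp add: power2_eq_square flip: \<nu>_add)
  also have "6480000 * (\<beta> ^ 3 * real k ^ i * (\<nu> r * (\<nu> (- 44))\<^sup>2))
      \<le> 6860700 * (\<beta> ^ 3 * real k ^ i * (\<nu> r * (\<nu> (- 44))\<^sup>2))"
    using \<beta>_ge_1 \<nu>_pos[of r] by (intro mult_right_mono) auto
  also have "\<dots> = 7000000 * \<beta> ^ 3 * \<nu> r * real k ^ i * min_damping\<^sup>2"
    by (simp add: min_damping_def power2_eq_square)
  finally show ?thesis .
qed

lemma est_deviation:
  assumes x: "x < n" and y: "y < n" and M: "feasible M"
    and exponents: "j \<le> 2" "2 * (j + 1) \<le> i" "60 * (real j + 1) + 98 \<le> r"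
    and c: "7000000 * (1 + 2 * cM * sqrt (6 * \<beta>)) * \<beta> ^ 3 \<le> c"
  shows "measure_pmf.prob (result (est_rw_dot cw n E (walk_budget c r i M) t M x y))
    {z. \<not> \<bar>z - collision x y\<bar> \<le> est_tol j} \<le> 1 / 4"
  unfolding result_est_rw_dot collision_def
proof (rule batch_mean_deviation[where \<Phi> = "2 * coherence / n"])
  define V where "V = 1 + 2 * cM * sqrt (6 * \<beta>)"
  have n: "0 < real n" and M_pos: "0 < M" using n_ge_4 M by (auto simp: feasible_def)
  have V: "0 \<le> V" using feasible_imp_cM_pos[OF M] \<beta>_ge_1 by (simp add: V_def)
  have c_pos: "0 < c" using budget_constant_ge_1[OF M] c by linarith
  show "0 < M" by (rule M_pos)
  show "0 < walk_budget c r i M" by (rule walk_budget_pos[OF c_pos M_pos])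
  have "12 * (2 * coherence / n * (1 + 2 * (M * sqrt (2 * coherence / n)))) \<le> 12 * (2 * coherence / n * (V * \<nu> 10))"
    unfolding V_def using variance_factor_le[OF M] coherence_pos by (intro mult_left_mono) auto
  also have "\<dots> = V * (240000 * coherence ^ (j + 1) * \<nu> 10) / (10000 * n * coherence ^ j)"
    using n coherence_pos by (simp add: field_simps)
  also have "\<dots> \<le> V * (7000000 * \<beta> ^ 3 * \<nu> r * real k ^ i * min_damping\<^sup>2) / (10000 * n * coherence ^ j)"
    using coherence_power_le[OF exponents] V n coherence_pos by (intro divide_right_mono mult_left_mono) auto
  also have "\<dots> = (7000000 * V * \<beta> ^ 3) * (\<nu> r * real k ^ i * min_damping\<^sup>2) / (10000 * n * coherence ^ j)" by simp
  also have "\<dots> \<le> c * (\<nu> r * real k ^ i * min_damping\<^sup>2) / (10000 * n * coherence ^ j)"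
    using c \<nu>_pos[of r] n coherence_pos unfolding V_def by (intro divide_right_mono mult_right_mono) auto
  also have "\<dots> = walk_budget c r i M * M * (est_tol j)\<^sup>2"
  proof -
    have "(sqrt coherence ^ j)\<^sup>2 = coherence ^ j"
      using coherence_pos by (simp add: power_commuting_commutes power2_eq_square flip: power_mult_distrib)
    then have "(est_tol j)\<^sup>2 = \<xi>\<^sup>2 * min_damping\<^sup>2 / (10000 * (real n)\<^sup>2 * coherence ^ j)"
      by (simp add: est_tol_def power_divide power_mult_distrib)
    then show ?thesis unfolding walk_budget_mult[OF M_pos] using n \<xi>_pos coherence_pos
      by (simp add: field_simps power2_eq_square)
  qed
  finally show "12 * (2 * coherence / n * (1 + 2 * (M * sqrt (2 * coherence / n)))) \<le> walk_budget c r i M * M * (est_tol j)\<^sup>2" .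
qed (intro set_walk walk_norm_sq_le est_tol_pos x y)+

lemma est_init_deviation:
  assumes "x < n" "y < n" "feasible M"
  shows "measure_pmf.prob (result (est_rw_dot cw n E (R_init H n k \<phi> \<epsilon> \<xi> M) t M x y))
    {z. \<not> \<bar>z - collision x y\<bar> \<le> est_tol 2} \<le> 1 / 4"
  unfolding R_init_eq using constants by (intro est_deviation assms) (simp_all add: sufficient_constants_def)

lemma est_query_deviation:
  assumes "x < n" "y < n" "feasible M"
  shows "measure_pmf.prob (result (est_rw_dot cw n E (R_query H n k \<phi> \<epsilon> \<xi> M) t M x y))
    {z. \<not> \<bar>z - collision x y\<bar> \<le> est_tol 1} \<le> 1 / 4"
  unfolding R_query_eq using constants by (intro est_deviation assms) (simp_all add: sufficient_constants_def)

lemma finite_est: "x < n \<Longrightarrow> y < n \<Longrightarrow> 0 < M \<Longrightarrow> finite (set_pmf (result (est_rw_dot cw n E R t M x y)))"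
  unfolding result_est_rw_dot by (simp add: finite_replicate_pmf finite_batch_pmf set_walk)

definition sample_scale :: real where
  "sample_scale = \<nu> 480 * ln n * real k ^ 8 / \<xi>\<^sup>2"

lemma c_s_ge_1: "1 \<le> c_s H"
proof -
  have "1 \<le> \<beta> ^ 4" using \<beta>_ge_1 by simp
  then show ?thesis using constants by (simp add: sufficient_constants_def)
qed

lemma inverse_\<xi>_sq_bounds: "1 \<le> 1 / \<xi>\<^sup>2" "1 / \<xi>\<^sup>2 \<le> real n ^ 10"
proof -
  have "\<xi>\<^sup>2 \<le> 1" using \<xi> \<xi>_pos by (intro power_le_one) auto
  then show "1 \<le> 1 / \<xi>\<^sup>2" using \<xi>_pos by simp
  have "1 / \<xi> \<le> real n ^ 5" using \<xi>(1) \<xi>_pos n_ge_4 by (simp add: field_simps)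
  then have "(1 / \<xi>)\<^sup>2 \<le> (real n ^ 5)\<^sup>2" using \<xi>_pos by (intro power_mono) auto
  then show "1 / \<xi>\<^sup>2 \<le> real n ^ 10" by (simp add: power_divide flip: power_mult)
qed

lemma sample_scale_bounds: "real k ^ 8 \<le> sample_scale" "sample_scale \<le> real n ^ 20"
proof -
  have scale: "sample_scale = \<nu> 480 * ln n * (real k ^ 8 * (1 / \<xi>\<^sup>2))" by (simp add: sample_scale_def)
  have "1 * 1 * (real k ^ 8 * 1) \<le> sample_scale"
    unfolding scale using \<nu>_ge_1[of 480] ln_n_ge_1 inverse_\<xi>_sq_bounds(1) by (intro mult_mono) auto
  then show "real k ^ 8 \<le> sample_scale" by simp
  have n: "1 \<le> real n" using n_ge_4 by simp
  have "\<nu> 480 \<le> n" using \<nu>_le_sqrt[of 480] n by (simp add: real_le_lsqrt self_le_power order_trans[of _ "sqrt n"])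
  moreover have "ln n \<le> n" using ln_bound[of "real n"] n by simp
  ultimately have "sample_scale \<le> real n * n * (real n ^ 8 * real n ^ 10)"
    unfolding scale using inverse_\<xi>_sq_bounds(2) ln_n_ge_1 \<nu>_pos[of 480] two_k_le_n n
    by (intro mult_mono power_mono) auto
  also have "\<dots> = real n ^ 20" by (simp add: eval_nat_numeral)
  finally show "sample_scale \<le> real n ^ 20" .
qed

lemma sample_scale_ge_1: "1 \<le> sample_scale"
proof -
  have "1 \<le> real k ^ 8" using k_ge_2 by (intro one_le_power) simp
  then show ?thesis using sample_scale_bounds(1) by linarith
qed

lemma s_bounds: "c_s H * sample_scale \<le> s" "s \<le> (c_s H + 1) * sample_scale"
proof -
  have "0 \<le> c_s H * sample_scale" using c_s_ge_1 sample_scale_ge_1 by simp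
  then have "c_s H * sample_scale \<le> s" "s \<le> c_s H * sample_scale + 1"
    unfolding sample_size_def \<nu>_def[symmetric] sample_scale_def[symmetric] by linarith+
  then show "c_s H * sample_scale \<le> s" "s \<le> (c_s H + 1) * sample_scale"
    using sample_scale_ge_1 by (auto simp: distrib_right)
qed

lemma k_le_s: "k \<le> s"
proof -
  have "real k \<le> real k ^ 8" using k_ge_2 by (intro self_le_power) auto
  also have "\<dots> \<le> 1 * sample_scale" using sample_scale_bounds by simp
  also have "\<dots> \<le> c_s H * sample_scale" using c_s_ge_1 sample_scale_ge_1 by (intro mult_right_mono) auto
  finally show ?thesis using s_bounds by linarith
qed

lemma s_pos: "0 < s"
  using k_le_s k_ge_2 by linarith

lemma reps_ge: "8 * (140 + 2 * c_s H) * ln n \<le> reps"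
proof -
  have "8 * (140 + 2 * c_s H) * ln n \<le> c_reps H * ln n"
    using constants ln_n_ge_1 by (intro mult_right_mono) (auto simp: sufficient_constants_def)
  also have "\<dots> \<le> reps" unfolding repetitions_def by linarith
  finally show ?thesis .
qed

lemma reps_pos: "0 < reps"
proof -
  have "0 < 8 * (140 + 2 * c_s H) * ln n" using c_s_ge_1 ln_n_ge_1 by simp
  then show ?thesis using reps_ge by linarith
qed

lemma s_sq_exp_reps_le: "(real s)\<^sup>2 * exp (- real reps / 8) \<le> 1 / real n ^ 100"
proof -
  have power: "real n ^ m = exp (m * ln n)" for m using n_ge_4 by (simp add: exp_of_nat_mult)
  have "real s \<le> (c_s H + 1) * real n ^ 20"
    using s_bounds(2) sample_scale_bounds(2) c_s_ge_1 by (elim order_trans) (intro mult_left_mono, auto)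
  also have "c_s H + 1 \<le> exp (c_s H * ln n)"
  proof -
    have "c_s H * 1 \<le> c_s H * ln n" using c_s_ge_1 ln_n_ge_1 by (intro mult_left_mono) auto
    then show ?thesis using exp_ge_add_one_self[of "c_s H * ln n"] by linarith
  qed
  finally have "real s \<le> exp ((c_s H + 20) * ln n)"
    unfolding power by (simp add: exp_add[symmetric] distrib_right mult_right_mono)
  then have "(real s)\<^sup>2 \<le> (exp ((c_s H + 20) * ln n))\<^sup>2" by (intro power_mono) auto
  also have "\<dots> = exp ((2 * c_s H + 40) * ln n)" by (simp add: exp_double[symmetric] algebra_simps)
  finally have "(real s)\<^sup>2 * exp (- real reps / 8) \<le> exp ((2 * c_s H + 40) * ln n) * exp (- ((140 + 2 * c_s H) * ln n))"
    using reps_ge by (intro mult_mono) (auto simp: algebra_simps)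
  also have "\<dots> = exp (- (100 * ln n))" by (simp add: exp_add[symmetric] algebra_simps)
  also have "\<dots> = 1 / real n ^ 100" unfolding power exp_minus by (simp add: inverse_eq_divide)
  finally show ?thesis .
qed

lemma sample_exponent_ge:
  "103 * ln n \<le> s * (\<xi>\<^sup>2 / (200 * coherence ^ 4))"
proof -
  have "\<nu> 60 ^ 4 = \<nu> 240" by (simp add: power4_eq_xxxx flip: \<nu>_add)
  then have coherence4: "coherence ^ 4 = 81 * \<beta> ^ 4 * real k ^ 8 * \<nu> 240"
    by (simp add: coherence_def power_mult_distrib flip: power_mult)
  have "103 * ln n \<le> 103 * ln n * \<nu> 240" using ln_n_ge_1 \<nu>_ge_1[of 240] by (simp add: mult_le_cancel_left1)
  also have "\<dots> = (1668600 * \<beta> ^ 4 * sample_scale) * (\<xi>\<^sup>2 / (200 * coherence ^ 4))"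
  proof -
    have "\<nu> 480 = \<nu> 240 * \<nu> 240" using \<nu>_add[of 240 240] by simp
    moreover have "0 < \<beta>" "\<nu> 240 \<noteq> 0" "0 < real k" using \<beta>_ge_1 \<nu>_pos[of 240] k_ge_2 by auto
    ultimately show ?thesis unfolding coherence4 sample_scale_def using \<xi>_pos by (simp add: field_simps)
  qed
  also have "\<dots> \<le> s * (\<xi>\<^sup>2 / (200 * coherence ^ 4))"
  proof (rule mult_right_mono)
    have "1668600 * \<beta> ^ 4 * sample_scale \<le> c_s H * sample_scale"
      using constants sample_scale_ge_1 by (intro mult_right_mono) (auto simp: sufficient_constants_def)
    then show "1668600 * \<beta> ^ 4 * sample_scale \<le> s" using s_bounds by linarith
  qed (use coherence_pos in simp)
  finally show ?thesis .
qed

lemma eigenvector_product_bound: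
  assumes "a < k" "b < k" "x < n"
  shows "\<bar>v a x * v b x\<bar> \<le> coherence / (k * n)"
proof -
  have "\<bar>v a x\<bar> * \<bar>v b x\<bar> \<le> ((v a x)\<^sup>2 + (v b x)\<^sup>2) / 2"
    using sum_squares_bound[of "\<bar>v a x\<bar>" "\<bar>v b x\<bar>"] by simp
  also have "\<dots> \<le> coherence / (k * n)"
    using add_mono[OF eigenvector_entry_sq_le[OF assms(1,3)] eigenvector_entry_sq_le[OF assms(2,3)]] by (simp add: mult.commute)
  finally show ?thesis by (simp add: abs_mult)
qed

lemma sample_sum_failure:
  assumes a: "a < k" and b: "b < k"
  defines "\<delta> \<equiv> (if a = b then 1 else 0 :: real)"
  shows "measure_pmf.prob (replicate_pmf s (pmf_of_set {..<n}))
    {IS. s * gram_tol / (n * k) \<le> \<bar>sum_list (map (\<lambda>x. v a x * v b x) IS) - s * (\<delta> / n)\<bar>} \<le> 2 / real n ^ 103"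
proof -
  define r where "r = s * gram_tol / (n * k)"
  have n: "0 < real n" and k: "0 < real k" and s: "0 < real s" using n_ge_4 k_ge_2 s_pos by auto
  have vertices: "{..<n} \<noteq> {}" "finite {..<n}" using n_ge_4 by (auto simp: lessThan_empty_iff)
  have ab_less: "a < n" "b < n" using a b two_k_le_n by auto
  have "measure_pmf.prob (replicate_pmf s (pmf_of_set {..<n}))
      {IS. r \<le> \<bar>sum_list (map (\<lambda>x. v a x * v b x) IS) - s * (\<delta> / n)\<bar>}
      \<le> 2 * exp (- r\<^sup>2 / (2 * real s * (coherence / (k * n))\<^sup>2))"
  proof (rule hoeffding_abs)
    show "expect (pmf_of_set {..<n}) (\<lambda>x. v a x * v b x) = \<delta> / n"
      using vertices orthonormal[OF ab_less] by (simp add: integral_pmf_of_set \<delta>_def dot_def)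
    show "\<bar>v a x * v b x\<bar> \<le> coherence / (k * n)" if "x \<in> set_pmf (pmf_of_set {..<n})" for x
      using that vertices by (intro eigenvector_product_bound a b) simp
  qed (use vertices coherence_pos gram_tol_pos n k s in \<open>simp_all add: r_def\<close>)
  also have "- r\<^sup>2 / (2 * real s * (coherence / (k * n))\<^sup>2) = - (s * (\<xi>\<^sup>2 / (200 * coherence ^ 4)))"
    unfolding r_def gram_tol_def using n k s coherence_pos by (simp add: field_simps eval_nat_numeral)
  also have "2 * exp (- (s * (\<xi>\<^sup>2 / (200 * coherence ^ 4)))) \<le> 2 * exp (- (real 103 * ln n))"
    using sample_exponent_ge by simp
  also have "\<dots> = 2 / real n ^ 103"
    unfolding exp_minus exp_of_nat_mult using n by (simp add: inverse_eq_divide)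
  finally show ?thesis by (simp only: r_def)
qed

lemma sample_pair_failure:
  assumes a: "a < k" and b: "b < k"
  defines "\<delta> \<equiv> (if a = b then 1 else 0 :: real)"
  shows "measure_pmf.prob (replicate_pmf s (pmf_of_set {..<n}))
    {IS. \<not> \<bar>real n / length IS * (\<Sum>i<length IS. v a (IS ! i) * v b (IS ! i)) - \<delta>\<bar> \<le> gram_tol / k} \<le> 2 / real n ^ 103"
proof (rule order_trans[OF prob_mono sample_sum_failure[OF a b, folded \<delta>_def]])
  have n: "0 < real n" and s: "0 < real s" using n_ge_4 s_pos by auto
  fix IS assume IS: "IS \<in> set_pmf (replicate_pmf s (pmf_of_set {..<n}))"
    and far: "\<not> \<bar>real n / length IS * (\<Sum>i<length IS. v a (IS ! i) * v b (IS ! i)) - \<delta>\<bar> \<le> gram_tol / k"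
  define S where "S = sum_list (map (\<lambda>x. v a x * v b x) IS)"
  have len: "length IS = s" using IS by (simp add: set_replicate_pmf)
  then have "(\<Sum>i<length IS. v a (IS ! i) * v b (IS ! i)) = S"
    by (simp add: S_def sum_list_sum_nth atLeast0LessThan)
  then have "(s / n) * (gram_tol / k) \<le> (s / n) * \<bar>real n / s * S - \<delta>\<bar>"
    using far len by (intro mult_left_mono) auto
  also have "\<dots> = \<bar>(s / n) * (real n / s * S - \<delta>)\<bar>" using n s by (simp add: abs_mult)
  also have "(s / n) * (real n / s * S - \<delta>) = S - s * (\<delta> / n)" using n s by (simp add: field_simps)
  finally show "s * gram_tol / (n * k) \<le> \<bar>sum_list (map (\<lambda>x. v a x * v b x) IS) - s * (\<delta> / n)\<bar>" by (simp add: S_def)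
qed

lemma sample_failure:
  "measure_pmf.prob (replicate_pmf s (pmf_of_set {..<n})) {IS. \<not> isotropic_sample IS} \<le> 1 / real n ^ 100"
proof -
  have "{IS. \<not> isotropic_sample IS} = {IS. \<not> (\<forall>p\<in>{..<k} \<times> {..<k}.
      \<bar>real n / length IS * (\<Sum>i<length IS. v (fst p) (IS ! i) * v (snd p) (IS ! i))
        - (if fst p = snd p then 1 else 0)\<bar> \<le> gram_tol / k)}"
    by (auto simp: isotropic_sample_def)
  also have "measure_pmf.prob (replicate_pmf s (pmf_of_set {..<n})) \<dots> \<le> card ({..<k} \<times> {..<k}) * (2 / real n ^ 103)"
    by (intro prob_union_bound sample_pair_failure) auto
  also have "\<dots> = 2 * (real k)\<^sup>2 / real n ^ 103" by (simp add: power2_eq_square)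
  also have "\<dots> \<le> real n ^ 3 / real n ^ 103"
  proof (rule divide_right_mono)
    have "(2 * real k)\<^sup>2 \<le> (real n)\<^sup>2" using two_k_le_n by (intro power_mono) auto
    then have "4 * (real k)\<^sup>2 \<le> (real n)\<^sup>2" by (simp add: power_mult_distrib)
    then have "2 * (real k)\<^sup>2 \<le> (real n)\<^sup>2" using zero_le_power2[of "real k"] by linarith
    also have "\<dots> \<le> real n ^ 3" using n_ge_4 by (intro power_increasing) auto
    finally show "2 * (real k)\<^sup>2 \<le> real n ^ 3" .
  qed simp
  also have "\<dots> = 1 / real n ^ 100"
  proof -
    have split: "real n ^ 103 = real n ^ 3 * real n ^ 100" by (simp flip: power_add)
    show ?thesis unfolding split using n_ge_4 by (intro nonzero_divide_mult_cancel_left) simp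
  qed
  finally show ?thesis .
qed

context
  fixes IS :: "nat list" and M :: nat
  assumes len: "length IS = s" and IS: "set IS \<subseteq> {..<n}" and M: "feasible M"
begin

lemma sample_less: "i < s \<Longrightarrow> IS ! i < n"
  using subsetD[OF IS nth_mem, of i] by (simp add: len)

lemma M_pos: "0 < M"
  using M by (simp add: feasible_def)

definition gram_estimate :: "nat \<Rightarrow> real mat pmf" where
  "gram_estimate cw = map_pmf (\<lambda>rows. mat s s (\<lambda>(i, j). rows ! min i j ! (max i j - min i j)))
     (result (for_each (\<lambda>i. for_each (\<lambda>j. est_rw_dot cw n E (R_init H n k \<phi> \<epsilon> \<xi> M) t M (IS ! i) (IS ! j)) [i..<s]) [0..<s]))"

lemma result_est_colli_prob_gram_estimate:
  "result (est_colli_prob cw n E reps (R_init H n k \<phi> \<epsilon> \<xi> M) t M IS)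
    = map_pmf (\<lambda>Gs. mat s s (\<lambda>p. median (map (\<lambda>G. G $$ p) Gs))) (replicate_pmf reps (gram_estimate cw))"
  unfolding result_est_colli_prob len gram_estimate_def ..

lemma finite_gram_estimate: "finite (set_pmf (gram_estimate cw))"
  unfolding gram_estimate_def set_map_pmf using M_pos
  by (intro finite_imageI finite_result_for_each finite_est sample_less) auto

lemma gram_estimate_symmetric:
  "G \<in> set_pmf (gram_estimate cw) \<Longrightarrow> i < s \<Longrightarrow> j < s \<Longrightarrow> G $$ (i, j) = G $$ (j, i)"
  by (auto simp: gram_estimate_def min.commute max.commute)

lemma gram_estimate_entry:
  assumes "i < s" "j < s"
  shows "map_pmf (\<lambda>G. G $$ (i, j)) (gram_estimate cw)
    = result (est_rw_dot cw n E (R_init H n k \<phi> \<epsilon> \<xi> M) t M (IS ! min i j) (IS ! max i j))"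
proof -
  define rows where "rows = result (for_each (\<lambda>i. for_each (\<lambda>j.
    est_rw_dot cw n E (R_init H n k \<phi> \<epsilon> \<xi> M) t M (IS ! i) (IS ! j)) [i..<s]) [0..<s])"
  have "map_pmf (\<lambda>G. G $$ (i, j)) (gram_estimate cw)
      = map_pmf (\<lambda>r. r ! (max i j - min i j)) (map_pmf (\<lambda>rows. rows ! min i j) rows)"
    using assms by (simp add: gram_estimate_def rows_def pmf.map_comp o_def)
  then show ?thesis unfolding rows_def using assms by (simp add: result_for_each_nth)
qed

lemma gram_estimate_deviation:
  assumes "i < s" "j < s"
  shows "measure_pmf.prob (gram_estimate cw) {G. \<not> \<bar>G $$ (i, j) - collision (IS ! i) (IS ! j)\<bar> \<le> est_tol 2} \<le> 1 / 4"
proof -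
  have collision: "collision (IS ! i) (IS ! j) = collision (IS ! min i j) (IS ! max i j)"
    using collision_commute by (cases "i \<le> j") (auto simp: min_def max_def)
  have "measure_pmf.prob (gram_estimate cw) {G. \<not> \<bar>G $$ (i, j) - collision (IS ! i) (IS ! j)\<bar> \<le> est_tol 2}
      = measure_pmf.prob (map_pmf (\<lambda>G. G $$ (i, j)) (gram_estimate cw)) {z. \<not> \<bar>z - collision (IS ! i) (IS ! j)\<bar> \<le> est_tol 2}"
    by (simp add: measure_map_pmf vimage_def)
  also have "\<dots> \<le> 1 / 4"
    unfolding gram_estimate_entry[OF assms] collision using assms by (intro est_init_deviation sample_less M) auto
  finally show ?thesis .
qed

lemma colli_failure:
  "measure_pmf.prob (result (est_colli_prob cw n E reps (R_init H n k \<phi> \<epsilon> \<xi> M) t M IS)) {G. \<not> accurate_gram IS G}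
    \<le> 1 / real n ^ 100"
proof -
  let ?I = "{..<s} \<times> {..<s}" and ?Gs = "replicate_pmf reps (gram_estimate cw)"
  let ?median = "\<lambda>Gs. mat s s (\<lambda>p. median (map (\<lambda>G. G $$ p) Gs))"
  let ?close = "\<lambda>p Gs. \<bar>median (map (\<lambda>G. G $$ p) Gs) - collision (IS ! fst p) (IS ! snd p)\<bar> \<le> est_tol 2"
  have "measure_pmf.prob (result (est_colli_prob cw n E reps (R_init H n k \<phi> \<epsilon> \<xi> M) t M IS)) {G. \<not> accurate_gram IS G}
      = measure_pmf.prob ?Gs {Gs. \<not> accurate_gram IS (?median Gs)}"
    unfolding result_est_colli_prob_gram_estimate by (simp add: measure_map_pmf vimage_def)
  also have "\<dots> \<le> measure_pmf.prob ?Gs {Gs. \<not> (\<forall>p\<in>?I. ?close p Gs)}"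
  proof (rule prob_mono, erule contrapos_nn)
    fix Gs assume Gs: "Gs \<in> set_pmf ?Gs" and close: "\<forall>p\<in>?I. ?close p Gs"
    have "map (\<lambda>G. G $$ (j, i)) Gs = map (\<lambda>G. G $$ (i, j)) Gs" if "i < s" "j < s" for i j
      using Gs that by (intro map_cong refl gram_estimate_symmetric) (auto simp: set_replicate_pmf)
    then have "transpose_mat (?median Gs) = ?median Gs" by (intro eq_matI) (auto simp del: map_eq_conv)
    then show "accurate_gram IS (?median Gs)" using close by (auto simp: accurate_gram_def len)
  qed
  also have "\<dots> \<le> card ?I * exp (- real reps / 8)"
  proof (rule median_amplification[OF finite_gram_estimate reps_pos])
    show "measure_pmf.prob (gram_estimate cw) {G. \<not> \<bar>G $$ p - collision (IS ! fst p) (IS ! snd p)\<bar> \<le> est_tol 2} \<le> 1 / 4"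
      if "p \<in> ?I" for p
      using gram_estimate_deviation[of "fst p" "snd p" cw] that by auto
  qed simp
  also have "\<dots> = (real s)\<^sup>2 * exp (- real reps / 8)" by (simp add: power2_eq_square)
  also have "\<dots> \<le> 1 / real n ^ 100" by (rule s_sq_exp_reps_le)
  finally show ?thesis .
qed

definition query_estimates :: "nat \<Rightarrow> nat \<Rightarrow> nat \<Rightarrow> (real \<times> real) list pmf" where
  "query_estimates cw x y = result (for_each (\<lambda>i. do {
      a \<leftarrow> est_rw_dot cw n E (R_query H n k \<phi> \<epsilon> \<xi> M) t M x (IS ! i);
      b \<leftarrow> est_rw_dot cw n E (R_query H n k \<phi> \<epsilon> \<xi> M) t M y (IS ! i);
      ret (a, b) }) [0..<s])"

lemma finite_query_estimates: "x < n \<Longrightarrow> y < n \<Longrightarrow> finite (set_pmf (query_estimates cw x y))"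
  unfolding query_estimates_def using sample_less M_pos by (intro finite_result_for_each) (auto simp: finite_est)

lemma query_estimates_marginals:
  assumes "i < s"
  shows "map_pmf (\<lambda>r. fst (r ! i)) (query_estimates cw x y) = result (est_rw_dot cw n E (R_query H n k \<phi> \<epsilon> \<xi> M) t M x (IS ! i))"
    and "map_pmf (\<lambda>r. snd (r ! i)) (query_estimates cw x y) = result (est_rw_dot cw n E (R_query H n k \<phi> \<epsilon> \<xi> M) t M y (IS ! i))"
proof -
  let ?est = "\<lambda>x. result (est_rw_dot cw n E (R_query H n k \<phi> \<epsilon> \<xi> M) t M x (IS ! i))"
  have "map_pmf (\<lambda>r. proj (r ! i)) (query_estimates cw x y)
      = map_pmf proj (bind_pmf (?est x) (\<lambda>a. bind_pmf (?est y) (\<lambda>b. return_pmf (a, b))))"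
    for proj :: "real \<times> real \<Rightarrow> real"
  proof -
    have "map_pmf (\<lambda>r. proj (r ! i)) (query_estimates cw x y) = map_pmf proj (map_pmf (\<lambda>r. r ! i) (query_estimates cw x y))"
      by (simp add: pmf.map_comp o_def)
    then show ?thesis unfolding query_estimates_def using assms by (simp add: result_for_each_nth)
  qed
  from this[of fst] this[of snd]
  show "map_pmf (\<lambda>r. fst (r ! i)) (query_estimates cw x y) = ?est x"
    and "map_pmf (\<lambda>r. snd (r ! i)) (query_estimates cw x y) = ?est y"
    by (simp_all add: map_bind_pmf bind_return_pmf')
qed

lemma median_query_failure:
  assumes z: "z < n" and fin: "finite (set_pmf Q)"
    and Q: "\<And>i. i < s \<Longrightarrow> map_pmf (\<lambda>r. proj (r ! i)) Q = result (est_rw_dot cw n E (R_query H n k \<phi> \<epsilon> \<xi> M) t M z (IS ! i))"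
  shows "measure_pmf.prob (replicate_pmf reps Q)
    {rows. \<not> accurate_query IS z (vec s (\<lambda>i. median (map (\<lambda>r. proj (r ! i)) rows)))} \<le> 1 / real n ^ 100"
proof -
  have deviation: "measure_pmf.prob Q {r. \<not> \<bar>proj (r ! i) - collision z (IS ! i)\<bar> \<le> est_tol 1} \<le> 1 / 4" if "i \<in> {..<s}" for i
  proof -
    have "measure_pmf.prob Q {r. \<not> \<bar>proj (r ! i) - collision z (IS ! i)\<bar> \<le> est_tol 1}
        = measure_pmf.prob (map_pmf (\<lambda>r. proj (r ! i)) Q) {e. \<not> \<bar>e - collision z (IS ! i)\<bar> \<le> est_tol 1}"
      by (simp add: measure_map_pmf vimage_def)
    also have "\<dots> \<le> 1 / 4" using that by (simp only: Q lessThan_iff) (intro est_query_deviation z M sample_less)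
    finally show ?thesis .
  qed
  have "measure_pmf.prob (replicate_pmf reps Q)
        {rows. \<not> accurate_query IS z (vec s (\<lambda>i. median (map (\<lambda>r. proj (r ! i)) rows)))}
      = measure_pmf.prob (replicate_pmf reps Q)
        {rows. \<not> (\<forall>i\<in>{..<s}. \<bar>median (map (\<lambda>r. proj (r ! i)) rows) - collision z (IS ! i)\<bar> \<le> est_tol 1)}"
    by (simp add: accurate_query_def len Ball_def)
  also have "\<dots> \<le> card {..<s} * exp (- real reps / 8)"
    by (rule median_amplification[OF fin reps_pos _ deviation]) auto
  also have "\<dots> \<le> (real s)\<^sup>2 * exp (- real reps / 8)"
    using s_pos by (intro mult_right_mono) (auto intro: self_le_power)
  finally show ?thesis using s_sq_exp_reps_le by linarith
qed

lemma query_dot_success: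
  assumes \<Psi>: "accurate_oracle IS \<Psi>" and x: "x < n" and y: "y < n"
  shows "1 - 6 / real n ^ 100 \<le> measure_pmf.prob (result (query_dot H cw n E k \<phi> \<epsilon> \<xi> IS \<Psi> M x y))
    {z. \<bar>z - spectral_embedding k u x \<bullet> spectral_embedding k u y\<bar> \<le> \<xi> / n}"
proof (rule prob_compl_ge)
  let ?P = "measure_pmf.prob (replicate_pmf reps (query_estimates cw x y))"
  let ?\<alpha> = "\<lambda>proj rows. vec s (\<lambda>i. median (map (\<lambda>r. proj (r ! i)) rows))"
  let ?fail = "\<lambda>z proj. {rows. \<not> accurate_query IS z (?\<alpha> proj rows)}"
  have "measure_pmf.prob (result (query_dot H cw n E k \<phi> \<epsilon> \<xi> IS \<Psi> M x y))
      {z. \<not> \<bar>z - spectral_embedding k u x \<bullet> spectral_embedding k u y\<bar> \<le> \<xi> / n}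
      \<le> ?P (?fail x fst \<union> ?fail y snd)"
    unfolding result_query_dot len query_estimates_def measure_map_pmf
    using \<Psi> x y by (intro measure_pmf.finite_measure_mono) (auto simp: accurate_oracle_def)
  also have "\<dots> \<le> ?P (?fail x fst) + ?P (?fail y snd)" by (rule measure_Un_le) auto
  also have "\<dots> \<le> 1 / real n ^ 100 + 1 / real n ^ 100"
    by (intro add_mono median_query_failure[OF x finite_query_estimates[OF x y] query_estimates_marginals(1)]
        median_query_failure[OF y finite_query_estimates[OF x y] query_estimates_marginals(2)])
  also have "\<dots> \<le> 6 / real n ^ 100" by (simp add: divide_right_mono)
  finally show "measure_pmf.prob (result (query_dot H cw n E k \<phi> \<epsilon> \<xi> IS \<Psi> M x y))
      {z. \<not> \<bar>z - spectral_embedding k u x \<bullet> spectral_embedding k u y\<bar> \<le> \<xi> / n} \<le> 6 / real n ^ 100" .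
qed

end

theorem init_oracle_correct:
  assumes Mi: "feasible Mi" and Mq: "feasible Mq" and eig: "eigensolver eig"
  shows "1 - 2 / real n ^ 100 \<le> measure_pmf.prob (result (init_oracle H cw ce eig n E k \<phi> \<epsilon> \<xi> Mi))
    {(IS, out). \<exists>\<Psi>. out = Some \<Psi> \<and> \<Psi> \<in> carrier_mat s s \<and>
      (\<forall>x<n. \<forall>y<n. 1 - 6 / real n ^ 100 \<le> measure_pmf.prob (result (query_dot H cw n E k \<phi> \<epsilon> \<xi> IS \<Psi> Mq x y))
         {z. \<bar>z - spectral_embedding k u x \<bullet> spectral_embedding k u y\<bar> \<le> \<xi> / n})}"
    (is "_ \<le> measure_pmf.prob _ {(IS, out). ?good IS out}")
proof -
  let ?U = "replicate_pmf s (pmf_of_set {..<n})"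
  let ?colli = "\<lambda>IS. result (est_colli_prob cw n E reps (R_init H n k \<phi> \<epsilon> \<xi> Mi) t Mi IS)"
  let ?out = "\<lambda>IS. map_pmf (\<lambda>G. (IS, oracle_output eig n k s G)) (?colli IS)"
  have vertices: "{..<n} \<noteq> {}" "finite {..<n}" using n_ge_4 by (auto simp: lessThan_empty_iff)
  have sample: "length IS = s" "set IS \<subseteq> {..<n}" if "IS \<in> set_pmf ?U" for IS
    using that vertices by (auto simp: set_replicate_pmf)
  have good: "?good IS (oracle_output eig n k s G)"
    if IS: "IS \<in> set_pmf ?U" and isotropic: "isotropic_sample IS" and G: "accurate_gram IS G" for IS G
  proof -
    have "\<exists>\<Psi>. oracle_output eig n k s G = Some \<Psi> \<and> \<Psi> \<in> carrier_mat s s \<and> accurate_oracle IS \<Psi>"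
      using oracle_output_accurate[OF sample(2)[OF IS] _ isotropic G eig] k_le_s unfolding sample(1)[OF IS] by blast
    then show ?thesis using query_dot_success[OF sample[OF IS] Mq] by blast
  qed
  have "measure_pmf.prob (bind_pmf ?U ?out) {r. \<not> (case r of (IS, out) \<Rightarrow> ?good IS out)} \<le> 1 / real n ^ 100 + 1 / real n ^ 100"
  proof (rule prob_bind_le[where P = isotropic_sample])
    show "finite (set_pmf ?U)" using vertices by (simp add: finite_replicate_pmf)
    show "finite (set_pmf (?out IS))" if "IS \<in> set_pmf ?U" for IS
      unfolding result_est_colli_prob_gram_estimate[OF sample[OF that] Mi] set_map_pmf
      by (intro finite_imageI finite_replicate_pmf finite_gram_estimate sample[OF that] Mi)
    show "measure_pmf.prob ?U {IS. \<not> isotropic_sample IS} \<le> 1 / real n ^ 100" by (rule sample_failure)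
    fix IS assume IS: "IS \<in> set_pmf ?U" and isotropic: "isotropic_sample IS"
    have "measure_pmf.prob (?out IS) {r. \<not> (case r of (IS, out) \<Rightarrow> ?good IS out)}
        = measure_pmf.prob (?colli IS) {G. \<not> ?good IS (oracle_output eig n k s G)}"
      by (simp add: measure_map_pmf vimage_def)
    also have "\<dots> \<le> measure_pmf.prob (?colli IS) {G. \<not> accurate_gram IS G}"
      using good[OF IS isotropic] by (intro prob_mono) blast
    also have "\<dots> \<le> 1 / real n ^ 100" by (rule colli_failure[OF sample[OF IS] Mi])
    finally show "measure_pmf.prob (?out IS) {r. \<not> (case r of (IS, out) \<Rightarrow> ?good IS out)} \<le> 1 / real n ^ 100" .
  qed simp
  then show ?thesis unfolding result_init_oracle by (intro prob_compl_ge) simp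
qed

end

section \<open>Time and space\<close>

definition costs :: "'a comp \<Rightarrow> ('a \<Rightarrow> bool) \<Rightarrow> real \<Rightarrow> real \<Rightarrow> bool" where
  "costs m P T S \<longleftrightarrow> (\<forall>(a, T', S') \<in> set_pmf (run m). P a \<and> real T' \<le> T \<and> real S' \<le> S)"

lemma costs_ret: "P a \<Longrightarrow> 0 \<le> T \<Longrightarrow> 0 \<le> S \<Longrightarrow> costs (ret a) P T S"
  by (simp add: costs_def ret_def)

lemma costs_tick: "0 \<le> S \<Longrightarrow> costs (tick T) (\<lambda>_. True) (real T) S"
  by (simp add: costs_def tick_def)

lemma costs_draw: "0 \<le> S \<Longrightarrow> costs (draw p) (\<lambda>_. True) 1 S"
  by (auto simp: costs_def draw_def)

lemma costs_bind:
  assumes m: "costs m P T S" and f: "\<And>a. P a \<Longrightarrow> costs (f a) Q T' S"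
  shows "costs (bind_comp m f) Q (T + T') S"
proof -
  have "Q b \<and> real (T1 + T2) \<le> T + T' \<and> real (max S1 S2) \<le> S"
    if "(a, T1, S1) \<in> set_pmf (run m)" "(b, T2, S2) \<in> set_pmf (run (f a))" for a b T1 T2 S1 S2
  proof -
    have a: "P a" "real T1 \<le> T" "real S1 \<le> S" using m that(1) by (auto simp: costs_def)
    moreover have "Q b" "real T2 \<le> T'" "real S2 \<le> S" using f[OF a(1)] that(2) by (auto simp: costs_def)
    ultimately show ?thesis by simp
  qed
  then show ?thesis by (fastforce simp: costs_def bind_comp_def)
qed

lemma costs_with_space: "costs m P T S \<Longrightarrow> costs (with_space b m) P T (b + S)"
  by (fastforce simp: costs_def with_space_def)

lemma costs_mono: "costs m P T S \<Longrightarrow> T \<le> T' \<Longrightarrow> S \<le> S' \<Longrightarrow> (\<And>a. P a \<Longrightarrow> Q a) \<Longrightarrow> costs m Q T' S'"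
  unfolding costs_def by fastforce

lemma costs_for_each:
  fixes T :: real
  assumes "\<And>x. x \<in> set xs \<Longrightarrow> costs (f x) (\<lambda>_. True) T S" "0 \<le> S"
  shows "costs (for_each f xs) (\<lambda>ys. length ys = length xs) (length xs * T) S"
  using assms(1)
proof (induction xs)
  case (Cons x xs)
  have "costs (for_each f (x # xs)) (\<lambda>ys. length ys = length (x # xs)) (T + (length xs * T + 0)) S"
    unfolding for_each.simps
  proof (rule costs_bind)
    show "costs (f x) (\<lambda>_. True) T S" using Cons.prems by simp
    show "costs (do { ys \<leftarrow> for_each f xs; ret (y # ys) }) (\<lambda>ys. length ys = length (x # xs)) (length xs * T + 0) S" for y
      using Cons assms(2) by (intro costs_bind[where P = "\<lambda>ys. length ys = length xs"] costs_ret) auto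
  qed
  then show ?case by (simp add: algebra_simps)
qed (simp add: costs_ret assms(2))

lemma costs_accumulate:
  assumes "costs m (\<lambda>_. True) T S" "0 \<le> S"
  shows "costs (accumulate B m acc) (\<lambda>_. True) (B * (T + 1)) S"
proof (induction B arbitrary: acc)
  case (Suc B)
  have "costs (accumulate (Suc B) m acc) (\<lambda>_. True) (T + (real 1 + B * (T + 1))) S"
    unfolding accumulate.simps using assms Suc by (intro costs_bind[where P = "\<lambda>_. True"] costs_tick) auto
  then show ?case by (simp add: algebra_simps)
qed (simp add: costs_ret assms(2))

lemma costs_lazy_walk: "costs (lazy_walk E t x) (\<lambda>_. True) t 0"
proof (induction t arbitrary: x)
  case (Suc t)
  have "costs (lazy_walk E (Suc t) x) (\<lambda>_. True) (1 + real t) 0"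
    unfolding lazy_walk.simps using Suc by (intro costs_bind[where P = "\<lambda>_. True"] costs_draw) auto
  then show ?case by simp
qed (simp add: costs_ret)

definition batch_time :: "nat \<Rightarrow> nat \<Rightarrow> real" where
  "batch_time t M = 2 * real M * t + 2 * sort_time M + 2 * M"

definition est_time :: "real \<Rightarrow> nat \<Rightarrow> nat \<Rightarrow> real" where
  "est_time R t M = nat \<lceil>R / real M\<rceil> * (batch_time t M + 1) + 1"

lemma costs_rw_batch: "costs (rw_batch n E t M x y) (\<lambda>_. True) (batch_time t M) 0"
proof -
  have walks: "costs (for_each (\<lambda>_. lazy_walk E t z) [0..<M]) (\<lambda>_. True) (real M * t) 0" for z
    by (rule costs_mono[OF costs_for_each[where T = t]]) (auto intro: costs_lazy_walk)
  have "costs (rw_batch n E t M x y) (\<lambda>_. True) (real M * t + (real M * t + (real (2 * sort_time M + 2 * M) + 0))) 0"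
    unfolding rw_batch_def by (intro costs_bind[OF walks] costs_bind[OF costs_tick] costs_ret) auto
  then show ?thesis by (rule costs_mono) (simp_all add: batch_time_def)
qed

lemma costs_est_rw_dot:
  "costs (est_rw_dot cw n E R t M x y) (\<lambda>_. True) (est_time R t M) (word cw n * (2 * M + 8))"
proof -
  have "costs (est_rw_dot cw n E R t M x y) (\<lambda>_. True)
      (nat \<lceil>R / real M\<rceil> * (batch_time t M + 1) + (real 1 + 0)) (real (word cw n * (2 * M + 8)) + 0)"
    unfolding est_rw_dot_def Let_def
    by (intro costs_with_space costs_bind[OF costs_accumulate[OF costs_rw_batch]] costs_bind[OF costs_tick] costs_ret) auto
  then show ?thesis by (rule costs_mono) (simp_all add: est_time_def)
qed

lemma costs_est_colli_prob:
  "costs (est_colli_prob cw n E reps R t M IS) (\<lambda>_. True)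
     (reps * (length IS * (length IS * est_time R t M)) + (real (length IS))\<^sup>2 * sort_time reps)
     (word cw n * (reps * (length IS)\<^sup>2 + reps + 8) + word cw n * (2 * M + 8))"
proof -
  let ?s = "length IS" and ?S = "real (word cw n * (2 * M + 8))" and ?T = "est_time R t M"
  let ?rows = "for_each (\<lambda>i. for_each (\<lambda>j. est_rw_dot cw n E R t M (IS ! i) (IS ! j)) [i..<?s]) [0..<?s]"
  have T: "0 \<le> ?T" by (simp add: est_time_def batch_time_def)
  have row: "costs (for_each (\<lambda>j. est_rw_dot cw n E R t M (IS ! i) (IS ! j)) [i..<?s]) (\<lambda>_. True) (?s * ?T) ?S" for i
    using T by (intro costs_mono[OF costs_for_each[OF costs_est_rw_dot]] mult_right_mono) auto
  have rows: "costs ?rows (\<lambda>_. True) (?s * (?s * ?T)) ?S"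
    by (rule costs_mono[OF costs_for_each[OF row]]) auto
  have matrix: "costs (do { rows \<leftarrow> ?rows; ret (mat ?s ?s (\<lambda>(i, j). rows ! min i j ! (max i j - min i j))) })
      (\<lambda>_. True) (?s * (?s * ?T) + 0) ?S"
    by (intro costs_bind[OF rows] costs_ret) auto
  have matrices: "costs (for_each (\<lambda>l. do { rows \<leftarrow> ?rows;
        ret (mat ?s ?s (\<lambda>(i, j). rows ! min i j ! (max i j - min i j))) }) [0..<reps])
      (\<lambda>_. True) (reps * (?s * (?s * ?T))) ?S"
    by (rule costs_mono[OF costs_for_each[OF matrix]]) auto
  have "costs (est_colli_prob cw n E reps R t M IS) (\<lambda>_. True)
     (reps * (?s * (?s * ?T)) + (real (?s\<^sup>2 * sort_time reps) + 0)) (real (word cw n * (reps * ?s\<^sup>2 + reps + 8)) + ?S)"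
    unfolding est_colli_prob_def Let_def
    by (intro costs_with_space costs_bind[OF matrices] costs_bind[OF costs_tick] costs_ret) auto
  then show ?thesis by simp
qed

lemma costs_init_oracle:
  fixes H n k \<phi> \<epsilon> \<xi> M cw ce
  defines "s \<equiv> sample_size H n k \<phi> \<epsilon> \<xi>" and "r \<equiv> repetitions H n"
    and "T \<equiv> est_time (R_init H n k \<phi> \<epsilon> \<xi> M) (walk_length n \<phi>) M"
  shows "costs (init_oracle H cw ce eig n E k \<phi> \<epsilon> \<xi> M) (\<lambda>(IS, out). length IS = s)
     (r * (s * (s * T)) + (real s)\<^sup>2 * sort_time r + real (s + (s\<^sup>2 + ce * s ^ 3) + (k + s * k + s\<^sup>2 * k + s\<^sup>2)))
     (word cw n * (s + 2 * s\<^sup>2 + ce * s\<^sup>2 + s * k + 8 + (r * s\<^sup>2 + r + 8) + (2 * M + 8)))"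
proof -
  let ?S = "real (word cw n * (r * s\<^sup>2 + r + 8) + word cw n * (2 * M + 8))"
  have sample: "costs (for_each (\<lambda>_. draw (pmf_of_set {..<n})) [0..<s]) (\<lambda>IS. length IS = s) s ?S"
    by (rule costs_mono[OF costs_for_each[where S = ?S, OF costs_draw]]) auto
  have colli: "costs (est_colli_prob cw n E r (R_init H n k \<phi> \<epsilon> \<xi> M) (walk_length n \<phi>) M IS) (\<lambda>_. True)
      (r * (s * (s * T)) + (real s)\<^sup>2 * sort_time r) ?S" if "length IS = s" for IS :: "nat list"
    using costs_est_colli_prob[of cw n E r "R_init H n k \<phi> \<epsilon> \<xi> M" "walk_length n \<phi>" M IS] unfolding that T_def by simp
  have "costs (init_oracle H cw ce eig n E k \<phi> \<epsilon> \<xi> M) (\<lambda>(IS, out). length IS = s)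
     (s + ((r * (s * (s * T)) + (real s)\<^sup>2 * sort_time r)
       + (real (s\<^sup>2 + ce * s ^ 3) + (real (k + s * k + s\<^sup>2 * k + s\<^sup>2) + 0))))
     (real (word cw n * (s + 2 * s\<^sup>2 + ce * s\<^sup>2 + s * k + 8)) + ?S)"
    unfolding init_oracle_def Let_def case_prod_unfold s_def[symmetric] r_def[symmetric]
    by (rule costs_with_space, rule costs_bind[OF sample], rule costs_bind[OF colli], assumption,
        rule costs_bind[OF costs_tick], simp, rule costs_bind[OF costs_tick], simp) (rule costs_ret, auto)
  then show ?thesis by (rule costs_mono) (simp_all add: algebra_simps)
qed

lemma costs_query_dot:
  fixes H n k \<phi> \<epsilon> \<xi> M cw
  assumes s: "length IS = s"
  defines "r \<equiv> repetitions H n" and "T \<equiv> est_time (R_query H n k \<phi> \<epsilon> \<xi> M) (walk_length n \<phi>) M"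
  shows "costs (query_dot H cw n E k \<phi> \<epsilon> \<xi> IS \<Psi> M x y) (\<lambda>_. True)
     (2 * (r * (s * T)) + 2 * (s * real (sort_time r)) + real (2 * s\<^sup>2 + 2 * s))
     (word cw n * (s + s\<^sup>2 + 2 * r * s + 2 * s + r + 8 + (2 * M + 8)))"
proof -
  let ?S = "real (word cw n * (2 * M + 8))"
  let ?est = "\<lambda>x i. est_rw_dot cw n E (R_query H n k \<phi> \<epsilon> \<xi> M) (walk_length n \<phi>) M x (IS ! i)"
  have pair: "costs (do { a \<leftarrow> ?est x i; b \<leftarrow> ?est y i; ret (a, b) }) (\<lambda>_. True) (T + (T + 0)) ?S" for i
    unfolding T_def by (intro costs_bind[OF costs_est_rw_dot] costs_ret) auto
  have row: "costs (for_each (\<lambda>i. do { a \<leftarrow> ?est x i; b \<leftarrow> ?est y i; ret (a, b) }) [0..<s]) (\<lambda>_. True) (s * (2 * T)) ?S"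
    by (rule costs_mono[OF costs_for_each[OF pair]]) auto
  have rows: "costs (for_each (\<lambda>l. for_each (\<lambda>i. do { a \<leftarrow> ?est x i; b \<leftarrow> ?est y i; ret (a, b) }) [0..<s]) [0..<r])
      (\<lambda>_. True) (r * (s * (2 * T))) ?S"
    by (rule costs_mono[OF costs_for_each[OF row]]) auto
  have "costs (query_dot H cw n E k \<phi> \<epsilon> \<xi> IS \<Psi> M x y) (\<lambda>_. True)
     (r * (s * (2 * T)) + (real (2 * s * sort_time r) + (real (2 * s\<^sup>2 + 2 * s) + 0)))
     (real (word cw n * (s + s\<^sup>2 + 2 * r * s + 2 * s + r + 8)) + ?S)"
    unfolding query_dot_def Let_def s r_def[symmetric]
    by (intro costs_with_space costs_bind[OF rows] costs_bind[OF costs_tick] costs_ret) auto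
  then show ?thesis by (rule costs_mono) (simp_all add: algebra_simps)
qed

lemma nat_ceiling_log2_le:
  assumes "1 \<le> m"
  shows "real (nat \<lceil>log 2 (real m)\<rceil>) \<le> 2 * ln m + 1"
proof -
  have "1 / 2 \<le> ln (2 :: real)" using exp_half_le2 by (subst ln_ge_iff) auto
  then have "ln m / ln 2 \<le> ln m / (1 / 2)" using assms by (intro divide_left_mono) auto
  then have "log 2 m \<le> 2 * ln m" by (simp add: log_def)
  moreover have "0 \<le> log 2 m" using assms by simp
  ultimately show ?thesis by linarith
qed

lemma sort_time_le:
  assumes "1 \<le> m"
  shows "real (sort_time m) \<le> m * (2 * ln m + 2)"
  unfolding sort_time_def of_nat_mult using nat_ceiling_log2_le[OF assms] by (intro mult_left_mono) auto

text \<open>One constant serves for all hidden factors. Since \<open>2 \<le> k / \<xi>\<close>, it is at most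
  \<open>k / \<xi>\<close> raised to its binary logarithm.\<close>

definition cost_constant :: "hidden \<Rightarrow> real \<Rightarrow> nat \<Rightarrow> nat \<Rightarrow> real" where
  "cost_constant H cM cw ce = 64 + c_s H + c_init H + c_query H + c_reps H + 3 * real cw + real ce + (cM + 2)\<^sup>2"

definition cost_exponent :: "hidden \<Rightarrow> real \<Rightarrow> nat \<Rightarrow> nat \<Rightarrow> real" where
  "cost_exponent H cM cw ce = 36 * (74 + log 2 (cost_constant H cM cw ce))"

context oracle_setup
begin

context
  fixes cw ce M :: nat
  assumes M: "feasible M"
begin

abbreviation K :: real where
  "K \<equiv> cost_constant H cM cw ce"

text \<open>The powers of \<open>\<nu>\<close> in \<open>s\<close>, \<open>R_init\<close> and \<open>R_query\<close> are at most \<open>\<nu> 74\<close> to the exponent of \<open>k\<close>; the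
  tightest case is \<open>440 \<le> 74 * 6\<close>.\<close>

definition growth :: "nat \<Rightarrow> nat \<Rightarrow> real" where
  "growth i j = (K * (k / \<xi>) * \<nu> 74) ^ i * ln n ^ j"

lemma M_ge_1: "1 \<le> M"
  using M by (simp add: feasible_def)

lemma hidden_constants_pos: "0 < c_s H" "0 < c_init H" "0 < c_query H" "0 < c_reps H"
  using c_s_ge_1 budget_constant_ge_1[OF M] constants by (auto simp: sufficient_constants_def)

lemma K_bounds:
  "64 \<le> K" "c_s H + 1 \<le> K" "c_reps H + 1 \<le> K" "c_init H \<le> K" "c_query H \<le> K" "3 * real cw \<le> K"
  "32 + real ce \<le> K" "2 * cM + 4 \<le> K" "cM\<^sup>2 \<le> K" "cM \<le> K"
  using hidden_constants_pos feasible_imp_cM_pos[OF M] zero_le_power2[of cM]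
  by (simp_all add: cost_constant_def power2_sum)

lemma two_le_k_div_\<xi>: "2 \<le> k / \<xi>"
proof -
  have "2 / 1 \<le> real k / \<xi>" using k_ge_2 \<xi> \<xi>_pos by (intro frac_le) auto
  then show ?thesis by simp
qed

lemma base_ge_K: "K \<le> K * (k / \<xi>) * \<nu> 74"
proof -
  have "1 \<le> k / \<xi>" using two_le_k_div_\<xi> by linarith
  then have "K * 1 * 1 \<le> K * (k / \<xi>) * \<nu> 74"
    using K_bounds(1) \<nu>_ge_1[of 74] \<xi>_pos by (intro mult_mono mult_nonneg_nonneg) auto
  then show ?thesis by simp
qed

lemma growth_nonneg: "0 \<le> growth i j"
  using base_ge_K K_bounds(1) ln_n_ge_1 by (simp add: growth_def)

lemma growth_mono: "i \<le> i' \<Longrightarrow> j \<le> j' \<Longrightarrow> growth i j \<le> growth i' j'"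
  unfolding growth_def using base_ge_K K_bounds(1) ln_n_ge_1 by (intro mult_mono power_increasing) auto

lemma growth_mult: "growth i j * growth i' j' = growth (i + i') (j + j')"
  by (simp only: growth_def power_add mult_ac)

lemma growth_power: "growth i j ^ m = growth (i * m) (j * m)"
  by (simp add: growth_def power_mult_distrib power_mult)

lemma mult_growth_le: "x \<le> K \<Longrightarrow> x * growth i j \<le> growth (i + 1) j"
  using mult_right_mono[of x "K * (k / \<xi>) * \<nu> 74" "growth i j"] base_ge_K growth_nonneg[of i j]
  by (simp add: growth_def mult_ac)

lemma le_growth_1: "x \<le> K \<Longrightarrow> x \<le> growth 1 0"
  using base_ge_K by (simp add: growth_def)

lemma k_power_div_le:
  assumes "2 \<le> i" "r \<le> 74 * real i" "x \<le> K" "0 \<le> x"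
  shows "x * (\<nu> r * (real k ^ i / \<xi>\<^sup>2)) \<le> growth i 0"
proof -
  have "\<xi> ^ i \<le> \<xi>\<^sup>2" using assms(1) \<xi> \<xi>_pos by (intro power_decreasing) auto
  then have "real k ^ i / \<xi>\<^sup>2 \<le> (k / \<xi>) ^ i"
    unfolding power_divide using \<xi>_pos by (intro divide_left_mono) auto
  moreover have "\<nu> r \<le> \<nu> 74 ^ i" unfolding \<nu>_power using assms(2) by (intro \<nu>_mono) (simp add: mult.commute)
  moreover have "x \<le> K ^ i"
    using assms(1,3) K_bounds(1) self_le_power[of K i] by linarith
  ultimately have "x * (\<nu> r * (real k ^ i / \<xi>\<^sup>2)) \<le> K ^ i * (\<nu> 74 ^ i * (k / \<xi>) ^ i)"
    using assms(4) \<nu>_pos[of r] \<nu>_pos[of 74] K_bounds(1) by (intro mult_mono) auto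
  then show ?thesis unfolding growth_def power_mult_distrib by (simp only: mult_ac power_0 mult_1_right)
qed

lemma s_le_growth: "real s \<le> growth 8 1"
proof -
  have "real s \<le> (c_s H + 1) * sample_scale" by (rule s_bounds(2))
  also have "\<dots> = (c_s H + 1) * (\<nu> 480 * (real k ^ 8 / \<xi>\<^sup>2)) * ln n" by (simp add: sample_scale_def)
  also have "\<dots> \<le> growth 8 0 * ln n"
    using k_power_div_le[of 8 480] K_bounds(2) c_s_ge_1 ln_n_ge_1 by (intro mult_right_mono) auto
  finally show ?thesis by (simp add: growth_def)
qed

lemma reps_le_growth: "real reps \<le> growth 1 1"
proof -
  have "0 \<le> c_reps H * ln n" using hidden_constants_pos ln_n_ge_1 by simp
  then have "real reps \<le> c_reps H * ln n + 1" unfolding repetitions_def by linarith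
  also have "\<dots> \<le> (c_reps H + 1) * growth 0 1" using ln_n_ge_1 by (simp add: growth_def distrib_right)
  also have "\<dots> \<le> growth 1 1" using mult_growth_le[of "c_reps H + 1" 0 1] K_bounds(3) by simp
  finally show ?thesis .
qed

lemma word_le_growth: "real (word cw n) \<le> growth 1 1"
proof -
  have "real cw * real (nat \<lceil>log 2 (real n)\<rceil>) \<le> real cw * (3 * ln n)"
    using nat_ceiling_log2_le[of n] n_ge_4 ln_n_ge_1 by (intro mult_left_mono) auto
  also have "\<dots> = (3 * real cw) * growth 0 1" by (simp add: growth_def)
  also have "\<dots> \<le> growth 1 1" using mult_growth_le[of "3 * real cw" 0 1] K_bounds(6) by simp
  finally show ?thesis by (simp add: word_def)
qed

lemma sort_time_reps_le_growth: "real (sort_time reps) \<le> growth 3 2"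
proof -
  have reps: "1 \<le> real reps" using reps_pos by simp
  have "real (sort_time reps) \<le> reps * (2 * ln reps + 2)" using reps_pos by (intro sort_time_le) simp
  also have "\<dots> \<le> reps * (4 * real reps)" using ln_le_minus_one[of "real reps"] reps by (intro mult_left_mono) linarith+
  also have "\<dots> = 4 * (real reps)\<^sup>2" by (simp add: power2_eq_square)
  also have "\<dots> \<le> 4 * growth 1 1 ^ 2" using reps_le_growth by (intro mult_left_mono power_mono) auto
  also have "\<dots> \<le> growth 3 2" using mult_growth_le[of 4 2 2] K_bounds(1) by (simp add: growth_power)
  finally show ?thesis .
qed

lemma M_sq_le_cM_sq_n: "(real M)\<^sup>2 \<le> cM\<^sup>2 * n"
proof -
  note cM = feasible_imp_cM_pos[OF M]
  have "real M * 1 \<le> real M * k" using k_ge_2 by (intro mult_left_mono) auto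
  also have "\<dots> \<le> cM * (sqrt n * \<nu> (- 20))" by (rule feasible_bound[OF M])
  also have "\<dots> \<le> cM * (sqrt n * 1)" using cM \<nu>_mono[of "- 20" 0] by (intro mult_left_mono) auto
  finally have "(real M)\<^sup>2 \<le> (cM * sqrt n)\<^sup>2" by (intro power_mono) auto
  then show ?thesis by (simp add: power_mult_distrib)
qed

lemma M_le_cM_n: "real M \<le> cM * n"
proof (rule power2_le_imp_le)
  have "cM\<^sup>2 * n \<le> cM\<^sup>2 * (real n)\<^sup>2" using n_ge_4 by (intro mult_left_mono self_le_power) auto
  then show "(real M)\<^sup>2 \<le> (cM * n)\<^sup>2" using M_sq_le_cM_sq_n by (simp add: power_mult_distrib)
qed (use feasible_imp_cM_pos[OF M] in simp)

lemma inverse_\<phi>_sq_ge_1: "1 \<le> 1 / \<phi>\<^sup>2"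
  using \<phi> by (simp add: power_le_one)

lemma growth_le_growth_div_M:
  assumes "i < i'"
  shows "growth i j \<le> growth i' j * (n / M * (1 / \<phi>\<^sup>2))"
proof -
  have "1 * 1 \<le> K * (n / M) * (1 / \<phi>\<^sup>2)"
  proof (rule mult_mono[OF _ inverse_\<phi>_sq_ge_1])
    have "real M \<le> K * n" using M_le_cM_n K_bounds(10) mult_right_mono[of cM K n] by linarith
    then show "1 \<le> K * (n / M)" using M_ge_1 by simp
  qed (use K_bounds(1) in auto)
  then have "growth i j * 1 \<le> growth i j * (K * (n / M) * (1 / \<phi>\<^sup>2))" using growth_nonneg by (intro mult_left_mono) auto
  also have "\<dots> = (K * growth i j) * (n / M * (1 / \<phi>\<^sup>2))" by simp
  also have "\<dots> \<le> growth i' j * (n / M * (1 / \<phi>\<^sup>2))"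
    using order_trans[OF mult_growth_le[of K i j] growth_mono[of "i + 1" i' j j]] assms
    by (intro mult_right_mono) auto
  finally show ?thesis by simp
qed

lemma batch_time_le: "batch_time t M + 1 \<le> M * (growth 2 1 * (1 / \<phi>\<^sup>2))"
proof -
  define L where "L = ln n * (1 / \<phi>\<^sup>2)"
  have L: "ln n \<le> L" using mult_left_mono[OF inverse_\<phi>_sq_ge_1, of "ln n"] ln_n_ge_1 by (simp add: L_def)
  have "real t \<le> 20 * L + 1" using t_bounds(2) by (simp add: L_def)
  moreover have "2 * ln M + 2 \<le> 2 * cM + 2 * ln n + 2"
  proof -
    note cM = feasible_imp_cM_pos[OF M]
    have "ln M \<le> ln (cM * n)" using M_le_cM_n M_ge_1 by (subst ln_le_cancel_iff) auto
    also have "\<dots> = ln cM + ln n" using cM n_ge_4 by (simp add: ln_mult)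
    finally show ?thesis using ln_bound[OF cM] by linarith
  qed
  moreover have "2 * cM \<le> 2 * cM * L" using feasible_imp_cM_pos[OF M] L ln_n_ge_1 by simp
  ultimately have "2 * t + 2 * (2 * ln M + 2) + 3 \<le> 2 * (2 * cM + 4) * L + 50 * L"
    using L ln_n_ge_1 by (simp add: distrib_right)
  also have "\<dots> \<le> 2 * K * L + 50 * L" using K_bounds(8) L ln_n_ge_1 by (intro add_right_mono mult_right_mono) auto
  also have "\<dots> \<le> K * (K * L)"
  proof -
    have "2 * K + 50 \<le> K * K" using mult_right_mono[OF K_bounds(1), of K] K_bounds(1) by linarith
    then show ?thesis using mult_right_mono[of "2 * K + 50" "K * K" L] L ln_n_ge_1 by (simp add: algebra_simps)
  qed
  also have "\<dots> \<le> growth 2 1 * (1 / \<phi>\<^sup>2)"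
  proof -
    have "K * (K * growth 0 1) \<le> K * growth 1 1" using mult_growth_le[of K 0 1] K_bounds(1) by (intro mult_left_mono) auto
    also have "\<dots> \<le> growth 2 1" using mult_growth_le[of K 1 1] by (simp add: numeral_2_eq_2)
    finally show ?thesis using mult_right_mono[of "K * (K * growth 0 1)" "growth 2 1" "1 / \<phi>\<^sup>2"]
      by (simp add: growth_def L_def mult_ac)
  qed
  finally have factor: "2 * t + 2 * (2 * ln M + 2) + 3 \<le> growth 2 1 * (1 / \<phi>\<^sup>2)" .
  have "batch_time t M + 1 \<le> 2 * real M * t + 2 * (M * (2 * ln M + 2)) + 2 * M + M"
    unfolding batch_time_def using sort_time_le[OF M_ge_1] M_ge_1 by simp
  also have "\<dots> = M * (2 * t + 2 * (2 * ln M + 2) + 3)" by (simp add: algebra_simps)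
  also have "\<dots> \<le> M * (growth 2 1 * (1 / \<phi>\<^sup>2))" using factor by (intro mult_left_mono) auto
  finally show ?thesis .
qed

lemma batches_le:
  fixes R :: real
  assumes R: "R * M \<le> n * growth 14 0" "0 < R"
  shows "real (nat \<lceil>R / real M\<rceil>) \<le> n * growth 15 0 / (real M)\<^sup>2"
proof -
  have "0 \<le> R / M" using R by simp
  then have "real (nat \<lceil>R / real M\<rceil>) \<le> R / M + 1" by linarith
  also have "\<dots> = (R * M + (real M)\<^sup>2) / (real M)\<^sup>2" using M_ge_1 by (simp add: power2_eq_square field_simps)
  also have "\<dots> \<le> n * growth 15 0 / (real M)\<^sup>2"
  proof (rule divide_right_mono)
    have "(real M)\<^sup>2 \<le> n * growth 14 0"
    proof -
      have "cM\<^sup>2 \<le> growth 14 0" using le_growth_1[OF K_bounds(9)] growth_mono[of 1 14 0 0] by linarith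
      then show ?thesis using M_sq_le_cM_sq_n mult_right_mono[of "cM\<^sup>2" "growth 14 0" n] by (simp add: mult.commute)
    qed
    then have "R * M + (real M)\<^sup>2 \<le> n * (2 * growth 14 0)" using R(1) by simp
    also have "\<dots> \<le> n * growth 15 0" using mult_growth_le[of 2 14 0] K_bounds(1) by (intro mult_left_mono) auto
    finally show "R * M + (real M)\<^sup>2 \<le> n * growth 15 0" .
  qed simp
  finally show ?thesis .
qed

lemma est_time_le:
  fixes R :: real
  assumes R: "R * M \<le> n * growth 14 0" "0 < R"
  shows "est_time R t M \<le> growth 18 1 * (n / M * (1 / \<phi>\<^sup>2))"
proof -
  let ?V = "n / M * (1 / \<phi>\<^sup>2)"
  have "nat \<lceil>R / real M\<rceil> * (batch_time t M + 1) \<le> n * growth 15 0 / (real M)\<^sup>2 * (M * (growth 2 1 * (1 / \<phi>\<^sup>2)))"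
    by (intro mult_mono batches_le[OF R] batch_time_le) (auto simp: batch_time_def growth_nonneg)
  also have "\<dots> = growth 17 1 * ?V"
    using growth_mult[of 15 0 2 1] M_ge_1 by (simp add: power2_eq_square mult_ac)
  finally have "est_time R t M \<le> growth 17 1 * ?V + 1" by (simp add: est_time_def)
  moreover have "1 \<le> growth 17 1 * ?V"
  proof -
    have "1 \<le> growth 16 1" using growth_mono[of 0 16 0 1] by (simp add: growth_def)
    then show ?thesis using growth_le_growth_div_M[of 16 17 1] by linarith
  qed
  ultimately have "est_time R t M \<le> (2 * growth 17 1) * ?V" by linarith
  also have "\<dots> \<le> growth 18 1 * ?V" using mult_growth_le[of 2 17 1] K_bounds(1) by (intro mult_right_mono) auto
  finally show ?thesis .
qed

lemma walk_budget_le: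
  assumes "0 < c" "c \<le> K" "2 \<le> i" "i \<le> 14" "r \<le> 74 * real i"
  shows "walk_budget c r i M * M \<le> n * growth 14 0" "0 < walk_budget c r i M"
proof -
  have "walk_budget c r i M * M = n * (c * (\<nu> r * (real k ^ i / \<xi>\<^sup>2)))" using M_ge_1 by (simp add: walk_budget_mult)
  also have "\<dots> \<le> n * growth 14 0"
    using k_power_div_le[of i r c] growth_mono[of i 14 0 0] assms by (intro mult_left_mono) auto
  finally show "walk_budget c r i M * M \<le> n * growth 14 0" .
  show "0 < walk_budget c r i M" using assms(1) M_ge_1 by (intro walk_budget_pos) auto
qed

lemma est_init_time_le: "est_time (R_init H n k \<phi> \<epsilon> \<xi> M) t M \<le> growth 18 1 * (n / M * (1 / \<phi>\<^sup>2))"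
  using hidden_constants_pos(2) K_bounds(4) unfolding R_init_eq by (intro est_time_le walk_budget_le) auto

lemma est_query_time_le: "est_time (R_query H n k \<phi> \<epsilon> \<xi> M) t M \<le> growth 18 1 * (n / M * (1 / \<phi>\<^sup>2))"
  using hidden_constants_pos(3) K_bounds(5) unfolding R_query_eq by (intro est_time_le walk_budget_le) auto

lemma est_time_nonneg: "0 \<le> est_time R t M"
  by (simp add: est_time_def batch_time_def)

lemma init_time_le:
  fixes T :: real
  assumes T: "T \<le> growth 18 1 * (n / M * (1 / \<phi>\<^sup>2))" "0 \<le> T"
  shows "reps * (s * (s * T)) + (real s)\<^sup>2 * sort_time reps + real (s + (s\<^sup>2 + ce * s ^ 3) + (k + s * k + s\<^sup>2 * k + s\<^sup>2))
    \<le> growth 36 4 * (n / M * (1 / \<phi>\<^sup>2))" (is "?walks + ?medians + real ?algebra \<le> _ * ?V")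
proof -
  have "?walks \<le> growth 1 1 * (growth 8 1 * (growth 8 1 * (growth 18 1 * ?V)))"
    using T by (intro mult_mono reps_le_growth s_le_growth) (auto simp: growth_nonneg)
  also have "\<dots> = growth 35 4 * ?V" unfolding mult.assoc[symmetric] growth_mult by (simp del: One_nat_def)
  finally have walks: "?walks \<le> growth 35 4 * ?V" .
  have growth_div_M: "growth 34 4 \<le> growth 35 4 * ?V" by (rule growth_le_growth_div_M) simp
  have "?medians \<le> growth 8 1 ^ 2 * growth 3 2"
    by (intro mult_mono power_mono s_le_growth sort_time_reps_le_growth) (auto simp: growth_nonneg)
  also have "\<dots> \<le> growth 34 4" by (simp add: growth_power growth_mult growth_mono)
  finally have medians: "?medians \<le> growth 34 4" .
  have "?algebra \<le> (6 + ce) * s ^ 3"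
  proof -
    have "s\<^sup>2 \<le> s ^ 3" "s \<le> s ^ 3" using s_pos by (auto intro: power_increasing self_le_power)
    moreover have "s * k \<le> s\<^sup>2" "s\<^sup>2 * k \<le> s ^ 3" using k_le_s by (simp_all add: power2_eq_square power3_eq_cube)
    ultimately show ?thesis using k_le_s by (simp add: distrib_right)
  qed
  then have "real ?algebra \<le> (6 + real ce) * real s ^ 3" by (metis of_nat_add of_nat_le_iff of_nat_mult of_nat_numeral of_nat_power)
  also have "\<dots> \<le> (6 + real ce) * growth 8 1 ^ 3" by (intro mult_left_mono power_mono s_le_growth) auto
  also have "\<dots> \<le> growth 25 3" using mult_growth_le[of "6 + real ce" 24 3] K_bounds(7) by (simp add: growth_power)
  also have "\<dots> \<le> growth 34 4" by (intro growth_mono) auto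
  finally have "real ?algebra \<le> growth 34 4" .
  then have "?walks + ?medians + real ?algebra \<le> growth 35 4 * ?V + growth 35 4 * ?V + growth 35 4 * ?V"
    by (intro add_mono walks order_trans[OF medians growth_div_M] order_trans[OF _ growth_div_M])
  also have "\<dots> = 3 * growth 35 4 * ?V" by simp
  also have "\<dots> \<le> growth 36 4 * ?V" using mult_growth_le[of 3 35 4] K_bounds(1) by (intro mult_right_mono) auto
  finally show ?thesis .
qed

lemma query_time_le:
  fixes T :: real
  assumes T: "T \<le> growth 18 1 * (n / M * (1 / \<phi>\<^sup>2))" "0 \<le> T"
  shows "2 * (reps * (s * T)) + 2 * (s * real (sort_time reps)) + real (2 * s\<^sup>2 + 2 * s)
    \<le> growth 36 3 * (n / M * (1 / \<phi>\<^sup>2))" (is "2 * ?walks + 2 * ?medians + real ?algebra \<le> _ * ?V")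
proof -
  have "?walks \<le> growth 1 1 * (growth 8 1 * (growth 18 1 * ?V))"
    using T by (intro mult_mono reps_le_growth s_le_growth) (auto simp: growth_nonneg)
  also have "\<dots> = growth 27 3 * ?V" unfolding mult.assoc[symmetric] growth_mult by (simp del: One_nat_def)
  also have "\<dots> \<le> growth 35 3 * ?V" by (intro mult_right_mono growth_mono) auto
  finally have walks: "?walks \<le> growth 35 3 * ?V" .
  have growth_div_M: "growth 34 3 \<le> growth 35 3 * ?V" by (rule growth_le_growth_div_M) simp
  have "?medians \<le> growth 8 1 * growth 3 2"
    by (intro mult_mono s_le_growth sort_time_reps_le_growth) (auto simp: growth_nonneg)
  also have "\<dots> \<le> growth 34 3" by (simp add: growth_mult growth_mono)
  finally have medians: "?medians \<le> growth 34 3" .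
  have "s \<le> s\<^sup>2" using s_pos by (intro self_le_power) auto
  then have "real ?algebra \<le> 4 * real s ^ 2" by simp
  also have "\<dots> \<le> 4 * growth 8 1 ^ 2" by (intro mult_left_mono power_mono s_le_growth) auto
  also have "\<dots> \<le> 4 * growth 34 3" by (simp add: growth_power growth_mono)
  also have "\<dots> \<le> 4 * (growth 35 3 * ?V)" using growth_div_M by (rule mult_left_mono) simp
  finally have "2 * ?walks + 2 * ?medians + real ?algebra
      \<le> 2 * (growth 35 3 * ?V) + 2 * (growth 35 3 * ?V) + 4 * (growth 35 3 * ?V)"
    by (intro add_mono mult_left_mono walks order_trans[OF medians growth_div_M]) auto
  also have "\<dots> = 8 * growth 35 3 * ?V" by simp
  also have "\<dots> \<le> growth 36 3 * ?V" using mult_growth_le[of 8 35 3] K_bounds(1) by (intro mult_right_mono) auto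
  finally show ?thesis .
qed

lemma init_space_le:
  "real (word cw n * (s + 2 * s\<^sup>2 + ce * s\<^sup>2 + s * k + 8 + (reps * s\<^sup>2 + reps + 8) + (2 * M + 8))) \<le> growth 36 4 * M"
proof -
  have s: "1 \<le> s" and reps: "1 \<le> reps" using s_pos reps_pos by auto
  have "s * k \<le> s\<^sup>2" "s \<le> s\<^sup>2" using s k_le_s by (auto simp: power2_eq_square)
  moreover have "1 \<le> s\<^sup>2" using s by simp
  moreover have "s\<^sup>2 \<le> reps * s\<^sup>2" "reps \<le> reps * s\<^sup>2" "reps * s\<^sup>2 \<le> reps * s\<^sup>2 * M" "ce * s\<^sup>2 \<le> ce * (reps * s\<^sup>2 * M)"
    "M \<le> reps * s\<^sup>2 * M"
    using s reps M_ge_1 by auto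
  ultimately have "s + 2 * s\<^sup>2 + ce * s\<^sup>2 + s * k + 8 + (reps * s\<^sup>2 + reps + 8) + (2 * M + 8)
      \<le> (32 + ce) * (reps * s\<^sup>2 * M)"
    unfolding distrib_right by linarith
  then have "real (word cw n * (s + 2 * s\<^sup>2 + ce * s\<^sup>2 + s * k + 8 + (reps * s\<^sup>2 + reps + 8) + (2 * M + 8)))
      \<le> real (word cw n * ((32 + ce) * (reps * s\<^sup>2 * M)))"
    unfolding of_nat_le_iff by (rule mult_le_mono2)
  also have "\<dots> = (32 + real ce) * (word cw n * (reps * (real s)\<^sup>2)) * M" by simp
  also have "\<dots> \<le> (32 + real ce) * (growth 1 1 * (growth 1 1 * growth 8 1 ^ 2)) * M"
    by (intro mult_right_mono mult_left_mono mult_mono power_mono word_le_growth reps_le_growth s_le_growth)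
       (auto simp: growth_nonneg)
  also have "\<dots> = (32 + real ce) * growth 18 4 * M" by (simp add: growth_power growth_mult del: One_nat_def)
  also have "\<dots> \<le> growth 36 4 * M"
    using mult_growth_le[of "32 + real ce" 18 4] K_bounds(7) growth_mono[of 19 36 4 4]
    by (intro mult_right_mono) auto
  finally show ?thesis .
qed

lemma query_space_le:
  "real (word cw n * (s + s\<^sup>2 + 2 * reps * s + 2 * s + reps + 8 + (2 * M + 8))) \<le> growth 36 3 * M"
proof -
  have s: "1 \<le> s" and reps: "1 \<le> reps" using s_pos reps_pos by auto
  have "s \<le> s\<^sup>2" using s by (simp add: power2_eq_square)
  moreover have "1 \<le> s\<^sup>2 * M" using s M_ge_1 by simp
  moreover have "s\<^sup>2 \<le> s\<^sup>2 * M" "reps \<le> reps * s" "reps * s \<le> reps * s * M" "M \<le> s\<^sup>2 * M" using s M_ge_1 by auto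
  ultimately have "s + s\<^sup>2 + 2 * reps * s + 2 * s + reps + 8 + (2 * M + 8) \<le> 22 * (s\<^sup>2 * M) + 3 * (reps * s * M)"
    by linarith
  then have "real (word cw n * (s + s\<^sup>2 + 2 * reps * s + 2 * s + reps + 8 + (2 * M + 8)))
      \<le> real (word cw n * (22 * (s\<^sup>2 * M) + 3 * (reps * s * M)))"
    unfolding of_nat_le_iff by (rule mult_le_mono2)
  also have "\<dots> = word cw n * (22 * (real s)\<^sup>2 + 3 * (real reps * s)) * M" by (simp add: algebra_simps)
  also have "\<dots> \<le> growth 1 1 * (22 * growth 8 1 ^ 2 + 3 * (growth 1 1 * growth 8 1)) * M"
    by (intro mult_right_mono mult_left_mono mult_mono add_mono power_mono word_le_growth reps_le_growth s_le_growth)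
       (auto simp: growth_nonneg)
  also have "\<dots> \<le> growth 36 3 * M"
  proof (rule mult_right_mono)
    have "growth 1 1 * (22 * growth 8 1 ^ 2 + 3 * (growth 1 1 * growth 8 1)) = 22 * growth 17 3 + 3 * growth 10 3"
      by (simp add: growth_power growth_mult distrib_left mult.left_commute[of "growth 1 1"] del: One_nat_def)
    also have "\<dots> \<le> 25 * growth 35 3" using growth_mono[of 17 35 3 3] growth_mono[of 10 35 3 3] by simp
    also have "\<dots> \<le> growth 36 3" using mult_growth_le[of 25 35 3] K_bounds(1) by simp
    finally show "growth 1 1 * (22 * growth 8 1 ^ 2 + 3 * (growth 1 1 * growth 8 1)) \<le> growth 36 3" .
  qed simp
  finally show ?thesis .
qed

lemma growth_36_le:
  defines "a \<equiv> cost_exponent H cM cw ce"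
  shows "growth 36 j \<le> (k / \<xi>) powr a * real n powr (a * \<epsilon> / \<phi>\<^sup>2) * ln n ^ j"
proof -
  define X where "X = k / \<xi>"
  have X: "2 \<le> X" unfolding X_def by (rule two_le_k_div_\<xi>)
  have log_K: "0 \<le> log 2 K" using K_bounds(1) by simp
  have "K = 2 powr log 2 K" using K_bounds(1) by simp
  also have "\<dots> \<le> X powr log 2 K" using X log_K by (intro powr_mono2) auto
  finally have "K * X * \<nu> 74 \<le> X powr log 2 K * X powr 1 * \<nu> 74"
    using X \<nu>_pos[of 74] by (intro mult_right_mono) auto
  also have "\<dots> \<le> X powr (74 + log 2 K) * \<nu> (74 + log 2 K)"
    unfolding powr_add[symmetric] using X log_K \<nu>_pos[of 74] by (intro mult_mono powr_mono \<nu>_mono) auto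
  finally have "(K * X * \<nu> 74) ^ 36 \<le> (X powr (74 + log 2 K) * \<nu> (74 + log 2 K)) ^ 36"
    using base_ge_K K_bounds(1) unfolding X_def by (intro power_mono) linarith+
  also have "\<dots> = X powr a * \<nu> a"
    using X by (simp add: power_mult_distrib \<nu>_power powr_power a_def cost_exponent_def mult.commute)
  finally show ?thesis unfolding growth_def X_def \<nu>_def using ln_n_ge_1 by (intro mult_right_mono) auto
qed

theorem init_oracle_costs:
  defines "a \<equiv> cost_exponent H cM cw ce"
  shows "costs (init_oracle H cw ce eig n E k \<phi> \<epsilon> \<xi> M) (\<lambda>(IS, out). length IS = s)
    ((k / \<xi>) powr a * (n * real n powr (a * \<epsilon> / \<phi>\<^sup>2)) * (ln n ^ 4 / M) * (1 / \<phi>\<^sup>2))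
    ((k / \<xi>) powr a * real n powr (a * \<epsilon> / \<phi>\<^sup>2) * M * ln n ^ 4)"
proof (rule costs_mono[OF costs_init_oracle])
  note time = order_trans[OF init_time_le[OF est_init_time_le est_time_nonneg]]
  show "reps * (s * (s * est_time (R_init H n k \<phi> \<epsilon> \<xi> M) t M)) + (real s)\<^sup>2 * sort_time reps
      + real (s + (s\<^sup>2 + ce * s ^ 3) + (k + s * k + s\<^sup>2 * k + s\<^sup>2))
    \<le> (k / \<xi>) powr a * (n * real n powr (a * \<epsilon> / \<phi>\<^sup>2)) * (ln n ^ 4 / M) * (1 / \<phi>\<^sup>2)"
    using mult_right_mono[OF growth_36_le, of "n / M * (1 / \<phi>\<^sup>2)" 4] by (intro time) (simp add: a_def mult_ac)
  show "real (word cw n * (s + 2 * s\<^sup>2 + ce * s\<^sup>2 + s * k + 8 + (reps * s\<^sup>2 + reps + 8) + (2 * M + 8)))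
    \<le> (k / \<xi>) powr a * real n powr (a * \<epsilon> / \<phi>\<^sup>2) * M * ln n ^ 4"
    using mult_right_mono[OF growth_36_le, of M 4] by (intro order_trans[OF init_space_le]) (simp add: a_def mult_ac)
qed

theorem query_dot_costs:
  assumes IS: "length IS = s"
  defines "a \<equiv> cost_exponent H cM cw ce"
  shows "costs (query_dot H cw n E k \<phi> \<epsilon> \<xi> IS \<Psi> M x y) (\<lambda>_. True)
    ((k / \<xi>) powr a * (n * real n powr (a * \<epsilon> / \<phi>\<^sup>2)) * (ln n ^ 3 / M) * (1 / \<phi>\<^sup>2))
    ((k / \<xi>) powr a * real n powr (a * \<epsilon> / \<phi>\<^sup>2) * M * ln n ^ 3)"
proof (rule costs_mono[OF costs_query_dot[OF IS]])
  note time = order_trans[OF query_time_le[OF est_query_time_le est_time_nonneg]]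
  show "2 * (reps * (s * est_time (R_query H n k \<phi> \<epsilon> \<xi> M) t M)) + 2 * (s * real (sort_time reps)) + real (2 * s\<^sup>2 + 2 * s)
    \<le> (k / \<xi>) powr a * (n * real n powr (a * \<epsilon> / \<phi>\<^sup>2)) * (ln n ^ 3 / M) * (1 / \<phi>\<^sup>2)"
    using mult_right_mono[OF growth_36_le, of "n / M * (1 / \<phi>\<^sup>2)" 3] by (intro time) (simp add: a_def mult_ac)
  show "real (word cw n * (s + s\<^sup>2 + 2 * reps * s + 2 * s + reps + 8 + (2 * M + 8)))
    \<le> (k / \<xi>) powr a * real n powr (a * \<epsilon> / \<phi>\<^sup>2) * M * ln n ^ 3"
    using mult_right_mono[OF growth_36_le, of M 3] by (intro order_trans[OF query_space_le]) (simp add: a_def mult_ac)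
qed simp

lemma oracle_size_le:
  defines "a \<equiv> cost_exponent H cM cw ce"
  shows "real (s * s) \<le> real n powr (a * \<epsilon> / \<phi>\<^sup>2) * ln n ^ 2 * (k / \<xi>) powr a"
proof -
  have "real (s * s) \<le> growth 8 1 ^ 2" using power_mono[OF s_le_growth, of 2] by (simp add: power2_eq_square)
  also have "\<dots> \<le> growth 36 2" by (simp add: growth_power growth_mono)
  also have "\<dots> \<le> real n powr (a * \<epsilon> / \<phi>\<^sup>2) * ln n ^ 2 * (k / \<xi>) powr a" using growth_36_le[of 2] by (simp add: a_def mult_ac)
  finally show ?thesis .
qed

end

end

lemma ex_sufficient_constants: "\<exists>H. positive_hidden H \<and> sufficient_constants \<beta> cM H"
proof -
  define b where "b = 7000000 * (1 + 2 * cM * sqrt (6 * \<beta>)) * \<beta> ^ 3"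
  define s where "s = 1668600 * \<beta> ^ 4 + 1"
  have "0 < s" by (simp add: s_def add_nonneg_pos)
  then have "positive_hidden \<lparr>c_s = s, c_init = \<bar>b\<bar> + 1, c_query = \<bar>b\<bar> + 1, c_reps = 8 * (140 + 2 * s)\<rparr>"
    by (simp add: positive_hidden_def)
  moreover have "sufficient_constants \<beta> cM \<lparr>c_s = s, c_init = \<bar>b\<bar> + 1, c_query = \<bar>b\<bar> + 1, c_reps = 8 * (140 + 2 * s)\<rparr>"
    unfolding sufficient_constants_def b_def[symmetric] by (simp add: s_def)
  ultimately show ?thesis by blast
qed

theorem theorem4:
  fixes \<beta> cM :: real
  shows "\<exists>H. positive_hidden H \<and> (\<forall>cw ce :: nat. \<exists>a::real. \<forall>(k::nat) (n::nat) (d::nat) (E::edges)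
      (\<phi>::real) (\<epsilon>::real) (\<xi>::real) (Mi::nat) (Mq::nat) lam u eig.
    k \<ge> 2 \<longrightarrow> 0 < \<epsilon> \<longrightarrow> \<epsilon> < 1 \<longrightarrow> 0 < \<phi> \<longrightarrow> \<phi> < 1 \<longrightarrow> \<epsilon> / \<phi>\<^sup>2 \<le> 1 / 10 ^ 5 \<longrightarrow>
    regular_graph n d E \<longrightarrow> clusterable \<beta> k \<phi> \<epsilon> n E \<longrightarrow>
    1 / real n ^ 5 < \<xi> \<longrightarrow> \<xi> < 1 \<longrightarrow>
    1 \<le> Mi \<longrightarrow> real Mi \<le> cM * (real n powr (1/2 - 20 * \<epsilon> / \<phi>\<^sup>2) / real k) \<longrightarrow>
    1 \<le> Mq \<longrightarrow> real Mq \<le> cM * (real n powr (1/2 - 20 * \<epsilon> / \<phi>\<^sup>2) / real k) \<longrightarrow>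
    ordered_eigenbasis n (laplacian n d E) lam u \<longrightarrow> eigensolver eig \<longrightarrow>
    (let f = spectral_embedding k u;
         init = init_oracle H cw ce eig n E k \<phi> \<epsilon> \<xi> Mi;
         query = (\<lambda>IS \<Psi> x y. query_dot H cw n E k \<phi> \<epsilon> \<xi> IS \<Psi> Mq x y);
         poly = (real k / \<xi>) powr a;
         small = real n powr (a * \<epsilon> / \<phi>\<^sup>2)
     in
       measure_pmf.prob (result init)
         {(IS, out). \<exists>\<Psi>. out = Some \<Psi> \<and>
            real (dim_row \<Psi> * dim_col \<Psi>) \<le> small * ln (real n) ^ 2 * poly \<and>
            (\<forall>x<n. \<forall>y<n.
               measure_pmf.prob (result (query IS \<Psi> x y))
                 {z. \<bar>z - f x \<bullet> f y\<bar> \<le> \<xi> / real n} \<ge> 1 - 6 / real n ^ 100)}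
         \<ge> 1 - 2 / real n ^ 100 \<and>
       (\<forall>((IS, out), T_init, S_init) \<in> set_pmf (run init).
          real S_init \<le> poly * small * real Mi * ln (real n) ^ 4 \<and>
          real T_init \<le> poly * (real n * small) * (ln (real n) ^ 4 / real Mi) * (1 / \<phi>\<^sup>2) \<and>
          (\<forall>\<Psi> x y. out = Some \<Psi> \<longrightarrow> x < n \<longrightarrow> y < n \<longrightarrow>
            (\<forall>(z, T_query, S_query) \<in> set_pmf (run (query IS \<Psi> x y)).
               real S_query \<le> poly * small * real Mq * ln (real n) ^ 3 \<and>
               real T_query \<le> poly * (real n * small) * (ln (real n) ^ 3 / real Mq) * (1 / \<phi>\<^sup>2))))))"
proof -
  obtain H where H: "positive_hidden H" "sufficient_constants \<beta> cM H" using ex_sufficient_constants by blast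
  show ?thesis
  proof (rule exI[of _ H], intro conjI H(1) allI, goal_cases costs)
    case (costs cw ce)
    show ?case
    proof (rule exI[of _ "cost_exponent H cM cw ce"], intro allI impI, goal_cases input)
      case (input k n d E \<phi> \<epsilon> \<xi> Mi Mq lam u eig)
      note eig = \<open>eigensolver eig\<close>
      obtain C where "clustering \<beta> k \<phi> \<epsilon> n E C" using input by (auto simp: clusterable_iff_clustering)
      then interpret oracle_setup n d E lam u k \<phi> \<epsilon> \<beta> C \<xi> H cM
        using input H(2) by unfold_locales
      have Mi: "feasible Mi" and Mq: "feasible Mq" using input by (auto simp: feasible_def)
      show ?case
        unfolding Let_def
        by (rule conjI, rule order_trans[OF init_oracle_correct[OF Mi Mq eig] measure_pmf.finite_measure_mono])
           (use oracle_size_le[OF Mi] init_oracle_costs[OF Mi] query_dot_costs[OF Mq] in \<open>fastforce simp: costs_def\<close>)+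
    qed
  qed
qed

end
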